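(* Suppose the weight sequence $\mathbf{w}$ has type I. Let $v_0$ be a uniformly random vertex of the simply generated tree $\mathcal{T}_n$. Then, as $n\to\infty$ (with $n\equiv 1 \bmod \mathrm{span}(\mathbf{w})$), the pointed tree $(\mathcal{T}_n,v_0)$ converges in distribution to $\mathcal{T}^*$ in the space $\mathfrak{T}^\bullet$.
   Context: A weight sequence $\mathbf{w}=(\omega_k)_{k\ge0}$ consists of non-negative reals with $\omega_0>0$ and $\omega_k>0$ for some $k\ge2$; $\mathrm{span}(\mathbf{w})=\gcd\{i\ge0:\omega_i>0\}$. A plane tree is a rooted tree whose offspring sets are linearly ordered; $d^+_T(v)$ is the outdegree and $\mathrm{h}_T(v)$ the height (distance to root). The weight of a finite plane tree is $\omega(T)=\prod_{v\in T}\omega_{d^+_T(v)}$, and $\mathcal{T}_n$ is a random plane tree with $n$ vertices drawn with probability proportional to its weight (only $n\equiv 1\bmod\mathrm{span}(\mathbf{w})$, $n$ large, are considered). Let $\phi(z)=\sum_k\omega_kz^k$ with radius of convergence $\rho_\phi$, and $\psi(t)=t\phi'(t)/\phi(t)$. If $\rho_\phi>0$ let $\nu=\lim_{t\nearrow\rho_\phi}\psi(t)\in(0,\infty]$. Type I: $\rho_\phi>0$, $\nu\ge1$, and $\tau$ is the unique number with $\psi(\tau)=1$. Type II: $\rho_\phi>0$, $0<\nu<1$, $\tau:=\rho_\phi$. Type III: $\rho_\phi=0$, $\nu:=0$, $\tau:=0$. Let $\xi$ be a random variable with $\Pr{\xi=k}=\pi_k=\tau^k\omega_k/\phi(\tau)$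 (so $\xi=0$ a.s. in type III), $\mu=\mathbb{E}[\xi]=\min(\nu,1)$, and $\mathcal{T}$ a Galton–Watson tree with offspring distribution $\xi$. The size-biased variable $\hat\xi$ takes values in $\mathbb{N}\cup\{\infty\}$ with $\Pr{\hat\xi=k}=k\pi_k$ and $\Pr{\hat\xi=\infty}=1-\mu$. Space $\mathfrak{T}^\bullet$: let $\mathcal{U}^\bullet_\infty$ be the infinite tree with a backward spine $u_0,u_1,\dots$ ($u_i$ parent of $u_{i-1}$), where each $u_i$, $i\ge1$, has infinitely many ordered children to the left and to the right of $u_{i-1}$ (indexed by $\mathbb{Z}\setminus\{0\}$ relative to $u_{i-1}$), each non-spine child and $u_0$ being the root of a copy of the Ulam–Harris tree (vertices = finite sequences of positive integers). A pointed plane tree $(T,v)$ with path $v=v_0,v_1,\dots,v_k$ = root is embedded into $\mathcal{U}^\bullet_\infty$ order- and degree-preservingly with $v_i\mapsto u_i$; more generally, elements of $\mathfrak{T}^\bullet$ are "trees" encoded by families $(d^+(x))_{x\in\mathcal{U}^\bullet_\infty}$ with $d^+(x)\in\overline{\mathbb{N}}_0=\mathbb{N}_0\cup\{\infty\}$ for $x\notin\{u_1,u_2,\dots\}$ and $d^+(u_i)\in\{*\}\sqcup(\overline{\mathbb{N}}_0\times\overline{\mathbb{N}}_0)$ for $i\ge1$, where $(a,b)$ gives the numbers of children of $u_i$ to the left and to the right of $u_{i-1}$ and $*$ means $u_i$ is not a vertex (the spine has ended). $\overline{\mathbb{N}}_0$ carries the one-point compactification topology, and $\mathfrak{T}^\bullet$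 (the closed subset of families that describe trees) carries the product topology; it is compact Polish. Convergence in $\mathfrak{T}^\bullet$ means convergence of $d^+(x)$ for every $x$. The limit tree $\mathcal{T}^*$ (type I, where $\hat\xi<\infty$ a.s.): $u_0$ is the root of an independent copy of $\mathcal{T}$; for every $i\ge1$, $u_i$ receives an independent copy of $\hat\xi$ many children, $u_{i-1}$ is identified with a uniformly random one of them, and every other child is the root of an independent copy of $\mathcal{T}$. $\mathcal{T}^*$ is pointed at $u_0$. *)

theory Defs
  imports "HOL-Analysis.Analysis" "HOL-Library.Extended_Real" "HOL-Library.Countable"
begin

section \<open>Weight sequences and their type\<close>

definition weight_seq :: "(nat \<Rightarrow> real) \<Rightarrow> bool" where
  "weight_seq w \<longleftrightarrow> (\<forall>k. 0 \<le> w k) \<and> 0 < w 0 \<and> (\<exists>k\<ge>2. 0 < w k)"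

definition wspan :: "(nat \<Rightarrow> real) \<Rightarrow> nat" where
  "wspan w = Gcd {i. 0 < w i}"

text \<open>phi(z) = sum_k w_k z^k, its (termwise) derivative, psi(t) = t phi'(t) / phi(t).\<close>
definition phi :: "(nat \<Rightarrow> real) \<Rightarrow> real \<Rightarrow> real" where
  "phi w t = (\<Sum>k. w k * t ^ k)"

definition dphi :: "(nat \<Rightarrow> real) \<Rightarrow> real \<Rightarrow> real" where
  "dphi w t = (\<Sum>k. real (Suc k) * w (Suc k) * t ^ k)"

definition psi :: "(nat \<Rightarrow> real) \<Rightarrow> real \<Rightarrow> real" where
  "psi w t = t * dphi w t / phi w t"

definition rho :: "(nat \<Rightarrow> real) \<Rightarrow> ereal" where
  "rho w = conv_radius w"

text \<open>nu = lim_{t -> rho from the left} psi(t), in (0, infinity].\<close>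
definition nu :: "(nat \<Rightarrow> real) \<Rightarrow> ereal" where
  "nu w = Lim (if rho w = \<infinity> then at_top else at_left (real_of_ereal (rho w)))
              (\<lambda>t. ereal (psi w t))"

definition typeI :: "(nat \<Rightarrow> real) \<Rightarrow> bool" where
  "typeI w \<longleftrightarrow> 0 < rho w \<and> 1 \<le> nu w"

text \<open>In type I, tau is the unique number with psi(tau) = 1 (possibly tau = rho, where
  the series are required to converge).\<close>
definition tau :: "(nat \<Rightarrow> real) \<Rightarrow> real" where
  "tau w = (THE t. 0 < t \<and> ereal t \<le> rho w \<and> summable (\<lambda>k. w k * t ^ k)
              \<and> summable (\<lambda>k. real (Suc k) * w (Suc k) * t ^ k) \<and> psi w t = 1)"

definition pik :: "(nat \<Rightarrow> real) \<Rightarrow> nat \<Rightarrow> real" where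
  "pik w k = tau w ^ k * w k / phi w (tau w)"

section \<open>Finite plane trees and the simply generated tree T_n\<close>

datatype ptree = Node "ptree list"

fun tsize :: "ptree \<Rightarrow> nat" where
  "tsize (Node ts) = Suc (sum_list (map tsize ts))"

fun tweight :: "(nat \<Rightarrow> real) \<Rightarrow> ptree \<Rightarrow> real" where
  "tweight w (Node ts) = w (length ts) * prod_list (map (tweight w) ts)"

text \<open>Vertices are addressed by 0-based Ulam--Harris words.\<close>
lemma size_nth_less: "i < length ts \<Longrightarrow> size (ts ! i) < Suc (size_list size ts)"
  by (rule less_Suc_eq_le[THEN iffD2], rule size_list_estimation'[OF nth_mem]) auto

function isaddr :: "ptree \<Rightarrow> nat list \<Rightarrow> bool" where
  "isaddr (Node ts) [] = True"
| "isaddr (Node ts) (i # u) = (if i < length ts then isaddr (ts ! i) u else False)"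
  by pat_completeness auto
termination by (relation "Wellfounded.measure (size \<circ> fst)") (auto simp: size_nth_less)

definition addrs :: "ptree \<Rightarrow> nat list set" where
  "addrs t = {u. isaddr t u}"

text \<open>outdegree at an address (0 if the address is not a vertex)\<close>
function deg :: "ptree \<Rightarrow> nat list \<Rightarrow> nat" where
  "deg (Node ts) [] = length ts"
| "deg (Node ts) (i # u) = (if i < length ts then deg (ts ! i) u else 0)"
  by pat_completeness auto
termination by (relation "Wellfounded.measure (size \<circ> fst)") (auto simp: size_nth_less)

definition Zn :: "(nat \<Rightarrow> real) \<Rightarrow> nat \<Rightarrow> real" where
  "Zn w n = (\<Sum>t\<in>{t. tsize t = n}. tweight w t)"

section \<open>The space T-bullet\<close>

text \<open>Vertices of U-bullet-infinity other than the spine vertices u_1, u_2, ...: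
  \<open>Below0 ws\<close> is the Ulam--Harris descendant ws (0-based word) of u_0;
  \<open>Side i l j ws\<close> is the descendant ws of the (j+1)-th nearest child of u_(i+1)
  on the left (l = True) resp. right (l = False) of u_i.
  Spine vertex u_(i+1) is indexed by i :: nat.\<close>
datatype uvert = Below0 "nat list" | Side nat bool nat "nat list"

instance uvert :: countable by countable_datatype

text \<open>A configuration: outdegrees in N-bar_0 = enat (order topology = one-point
  compactification) at non-spine vertices, and at u_(i+1) a value in
  {*} + N-bar_0 x N-bar_0, encoded as (True,0,0) for * and (False,a,b) for (a,b)
  (bool is discrete, so this is a homeomorphic copy).\<close>
type_synonym cfg = "(uvert \<Rightarrow> enat) \<times> (nat \<Rightarrow> bool \<times> enat \<times> enat)"

definition spine_vertex :: "cfg \<Rightarrow> nat \<Rightarrow> bool" where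
  "spine_vertex F i \<longleftrightarrow> \<not> fst (snd F i)"

fun isv :: "cfg \<Rightarrow> uvert \<Rightarrow> bool" where
  "isv F (Below0 ws) = (\<forall>k<length ws. enat (ws ! k) < fst F (Below0 (take k ws)))"
| "isv F (Side i l j ws) =
     (spine_vertex F i \<and>
      enat j < (if l then fst (snd (snd F i)) else snd (snd (snd F i))) \<and>
      (\<forall>k<length ws. enat (ws ! k) < fst F (Side i l j (take k ws))))"

definition Tbullet :: "cfg set" where
  "Tbullet = {F. (\<forall>x. \<not> isv F x \<longrightarrow> fst F x = 0) \<and>
                 (\<forall>i. fst (snd F i) \<longrightarrow> snd (snd F i) = (0, 0) \<and> fst (snd F (Suc i)))}"

text \<open>Embedding of a pointed finite plane tree (t, v), v an address of t with path
  v = v_0, ..., v_k = root, v_i = take (k - i) v mapped to u_i.\<close>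
definition enc :: "ptree \<Rightarrow> nat list \<Rightarrow> cfg" where
  "enc t v =
    (let k = length v in
     (\<lambda>x. case x of
        Below0 ws \<Rightarrow> enat (deg t (v @ ws))
      | Side i l j ws \<Rightarrow>
          (if Suc i \<le> k then
             (let p = take (k - Suc i) v; c = v ! (k - Suc i) in
              if l then (if j < c then enat (deg t (p @ [c - Suc j] @ ws)) else 0)
              else (if c + Suc j < deg t p then enat (deg t (p @ [c + Suc j] @ ws)) else 0))
           else 0),
      \<lambda>i. if Suc i \<le> k then
             (let p = take (k - Suc i) v; c = v ! (k - Suc i) in
              (False, enat c, enat (deg t p - Suc c)))
           else (True, 0, 0)))"

text \<open>E[f(T_n, v_0)] for a uniformly random vertex v_0 of T_n.\<close>
definition ETn :: "(nat \<Rightarrow> real) \<Rightarrow> nat \<Rightarrow> (cfg \<Rightarrow> real) \<Rightarrow> real" where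
  "ETn w n f = (\<Sum>t\<in>{t. tsize t = n}.
                  tweight w t / Zn w n * ((\<Sum>v\<in>addrs t. f (enc t v)) / real n))"

section \<open>The limit tree T-star\<close>

text \<open>Offspring law xi on N_0.\<close>
definition xi_measure :: "(nat \<Rightarrow> real) \<Rightarrow> nat measure" where
  "xi_measure w = density (count_space UNIV) (\<lambda>k. ennreal (pik w k))"

text \<open>Law of (hat-xi, position of u_(i-1) among the hat-xi children): hat-xi = k with
  probability k pi_k, then a uniformly random position p < k.\<close>
definition spine_measure :: "(nat \<Rightarrow> real) \<Rightarrow> (nat \<times> nat) measure" where
  "spine_measure w = density (count_space UNIV)
     (\<lambda>(k, p). ennreal (real k * pik w k * (if p < k then 1 / real k else 0)))"

text \<open>Independent labels: xi-distributed outdegree for every non-spine vertex of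
  U-bullet-infinity, (hat-xi, position) for every u_(i+1).\<close>
definition label_space :: "(nat \<Rightarrow> real) \<Rightarrow> ((uvert \<Rightarrow> nat) \<times> (nat \<Rightarrow> nat \<times> nat)) measure" where
  "label_space w = (PiM UNIV (\<lambda>_. xi_measure w)) \<Otimes>\<^sub>M (PiM UNIV (\<lambda>_. spine_measure w))"

definition raw_cfg :: "(uvert \<Rightarrow> nat) \<times> (nat \<Rightarrow> nat \<times> nat) \<Rightarrow> cfg" where
  "raw_cfg \<omega> = ((\<lambda>x. enat (fst \<omega> x)),
                 (\<lambda>i. (False, enat (snd (snd \<omega> i)), enat (fst (snd \<omega> i) - Suc (snd (snd \<omega> i))))))"

text \<open>Pruning: only vertices reachable keep their outdegree (the GW copies hanging off
  u_0 and the non-spine children are the GW trees built from the i.i.d. labels).\<close>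
definition Tstar_of :: "(uvert \<Rightarrow> nat) \<times> (nat \<Rightarrow> nat \<times> nat) \<Rightarrow> cfg" where
  "Tstar_of \<omega> = (let F = raw_cfg \<omega> in ((\<lambda>x. if isv F x then fst F x else 0), snd F))"

text \<open>E[f(T-star)].\<close>
definition ETstar :: "(nat \<Rightarrow> real) \<Rightarrow> (cfg \<Rightarrow> real) \<Rightarrow> real" where
  "ETstar w f = (\<integral>\<omega>. f (Tstar_of \<omega>) \<partial>label_space w)"

end

theory Submission
  imports Defs "HOL-Probability.Infinite_Product_Measure"
    "HOL-Computational_Algebra.Formal_Power_Series" "HOL-Computational_Algebra.Group_Closure"
begin

text \<open>
  Tilting by \<open>\<tau>\<close> turns \<open>T\<^sub>n\<close> into a Galton--Watson tree with critical offspring law \<open>\<pi>\<close>, conditioned on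
  having \<open>n\<close> vertices. The \<open>h\<close>-th ancestor of \<open>v\<^sub>0\<close> has the pointed fringe subtree \<open>(t, v)\<close> with
  probability \<open>E N\<^sub>t(T\<^sub>n) / n\<close>, where \<open>N\<^sub>t\<close> counts the fringe subtrees equal to \<open>t\<close>, while in the limit tree
  this event has probability \<open>\<pi>(t) = \<Prod>\<^sub>u \<pi>(d(u))\<close>. These numbers add up to 1 over the pairs \<open>(t, v)\<close> with
  \<open>v\<close> at height \<open>h\<close>, because a critical tree is almost surely finite and has mean generation size 1; so no mass is
  lost and it suffices to show \<open>E N\<^sub>t(T\<^sub>n) / n \<longlongrightarrow> \<pi>(t)\<close> for every finite \<open>t\<close>.

  Peeling off roots one by one gives \<open>E N\<^sub>t(T\<^sub>n) / n = \<pi>(t) P(S\<^sub>n\<^sub>-\<^sub>k = n - k) / P(S\<^sub>n = n - 1)\<close> with \<open>k = |t|\<close> and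
  \<open>S\<close> the random walk with step law \<open>\<pi>\<close>. The mean size of the critical tree is infinite, so
  \<open>P(S\<^sub>n = n - 1)\<close> does not decay exponentially. A Chernoff bound then shows that, conditionally on \<open>S\<^sub>n = n - 1\<close>,
  the proportion of steps equal to \<open>j\<close> tends to \<open>\<pi>\<^sub>j\<close>, i.e. \<open>P(S\<^sub>n\<^sub>-\<^sub>1 = n - 1 - j) / P(S\<^sub>n = n - 1) \<longlongrightarrow> 1\<close>;
  iterating along the outdegrees of \<open>t\<close> yields the claim without any moment assumption beyond the mean.
\<close>

section \<open>Type I weight sequences\<close>

text \<open>The obstacle: the offspring law may have infinite variance and any span, so no Gaussian
  local limit theorem applies; only crude information on P(S_n = n - 1) is used. It equals n times
  the probability that the Galton-Watson tree has n vertices, so these numbers sum to the mean total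
  progeny, which is infinite because each generation has mean size 1. Hence they are at least a^n
  infinitely often, for every a < 1. Bridges can be concatenated, which extends this to all large
  admissible n, and events of exponentially small probability stay negligible under the
  conditioning.

  Neither tightness nor uniform continuity enters: for a fixed bounded continuous f, almost every
  realisation of the limit tree lies in a cylinder on which f is nearly constant, and finitely many
  such cylinders carry almost all the mass. Convergence of finitely many fringe proportions shows
  that the same patterns then cover almost all choices of v_0 in T_n, and for both trees the
  remainder costs at most sup |f| times a small probability.\<close>

definition conv_at :: "(nat \<Rightarrow> real) \<Rightarrow> real \<Rightarrow> bool" where
  "conv_at w t \<longleftrightarrow> summable (\<lambda>k. w k * t ^ k) \<and> summable (\<lambda>k. real (Suc k) * w (Suc k) * t ^ k)"

lemma conv_at_sums:
  assumes "conv_at w t"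
  shows "(\<lambda>k. w k * t ^ k) sums phi w t" "(\<lambda>k. real k * (w k * t ^ k)) sums (t * dphi w t)"
proof -
  show "(\<lambda>k. w k * t ^ k) sums phi w t"
    using assms by (simp add: conv_at_def phi_def summable_sums)
  have "(\<lambda>k. real (Suc k) * w (Suc k) * t ^ k) sums dphi w t"
    using assms by (simp add: conv_at_def dphi_def summable_sums)
  from sums_mult[OF this, of t]
  have "(\<lambda>k. real (Suc k) * (w (Suc k) * t ^ Suc k)) sums (t * dphi w t)"
    by (simp add: algebra_simps)
  then show "(\<lambda>k. real k * (w k * t ^ k)) sums (t * dphi w t)"
    by (subst (asm) sums_Suc_iff) simp
qed

lemma conv_at_sums_shifted:
  assumes "conv_at w t"
  shows "(\<lambda>k. (real k - m) * (w k * t ^ k)) sums (t * dphi w t - m * phi w t)"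
  using sums_diff[OF conv_at_sums(2)[OF assms] sums_mult[OF conv_at_sums(1)[OF assms], of m]]
  by (simp add: algebra_simps)

lemma phi_pos:
  assumes "weight_seq w" "conv_at w t" "0 \<le> t"
  shows "0 < phi w t"
proof -
  have "0 < w 0 * t ^ 0" using assms(1) by (simp add: weight_seq_def)
  also have "\<dots> \<le> phi w t"
    unfolding phi_def using assms
    by (intro sum_le_suminf[of _ "{0}", simplified]) (auto simp: conv_at_def weight_seq_def)
  finally show ?thesis .
qed

lemma conv_at_less_rho:
  assumes "0 \<le> t" "ereal t < rho w"
  shows "conv_at w t"
proof -
  obtain K where K: "ereal t < ereal K" "ereal K < rho w"
    using assms(2) ereal_dense2 by blast
  have "summable (\<lambda>n. diffs w n * t ^ n)"
  proof (rule termdiff_converges)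
    show "norm t < K" using K assms by simp
    fix x :: real assume "norm x < K"
    then have "ereal (norm x) < rho w" using K(2) by (meson ereal_less(2) less_ereal.simps(1) less_trans)
    then show "summable (\<lambda>n. w n * x ^ n)"
      unfolding rho_def by (rule summable_in_conv_radius)
  qed
  moreover have "summable (\<lambda>n. w n * t ^ n)"
    using assms unfolding rho_def by (intro summable_in_conv_radius) simp
  ultimately show ?thesis by (simp add: conv_at_def diffs_def)
qed

text \<open>\<open>psi w t\<close> is the mean of the law with weights w_k t^k / phi(t). Put m =
  psi(s) and r = t / s: the sum of (k - m) w_k s^k vanishes, and replacing the constant factor r^m
  by r^k does not decrease any term, because (k - m)(r^k - r^m) >= 0.\<close>

lemma psi_mono:
  assumes w: "weight_seq w" and st: "0 < s" "s \<le> t" and c: "conv_at w s" "conv_at w t"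
  shows "psi w s \<le> psi w t"
proof -
  define m where "m = psi w s"
  define r where "r = t / s"
  have r: "1 \<le> r" using st by (simp add: r_def)
  have ps: "0 < phi w s" "0 < phi w t" using phi_pos[OF w] c st by auto
  have 0: "s * dphi w s - m * phi w s = 0" using ps by (simp add: m_def psi_def)
  have A: "(\<lambda>k. r powr m * ((real k - m) * (w k * s ^ k))) sums 0"
    using sums_mult[OF conv_at_sums_shifted[OF c(1), of m], of "r powr m"] 0 by simp
  have "0 \<le> t * dphi w t - m * phi w t"
  proof (rule sums_le[OF _ A conv_at_sums_shifted[OF c(2), of m]])
    fix k
    have tk: "t ^ k = r powr real k * s ^ k"
      using st r by (simp add: r_def powr_realpow power_divide)
    have "r powr m * (real k - m) \<le> r powr real k * (real k - m)"
    proof (cases "m \<le> real k")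
      case True
      then show ?thesis using r by (intro mult_right_mono powr_mono) auto
    next
      case False
      then show ?thesis using r by (intro mult_right_mono_neg powr_mono) auto
    qed
    then have "(r powr m * (real k - m)) * (w k * s ^ k) \<le> (r powr real k * (real k - m)) * (w k * s ^ k)"
      using w st by (rule_tac mult_right_mono) (auto simp: weight_seq_def)
    then show "r powr m * ((real k - m) * (w k * s ^ k)) \<le> (real k - m) * (w k * t ^ k)"
      by (simp add: tk mult_ac)
  qed
  then show ?thesis
    using ps by (simp add: m_def[symmetric] psi_def[of w t] pos_le_divide_eq)
qed

text \<open>Monotonicity makes the limit in \<open>nu\<close> exist, so \<open>Lim\<close> is not an
  arbitrary value; the supremum also treats finite and infinite radius alike.\<close>

lemma nu_eq_SUP:
  assumes w: "weight_seq w" and "0 < rho w"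
  shows "nu w = (SUP t\<in>{t. 0 < t \<and> ereal t < rho w}. ereal (psi w t))"
proof -
  define F where "F = (if rho w = \<infinity> then at_top else at_left (real_of_ereal (rho w)))"
  define I where "I = {t. 0 < t \<and> ereal t < rho w}"
  have F: "F \<noteq> bot" by (simp add: F_def)
  have ev: "\<forall>\<^sub>F t in F. s < t \<and> ereal t < rho w" if "ereal s < rho w" for s
  proof (cases "rho w")
    case (real r)
    then have "s < r" using that by simp
    then have "\<forall>\<^sub>F t in at_left r. t \<in> {s<..<r}" by (intro eventually_at_leftI[of s]) auto
    then show ?thesis using real by (auto simp: F_def elim: eventually_mono)
  next
    case PInf
    then show ?thesis by (simp add: F_def eventually_gt_at_top)
  qed (use assms in auto)
  have ev0: "\<forall>\<^sub>F t in F. t \<in> I" using ev[of 0] assms by (simp add: I_def zero_ereal_def)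
  have "((\<lambda>t. ereal (psi w t)) \<longlongrightarrow> (SUP t\<in>I. ereal (psi w t))) F"
  proof (rule increasing_tendsto)
    show "\<forall>\<^sub>F t in F. ereal (psi w t) \<le> (SUP t\<in>I. ereal (psi w t))"
      using ev0 by eventually_elim (auto intro: SUP_upper)
    fix x assume "x < (SUP t\<in>I. ereal (psi w t))"
    then obtain s where s: "s \<in> I" "x < ereal (psi w s)" by (auto simp: less_SUP_iff)
    from s have "ereal s < rho w" by (simp add: I_def)
    from ev[OF this] show "\<forall>\<^sub>F t in F. x < ereal (psi w t)"
    proof eventually_elim
      case (elim t)
      then have "psi w s \<le> psi w t"
        using s by (intro psi_mono[OF w] conv_at_less_rho) (auto simp: I_def)
      then show ?case using s(2) by (meson ereal_less_eq(3) less_le_trans)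
    qed
  qed
  then show ?thesis unfolding nu_def using F by (simp add: F_def I_def tendsto_Lim)
qed

text \<open>The excess is the series with terms (k - 1) w_k t^k. Only the constant term at k = 0 is
  negative, and some k >= 2 has positive weight, so it increases strictly, up to and including a
  boundary point. Its zeros are the solutions of psi = 1, hence the uniqueness of
  \<open>tau\<close>.\<close>

lemma excess_strict_mono:
  assumes w: "weight_seq w" and st: "0 \<le> s" "s < t" and c: "conv_at w s" "conv_at w t"
  shows "s * dphi w s - phi w s < t * dphi w t - phi w t"
proof -
  obtain k0 where k0: "k0 \<ge> 2" "0 < w k0" using w by (auto simp: weight_seq_def)
  have le: "(real k - 1) * (w k * s ^ k) \<le> (real k - 1) * (w k * t ^ k)" for k
  proof (cases "k = 0")
    case False
    then show ?thesis using st w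
      by (intro mult_left_mono power_mono) (auto simp: weight_seq_def)
  qed simp
  have "s ^ k0 < t ^ k0" using st k0 by (intro power_strict_mono) auto
  then have lt: "(real k0 - 1) * (w k0 * s ^ k0) < (real k0 - 1) * (w k0 * t ^ k0)"
    using k0 by simp
  have A: "(\<lambda>k. (real k - 1) * (w k * t ^ k) - (real k - 1) * (w k * s ^ k))
     sums ((t * dphi w t - phi w t) - (s * dphi w s - phi w s))"
    using sums_diff[OF conv_at_sums_shifted[OF c(2), of 1] conv_at_sums_shifted[OF c(1), of 1]] by simp
  have "0 < (\<Sum>k. (real k - 1) * (w k * t ^ k) - (real k - 1) * (w k * s ^ k))"
    using le lt by (intro suminf_pos2[of _ k0] sums_summable[OF A]) (auto simp: less_diff_eq)
  then show ?thesis using sums_unique[OF A] by simp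
qed

lemma psi_eq_1_iff:
  assumes "weight_seq w" "conv_at w t" "0 \<le> t"
  shows "psi w t = 1 \<longleftrightarrow> t * dphi w t - phi w t = 0"
  using phi_pos[OF assms] by (auto simp: psi_def field_simps)

text \<open>If the excess stays nonpositive below r, the terms with k >= 2 sum to at most w_0,
  uniformly in t < r. The bound survives t -> r in each partial sum, so the series of (k - 1) w_k
  r^k converges, and it controls both series of \<open>conv_at\<close>.\<close>

lemma conv_at_boundary:
  assumes w: "weight_seq w" and r: "0 < r" "rho w = ereal r"
    and neg: "\<And>t. 0 < t \<Longrightarrow> t < r \<Longrightarrow> t * dphi w t \<le> phi w t"
  shows "conv_at w r"
proof -
  have w0: "w k \<ge> 0" for k using w by (simp add: weight_seq_def)
  have bound: "(\<Sum>k=2..<n. (real k - 1) * (w k * t ^ k)) \<le> w 0" if t: "0 < t" "t < r" for t n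
  proof -
    have c: "conv_at w t" using t r by (intro conv_at_less_rho) auto
    have "(\<Sum>k\<in>{0} \<union> {2..<n}. (real k - 1) * (w k * t ^ k)) \<le> (\<Sum>k. (real k - 1) * (w k * t ^ k))"
      using w0 t
      by (intro sum_le_suminf sums_summable[OF conv_at_sums_shifted[OF c, of 1]]) 
         (auto simp: Suc_le_eq)
    also have "\<dots> \<le> 0"
      using sums_unique[OF conv_at_sums_shifted[OF c, of 1]] neg[OF t] by simp
    finally show ?thesis by (subst (asm) sum.union_disjoint) auto
  qed
  have bound_r: "(\<Sum>k=2..<n. (real k - 1) * (w k * r ^ k)) \<le> w 0" for n
  proof (rule tendsto_upperbound)
    show "((\<lambda>t. \<Sum>k=2..<n. (real k - 1) * (w k * t ^ k)) \<longlongrightarrow> (\<Sum>k=2..<n. (real k - 1) * (w k * r ^ k))) (at_left r)"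
      by (intro tendsto_intros)
    have "\<forall>\<^sub>F t in at_left r. t \<in> {0<..<r}" using r by (intro eventually_at_leftI[of 0]) auto
    then show "\<forall>\<^sub>F t in at_left r. (\<Sum>k=2..<n. (real k - 1) * (w k * t ^ k)) \<le> w 0"
      by eventually_elim (use bound in auto)
  qed simp
  have "summable (\<lambda>k. (real (k+2) - 1) * (w (k+2) * r ^ (k+2)))"
  proof (rule summableI_nonneg_bounded)
    fix n
    show "0 \<le> (real (n + 2) - 1) * (w (n + 2) * r ^ (n + 2))" using w0 r by simp
    show "(\<Sum>k<n. (real (k + 2) - 1) * (w (k + 2) * r ^ (k + 2))) \<le> w 0"
      using bound_r[of "n+2"] sum.shift_bounds_nat_ivl[of "\<lambda>k. (real k - 1) * (w k * r ^ k)" 0 2 n]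
      by (simp only: atLeast0LessThan add_0)
  qed
  then have S: "summable (\<lambda>k. (real k - 1) * (w k * r ^ k))" by (subst (asm) summable_iff_shift)
  have "summable (\<lambda>k. w k * r ^ k)"
  proof (rule summable_comparison_test_ev[OF _ S])
    show "\<forall>\<^sub>F k in sequentially. norm (w k * r ^ k) \<le> (real k - 1) * (w k * r ^ k)"
      using eventually_ge_at_top[of 2]
    proof eventually_elim
      case (elim k)
      have "1 * (w k * r ^ k) \<le> (real k - 1) * (w k * r ^ k)"
        using elim w0 r by (intro mult_right_mono) auto
      then show ?case using w0 r by simp
    qed
  qed
  moreover from summable_add[OF this S] have "summable (\<lambda>k. real k * (w k * r ^ k))"
    by (simp add: algebra_simps)
  then have "summable (\<lambda>k. real (Suc k) * (w (Suc k) * r ^ Suc k))"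
    by (subst (asm) summable_Suc_iff[symmetric])
  then have "summable (\<lambda>k. 1 / r * (real (Suc k) * (w (Suc k) * r ^ Suc k)))"
    by (rule summable_mult)
  then have "summable (\<lambda>k. real (Suc k) * w (Suc k) * r ^ k)"
    using r by (simp add: mult_ac)
  ultimately show ?thesis by (simp add: conv_at_def)
qed

lemma continuous_on_excess:
  assumes "ereal b < rho w"
  shows "continuous_on {0..b} (\<lambda>t. t * dphi w t - phi w t)"
proof -
  obtain K where K: "ereal b < ereal K" "ereal K < rho w"
    using assms ereal_dense2 by blast
  have s: "summable (\<lambda>n. w n * x ^ n)" if "norm x < K" for x
    unfolding rho_def using that K(2) 
    by (intro summable_in_conv_radius) (metis less_ereal.simps(1) less_trans rho_def)
  have d: "DERIV (\<lambda>x. \<Sum>n. w n * x ^ n) x :> (\<Sum>n. diffs w n * x ^ n)" if "norm x < K" for x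
    using termdiffs_strong'[OF s that] by simp
  have d2: "DERIV (\<lambda>x. \<Sum>n. diffs w n * x ^ n) x :> (\<Sum>n. diffs (diffs w) n * x ^ n)" if "norm x < K" for x
    using termdiffs_strong'[OF termdiff_converges[OF _ s] that] by simp
  have [simp]: "phi w = (\<lambda>x. \<Sum>n. w n * x ^ n)" "dphi w = (\<lambda>x. \<Sum>n. diffs w n * x ^ n)"
    by (auto simp: fun_eq_iff phi_def dphi_def diffs_def)
  show ?thesis
  proof (intro continuous_at_imp_continuous_on ballI)
    fix x assume "x \<in> {0..b}"
    then have x: "norm x < K" using K by auto
    have "isCont (phi w) x" "isCont (dphi w) x" using d[OF x] d2[OF x] DERIV_isCont by (simp, blast)+
    then show "isCont (\<lambda>t. t * dphi w t - phi w t) x" by (intro continuous_intros)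
  qed
qed

text \<open>Either the excess \<open>g\<close> reaches 0 inside the disc of convergence, or it stays
  negative there. In the second case the radius is finite, both series converge on the boundary, and
  \<open>nu\<close> >= 1 forces the excess to vanish exactly there.\<close>

lemma tau_exists:
  assumes w: "weight_seq w" and I: "typeI w"
  shows "\<exists>t>0. ereal t \<le> rho w \<and> conv_at w t \<and> psi w t = 1"
proof -
  define g where "g t = t * dphi w t - phi w t" for t
  define J where "J = {t. 0 < t \<and> ereal t < rho w}"
  have rho: "0 < rho w" and nu: "1 \<le> (SUP t\<in>J. ereal (psi w t))"
    using I nu_eq_SUP[OF w] by (auto simp: typeI_def J_def)
  have cJ: "conv_at w t" if "t \<in> J" for t using that by (intro conv_at_less_rho) (auto simp: J_def)
  have g0: "g 0 < 0" using w by (simp add: g_def phi_def weight_seq_def)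
  show ?thesis
  proof (cases "\<exists>t\<in>J. 0 \<le> g t")
    case True
    then obtain b where b: "b \<in> J" "0 \<le> g b" by blast
    have "\<exists>x\<ge>0. x \<le> b \<and> g x = 0"
      using b g0 continuous_on_excess[of b w] unfolding g_def
      by (intro IVT'[of "\<lambda>t. t * dphi w t - phi w t"]) (auto simp: J_def)
    then obtain x where x: "0 \<le> x" "x \<le> b" "g x = 0" by blast
    have "x \<noteq> 0" using x g0 by auto
    then have x0: "x \<in> J" using x b unfolding J_def
      by (auto intro: le_less_trans[of "ereal x" "ereal b"])
    then show ?thesis using cJ[OF x0] psi_eq_1_iff[OF w cJ[OF x0]] x
      by (intro exI[of _ x]) (auto simp: J_def g_def)
  next
    case False
    then have neg: "g t < 0" if "t \<in> J" for t using that by force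
    obtain k where k: "k \<ge> 2" "0 < w k" using w by (auto simp: weight_seq_def)
    have "rho w \<noteq> \<infinity>"
    proof
      assume inf: "rho w = \<infinity>"
      \<comment> \<open>Chosen so that w_k t = w_k + w_0: the k-th term alone then outweighs the
        only negative term, -w_0.\<close>
      define t where "t = 1 + w 0 / w k"
      have t: "t \<in> J" using k w inf by (auto simp: J_def t_def weight_seq_def add_pos_nonneg)
      have t1: "t \<ge> 1" using k w by (simp add: t_def weight_seq_def)
      have "t \<le> t ^ k" using t1 k by (intro self_le_power) auto
      then have "w k * t \<le> w k * t ^ k" using k by simp
      moreover have "w k * t = w k + w 0" using k by (simp add: t_def field_simps)
      ultimately have "w 0 < w k * t ^ k" using k by simp
      also have "\<dots> \<le> (real k - 1) * (w k * t ^ k)" 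
        using k t1 by (intro mult_right_mono[of 1 "real k - 1", simplified]) auto
      finally have "0 < (\<Sum>j\<in>{0,k}. (real j - 1) * (w j * t ^ j))" using k by simp
      also have "\<dots> \<le> (\<Sum>j. (real j - 1) * (w j * t ^ j))"
        using w t1 by (intro sum_le_suminf sums_summable[OF conv_at_sums_shifted[OF cJ[OF t], of 1]])
           (auto simp: Suc_le_eq weight_seq_def)
      also have "\<dots> = g t" using sums_unique[OF conv_at_sums_shifted[OF cJ[OF t], of 1]] by (simp add: g_def)
      finally show False using neg[OF t] by simp
    qed
    then obtain r where r: "rho w = ereal r" "0 < r" using rho by (cases "rho w") auto
    have cr: "conv_at w r"
      using conv_at_boundary[OF w r(2,1)] neg r by (force simp: J_def g_def)
    have "g r = 0"
    proof (rule ccontr)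
      assume ne: "g r \<noteq> 0"
      have le: "g t < g r" if "t \<in> J" for t
        using that excess_strict_mono[OF w _ _ cJ[OF that] cr] r by (auto simp: J_def g_def)
      have lep: "phi w t \<le> phi w r" if "t \<in> J" for t
        by (rule sums_le[OF _ conv_at_sums(1)[OF cJ[OF that]] conv_at_sums(1)[OF cr]])
           (use that r w in \<open>auto simp: J_def weight_seq_def intro!: mult_left_mono power_mono\<close>)
      have phr: "0 < phi w r" using phi_pos[OF w cr] r by simp
      have pht: "0 < phi w t" if "t \<in> J" for t using phi_pos[OF w cJ[OF that]] that by (simp add: J_def)
      have psi: "psi w t = 1 + g t / phi w t" if "t \<in> J" for t
        using pht[OF that] by (simp add: psi_def g_def field_simps)
      show False
      proof (cases "g r < 0")
        case True
        \<comment> \<open>A negative boundary excess keeps psi below 1 by the fixed amount |g r| /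
          phi(r), because phi increases.\<close>
        have "(SUP t\<in>J. ereal (psi w t)) \<le> ereal (1 + g r / phi w r)"
        proof (rule SUP_least)
          fix t assume t: "t \<in> J"
          have "g t / phi w t \<le> g r / phi w t" using le[OF t] pht[OF t] by (simp add: divide_right_mono)
          also have "\<dots> \<le> g r / phi w r"
            using lep[OF t] pht[OF t] True by (intro divide_left_mono_neg) auto
          finally show "ereal (psi w t) \<le> ereal (1 + g r / phi w r)" by (simp add: psi[OF t])
        qed
        moreover have "1 + g r / phi w r < 1" using True phr by (simp add: divide_neg_pos)
        ultimately show False using nu by (metis ereal_less(4) leD le_less_trans one_ereal_def less_ereal.simps(1))
      next
        case F: False
        have gr: "g r > 0" using F ne by simp
        \<comment> \<open>Continuity of the full series up to the boundary is avoided: a partial sum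
          is positive at r, hence also slightly below r. With n >= 1 it contains the negative term,
          so it bounds the whole excess from below.\<close>
        define S where "S n t = (\<Sum>j<n. (real j - 1) * (w j * t ^ j))" for n t
        have "(\<lambda>n. S n r) \<longlonglongrightarrow> g r"
          using conv_at_sums_shifted[OF cr, of 1] by (simp add: sums_def S_def g_def)
        then have "\<forall>\<^sub>F n in sequentially. S n r > 0" using gr by (rule order_tendstoD)
        then obtain n where n: "S n r > 0" "n \<ge> 1"
          by (metis (no_types, lifting) eventually_sequentially linorder_linear)
        have "isCont (S n) r" unfolding S_def by (intro continuous_intros)
        then have "(S n \<longlongrightarrow> S n r) (at_left r)" 
          by (simp add: isCont_def filterlim_at_split)
        then have "\<forall>\<^sub>F t in at_left r. S n t > 0" using n by (intro order_tendstoD)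
        moreover have "\<forall>\<^sub>F t in at_left r. t \<in> {0<..<r}" using r by (intro eventually_at_leftI[of 0]) auto
        ultimately have "\<forall>\<^sub>F t in at_left r. t \<in> {0<..<r} \<and> S n t > 0" by eventually_elim auto
        then obtain t where t: "0 < t" "t < r" "S n t > 0"
          by (force dest: eventually_happens)
        then have tJ: "t \<in> J" using r by (simp add: J_def)
        have "S n t \<le> (\<Sum>j. (real j - 1) * (w j * t ^ j))"
          unfolding S_def using w t n
          by (intro sum_le_suminf sums_summable[OF conv_at_sums_shifted[OF cJ[OF tJ], of 1]])
             (auto simp: weight_seq_def Suc_le_eq)
        also have "\<dots> = g t" using sums_unique[OF conv_at_sums_shifted[OF cJ[OF tJ], of 1]] by (simp add: g_def)
        finally show False using neg[OF tJ] t by simp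
      qed
    qed
    then show ?thesis using r cr psi_eq_1_iff[OF w cr] by (intro exI[of _ r]) (auto simp: g_def)
  qed
qed

lemma tau_props:
  assumes w: "weight_seq w" and I: "typeI w"
  shows "0 < tau w" "conv_at w (tau w)" "psi w (tau w) = 1"
proof -
  obtain t where t: "0 < t" "ereal t \<le> rho w" "conv_at w t" "psi w t = 1"
    using tau_exists[OF assms] by blast
  have "tau w = t"
    unfolding tau_def
  proof (rule the_equality)
    show "0 < t \<and> ereal t \<le> rho w \<and> summable (\<lambda>k. w k * t ^ k) \<and>
      summable (\<lambda>k. real (Suc k) * w (Suc k) * t ^ k) \<and> psi w t = 1"
      using t by (auto simp: conv_at_def)
    fix s assume "0 < s \<and> ereal s \<le> rho w \<and> summable (\<lambda>k. w k * s ^ k) \<and>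
      summable (\<lambda>k. real (Suc k) * w (Suc k) * s ^ k) \<and> psi w s = 1"
    then have s: "0 < s" "conv_at w s" "psi w s = 1" by (auto simp: conv_at_def)
    show "s = t"
      using excess_strict_mono[OF w _ _ s(2) t(3)] excess_strict_mono[OF w _ _ t(3) s(2)] s t
        psi_eq_1_iff[OF w s(2)] psi_eq_1_iff[OF w t(3)]
      by (cases s t rule: linorder_cases) auto
  qed
  then show "0 < tau w" "conv_at w (tau w)" "psi w (tau w) = 1" using t by auto
qed

section \<open>Critical offspring laws and exponential tilting\<close>

locale critical_offspring =
  fixes p :: "nat \<Rightarrow> real"
  assumes p_nonneg: "0 \<le> p k"
    and p_sums: "p sums 1"
    and p_mean: "(\<lambda>k. real k * p k) sums 1"
    and p_0: "0 < p 0"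
    and p_ge_2: "\<exists>k\<ge>2. 0 < p k"

lemma critical_offspring_pik:
  assumes w: "weight_seq w" and I: "typeI w"
  shows "critical_offspring (pik w)"
proof -
  note t = tau_props[OF assms]
  have ph: "0 < phi w (tau w)" using phi_pos[OF w t(2)] t(1) by simp
  have pk: "pik w k = 1 / phi w (tau w) * (w k * tau w ^ k)" for k by (simp add: pik_def)
  have "(\<lambda>k. pik w k) sums (1 / phi w (tau w) * phi w (tau w))"
    unfolding pk by (intro sums_mult conv_at_sums t)
  moreover have "(\<lambda>k. 1 / phi w (tau w) * (real k * (w k * tau w ^ k))) sums (1 / phi w (tau w) * (tau w * dphi w (tau w)))"
    by (intro sums_mult conv_at_sums t)
  then have "(\<lambda>k. real k * pik w k) sums psi w (tau w)"
    by (simp add: pk psi_def mult_ac)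
  ultimately show ?thesis
    using w t ph by unfold_locales (simp_all, auto simp: pik_def weight_seq_def)
qed

lemma pik_pos_iff:
  assumes w: "weight_seq w" and I: "typeI w"
  shows "0 < pik w k \<longleftrightarrow> 0 < w k"
  using tau_props[OF assms] phi_pos[OF w tau_props(2)[OF assms]]
  by (simp add: pik_def zero_less_mult_iff zero_less_divide_iff)

text \<open>A tree with n vertices has n - 1 edges, so tilting multiplies the weights of all trees
  of a given size by one and the same factor, which cancels in the conditional law.\<close>

lemma tweight_tilt:
  assumes "\<phi> > 0"
  shows "tweight (\<lambda>k. s ^ k * w k / \<phi>) t = s ^ (tsize t - 1) / \<phi> ^ tsize t * tweight w t"
proof (induction t)
  case (Node ts)
  have "prod_list (map (tweight (\<lambda>k. s ^ k * w k / \<phi>)) ts) * s ^ length ts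
     = s ^ sum_list (map tsize ts) / \<phi> ^ sum_list (map tsize ts) * prod_list (map (tweight w) ts)"
    using Node
  proof (induction ts)
    case (Cons a ts)
    have "tsize a \<ge> 1" by (cases a) auto
    then have *: "s ^ (tsize a - 1) * s = s ^ tsize a" by (metis power_minus_mult less_eq_Suc_le One_nat_def)
    have "prod_list (map (tweight (\<lambda>k. s ^ k * w k / \<phi>)) (a # ts)) * s ^ length (a # ts)
      = (tweight (\<lambda>k. s ^ k * w k / \<phi>) a * s) * (prod_list (map (tweight (\<lambda>k. s ^ k * w k / \<phi>)) ts) * s ^ length ts)"
      by simp
    also have "\<dots> = s ^ tsize a / \<phi> ^ tsize a * tweight w a * (s ^ sum_list (map tsize ts) / \<phi> ^ sum_list (map tsize ts) * prod_list (map (tweight w) ts))"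
      using Cons * by simp
    finally show ?case by (simp add: power_add)
  qed simp
  then show ?case by (simp add: field_simps)
qed

lemma ETn_pik:
  assumes w: "weight_seq w" and I: "typeI w"
  shows "ETn (pik w) n f = ETn w n f"
proof -
  have ph: "0 < phi w (tau w)" and t: "0 < tau w"
    using phi_pos[OF w tau_props(2)[OF assms]] tau_props(1)[OF assms] by auto
  define C where "C = tau w ^ (n - 1) / phi w (tau w) ^ n"
  have C: "C > 0" using ph t by (simp add: C_def)
  have tw: "tweight (pik w) t = C * tweight w t" if "tsize t = n" for t
    using tweight_tilt[OF ph, of "tau w" w t] that by (simp add: C_def pik_def[abs_def])
  have Z: "Zn (pik w) n = C * Zn w n"
    by (simp add: Zn_def sum_distrib_left tw)
  show ?thesis unfolding ETn_def Z using C by (intro sum.cong refl) (simp add: tw)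
qed

section \<open>Counting plane forests\<close>

unbundle no vec_syntax
unbundle fps_syntax

lemma tsize_pos: "0 < tsize t"
  by (cases t) auto

abbreviation fsize :: "ptree list \<Rightarrow> nat" where
  "fsize ts \<equiv> sum_list (map tsize ts)"

abbreviation fweight :: "(nat \<Rightarrow> real) \<Rightarrow> ptree list \<Rightarrow> real" where
  "fweight w ts \<equiv> prod_list (map (tweight w) ts)"

fun fringe_count :: "ptree \<Rightarrow> ptree \<Rightarrow> nat" where
  "fringe_count s (Node ts) = (if Node ts = s then 1 else 0) + sum_list (map (fringe_count s) ts)"

abbreviation forest_fringe_count :: "ptree \<Rightarrow> ptree list \<Rightarrow> nat" where
  "forest_fringe_count s ts \<equiv> sum_list (map (fringe_count s) ts)"

definition forests :: "nat \<Rightarrow> nat \<Rightarrow> ptree list set" where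
  "forests m n = {ts. length ts = m \<and> fsize ts = n}"

lemma length_le_fsize: "length ts \<le> fsize ts"
  by (induction ts) (use tsize_pos in \<open>auto simp: Suc_le_eq add_less_le_mono intro: le_less_trans add_strict_mono\<close>)

lemma forests_empty: "n < m \<Longrightarrow> forests m n = {}"
  using length_le_fsize leD by (auto simp: forests_def)

lemma forests_0: "forests 0 n = (if n = 0 then {[]} else {})"
  by (auto simp: forests_def)

text \<open>Deleting the first root and moving its j children to the front is one step of the
  depth-first (Lukasiewicz) exploration. The recursion couples all numbers of trees, which is why
  forests are counted rather than single trees.\<close>

lemma forests_Suc:
  "forests (Suc m) (Suc n) =
     (\<lambda>(j, us). Node (take j us) # drop j us) ` (SIGMA j:{..n}. forests (m + j) n)" (is "_ = ?f ` _")
proof (intro set_eqI iffI)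
  fix ts assume "ts \<in> forests (Suc m) (Suc n)"
  then obtain us rest where ts: "ts = Node us # rest" "length rest = m" "fsize (us @ rest) = n"
    by (cases ts; cases "hd ts") (auto simp: forests_def)
  have "length us \<le> n" using ts length_le_fsize[of us] by auto
  then show "ts \<in> ?f ` (SIGMA j:{..n}. forests (m + j) n)"
    using ts by (intro image_eqI[of _ _ "(length us, us @ rest)"]) (auto simp: forests_def)
next
  fix ts assume "ts \<in> ?f ` (SIGMA j:{..n}. forests (m + j) n)"
  then obtain j us where ts: "ts = Node (take j us) # drop j us" "length us = m + j" "fsize us = n"
    by (auto simp: forests_def)
  have "fsize (take j us) + fsize (drop j us) = n"
    using ts(3) by (metis append_take_drop_id map_append sum_list_append)
  then show "ts \<in> forests (Suc m) (Suc n)" using ts by (auto simp: forests_def)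
qed

lemma inj_on_peel:
  "inj_on (\<lambda>(j, us). Node (take j us) # drop j us) (SIGMA j:{..n}. forests (m + j) n)"
proof (rule inj_onI, clarsimp simp: forests_def)
  fix j us k vs
  assume *: "take j us = take k vs" "drop j us = drop k vs" "length us = m + j" "length vs = m + k"
  then have "length (take j us) = length (take k vs)" by simp
  with * show "j = k \<and> us = vs" by (metis add.commute append_take_drop_id diff_add_inverse length_take min_def le_add1)
qed

lemma finite_forests: "finite (forests m n)"
proof (induction n arbitrary: m)
  case 0
  then show ?case by (cases m) (auto simp: forests_0 forests_empty)
next
  case (Suc n)
  then show ?case by (cases m) (auto simp: forests_0 forests_Suc)
qed

lemma trees_eq_forests: "{t. tsize t = n} = hd ` forests 1 n" "inj_on hd (forests 1 n)"
proof -
  have *: "forests (Suc 0) n = (\<lambda>t. [t]) ` {t. tsize t = n}"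
    by (auto simp: forests_def length_Suc_conv)
  show "{t. tsize t = n} = hd ` forests 1 n" by (simp add: * image_image)
  show "inj_on hd (forests 1 n)" by (auto simp: * inj_on_def)
qed

lemma finite_trees: "finite {t. tsize t = n}"
  by (simp add: trees_eq_forests finite_forests)

lemma sum_trees_eq_forests: "(\<Sum>t\<in>{t. tsize t = n}. g t) = (\<Sum>ts\<in>forests 1 n. g (hd ts))"
  unfolding trees_eq_forests(1) by (simp only: sum.reindex[OF trees_eq_forests(2)] comp_def)

lemma sum_forests_Suc:
  fixes g :: "ptree list \<Rightarrow> real"
  shows "(\<Sum>ts\<in>forests (Suc m) (Suc n). g ts) =
    (\<Sum>j\<le>n. \<Sum>us\<in>forests (m + j) n. g (Node (take j us) # drop j us))"
  unfolding forests_Suc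
  by (subst sum.reindex[OF inj_on_peel]) (simp add: sum.Sigma finite_forests case_prod_unfold)

definition forest_weight :: "(nat \<Rightarrow> real) \<Rightarrow> nat \<Rightarrow> nat \<Rightarrow> real" where
  "forest_weight w m n = (\<Sum>ts\<in>forests m n. fweight w ts)"

definition marked_weight :: "(nat \<Rightarrow> real) \<Rightarrow> ptree \<Rightarrow> nat \<Rightarrow> nat \<Rightarrow> real" where
  "marked_weight w t m n = (\<Sum>ts\<in>forests m n. fweight w ts * real (forest_fringe_count t ts))"

lemma peel_weight:
  assumes "us \<in> forests (m + j) n"
  shows "fweight w (Node (take j us) # drop j us) = w j * fweight w us"
    "forest_fringe_count t (Node (take j us) # drop j us) = (if Node (take j us) = t then 1 else 0) + forest_fringe_count t us"
proof -
  have l: "length us = m + j" using assms by (simp add: forests_def)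
  have "fweight w (take j us) * fweight w (drop j us) = fweight w us"
    by (metis append_take_drop_id map_append prod_list.append)
  then show "fweight w (Node (take j us) # drop j us) = w j * fweight w us"
    using l by (simp add: min_def)
  have "forest_fringe_count t (take j us) + forest_fringe_count t (drop j us) = forest_fringe_count t us"
    by (metis append_take_drop_id map_append sum_list_append)
  then show "forest_fringe_count t (Node (take j us) # drop j us) = (if Node (take j us) = t then 1 else 0) + forest_fringe_count t us"
    by simp
qed

lemma forest_weight_Suc: "forest_weight w (Suc m) (Suc n) = (\<Sum>j\<le>n. w j * forest_weight w (m + j) n)"
  unfolding forest_weight_def sum_forests_Suc sum_distrib_left
  by (intro sum.cong refl) (simp only: peel_weight(1))

text \<open>If the first tree is \<open>t\<close> itself, the remaining trees are unconstrained,
  which gives the inhomogeneous term; every other occurrence of \<open>t\<close> survives in the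
  peeled forest.\<close>

lemma marked_weight_Suc:
  "marked_weight w t (Suc m) (Suc n) = (\<Sum>j\<le>n. w j * marked_weight w t (m + j) n) +
     (if tsize t \<le> Suc n then tweight w t * forest_weight w m (Suc n - tsize t) else 0)"
proof -
  have "marked_weight w t (Suc m) (Suc n) = (\<Sum>ts\<in>forests (Suc m) (Suc n).
      fweight w ts * real (forest_fringe_count t ts - (if hd ts = t then 1 else 0))) +
      (\<Sum>ts\<in>forests (Suc m) (Suc n). fweight w ts * (if hd ts = t then 1 else 0))" (is "_ = ?A + ?B")
    unfolding marked_weight_def sum.distrib[symmetric]
  proof (intro sum.cong refl)
    fix ts assume "ts \<in> forests (Suc m) (Suc n)"
    then obtain us rest where ts: "ts = Node us # rest"
      by (cases ts; cases "hd ts") (auto simp: forests_def)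
    show "fweight w ts * real (forest_fringe_count t ts) = fweight w ts * real (forest_fringe_count t ts - (if hd ts = t then 1 else 0)) +
         fweight w ts * (if hd ts = t then 1 else 0)"
      by (simp add: ts algebra_simps)
  qed
  also have "?A = (\<Sum>j\<le>n. w j * marked_weight w t (m + j) n)"
    unfolding marked_weight_def sum_forests_Suc sum_distrib_left
  proof (intro sum.cong refl)
    fix j us assume us: "us \<in> forests (m + j) n"
    show "fweight w (Node (take j us) # drop j us) *
         real (forest_fringe_count t (Node (take j us) # drop j us) - (if hd (Node (take j us) # drop j us) = t then 1 else 0)) =
         w j * (fweight w us * real (forest_fringe_count t us))"
      unfolding peel_weight[OF us] by simp
  qed
  also have "?B = (\<Sum>ts\<in>{ts \<in> forests (Suc m) (Suc n). hd ts = t}. fweight w ts)"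
    by (simp add: sum.If_cases finite_forests Int_def if_distrib cong: if_cong)
  also have "\<dots> = (if tsize t \<le> Suc n then tweight w t * forest_weight w m (Suc n - tsize t) else 0)"
  proof (cases "tsize t \<le> Suc n")
    case True
    have "{ts \<in> forests (Suc m) (Suc n). hd ts = t} = (#) t ` forests m (Suc n - tsize t)"
      using True by (auto simp: forests_def length_Suc_conv image_iff)
    then show ?thesis using True by (simp add: sum.reindex forest_weight_def sum_distrib_left)
  next
    case False
    then have "{ts \<in> forests (Suc m) (Suc n). hd ts = t} = {}"
      by (auto simp: forests_def length_Suc_conv)
    then show ?thesis using False by (simp del: Collect_empty_eq)
  qed
  finally show ?thesis .
qed

section \<open>Closed formulas through coefficients of powers\<close>

lemma fps_power_Suc_nth:
  "(W ^ Suc n) $ s = (\<Sum>j\<le>s. W $ j * (W ^ n) $ (s - j))" for W :: "real fps"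
  by (simp add: fps_mult_nth atLeast0AtMost)

text \<open>For a probability law this is exchangeability: given that n + 1 independent steps sum to
  s, each has mean s / (n + 1). Algebraically it is X times the derivative of W^(n + 1).\<close>

lemma fps_power_exchange:
  fixes n s :: nat and W :: "real fps"
  shows "real (Suc n) * (\<Sum>j\<le>s. real j * W $ j * (W ^ n) $ (s - j)) = real s * (W ^ Suc n) $ s"
proof -
  have X: "(fps_X * fps_deriv V) $ k = real k * V $ k" for V :: "real fps" and k
    by (cases k) auto
  have "real s * (W ^ Suc n) $ s = (of_nat (Suc n) * ((fps_X * fps_deriv W) * W ^ n)) $ s"
    unfolding X[symmetric] fps_deriv_power' by (simp add: mult_ac)
  also have "\<dots> = real (Suc n) * ((fps_X * fps_deriv W) * W ^ n) $ s"
    by (simp only: fps_mult_of_nat_nth)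
  also have "((fps_X * fps_deriv W) * W ^ n) $ s = (\<Sum>j\<le>s. real j * W $ j * (W ^ n) $ (s - j))"
    by (simp only: fps_mult_nth[of "fps_X * fps_deriv W"] atLeast0AtMost X)
  finally show ?thesis ..
qed

text \<open>Kemperman's formula; differentiating the power of the generating function replaces the cyclic
  shifts of the usual proof.\<close>
lemma forest_weight_eq:
  assumes "0 < n" "m \<le> n"
  shows "real n * forest_weight w m n = real m * (Abs_fps w ^ n) $ (n - m)"
  using assms
proof (induction n arbitrary: m)
  case (Suc n)
  let ?W = "Abs_fps w"
  show ?case
  proof (cases m)
    case 0
    then show ?thesis by (simp add: forest_weight_def forests_0)
  next
    case (Suc m')
    show ?thesis
    proof (cases "n = 0")
      case True
      then show ?thesis using Suc Suc.prems by (simp add: forest_weight_Suc) (simp add: forest_weight_def forests_0)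
    next
      case False
      have m': "m' \<le> n" using Suc Suc.prems by simp
      have "real n * forest_weight w m (Suc n) = (\<Sum>j\<le>n. w j * (real n * forest_weight w (m' + j) n))"
        by (simp add: Suc forest_weight_Suc sum_distrib_left mult_ac)
      also have "\<dots> = (\<Sum>j\<le>n - m'. w j * (real n * forest_weight w (m' + j) n))"
        using m' by (intro sum.mono_neutral_right) (auto simp: forest_weight_def forests_empty)
      also have "\<dots> = (\<Sum>j\<le>n - m'. w j * (real (m' + j) * (?W ^ n) $ (n - m' - j)))"
        using m' False by (intro sum.cong refl) (simp add: Suc.IH)
      also have "\<dots> = real m' * (\<Sum>j\<le>n - m'. ?W $ j * (?W ^ n) $ (n - m' - j))
           + (\<Sum>j\<le>n - m'. real j * ?W $ j * (?W ^ n) $ (n - m' - j))"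
        by (simp add: sum_distrib_left sum.distrib[symmetric] algebra_simps)
      finally have "real n * forest_weight w m (Suc n) = real m' * (?W ^ Suc n) $ (n - m')
           + (\<Sum>j\<le>n - m'. real j * ?W $ j * (?W ^ n) $ (n - m' - j))"
        by (simp only: fps_power_Suc_nth)
      \<comment> \<open>Multiplying by n + 1 lets exchangeability evaluate the second sum; the two
        multiples of the same coefficient then combine to n (m' + 1).\<close>
      then have "real (Suc n) * (real n * forest_weight w m (Suc n)) = real (Suc n) * (real m' * (?W ^ Suc n) $ (n - m'))
           + real (n - m') * (?W ^ Suc n) $ (n - m')"
        using fps_power_exchange[where n=n and s="n - m'" and W="?W"] by (simp add: distrib_left del: power_Suc of_nat_Suc)
      also have "\<dots> = real n * (real (Suc m') * (?W ^ Suc n) $ (n - m'))"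
        using m' by (simp add: of_nat_diff algebra_simps del: power_Suc)
      finally show ?thesis using False by (simp add: Suc del: power_Suc)
    qed
  qed
qed simp

text \<open>Heuristically, insert the preorder degree word of \<open>t\<close> at one of n places of
  a cyclic degree word; m of the n rotations code forests, so the factors n cancel and no
  denominator is left, unlike in \<open>forest_weight_eq\<close>. The proof solves the peeling
  recursion by induction.\<close>

lemma marked_weight_eq:
  "marked_weight w t m n = (if tsize t \<le> n \<and> m \<le> n - tsize t + 1
     then real m * tweight w t * (Abs_fps w ^ (n - tsize t)) $ (n - tsize t + 1 - m) else 0)"
proof (induction n arbitrary: m)
  case 0
  then show ?case using tsize_pos[of t]
    by (cases m) (auto simp: marked_weight_def forests_0 forests_empty)
next
  case (Suc n)
  let ?W = "Abs_fps w" and ?k = "tsize t"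
  show ?case
  proof (cases m)
    case 0
    then show ?thesis by (simp add: marked_weight_def forests_0)
  next
    case m: (Suc m')
    consider "Suc n < ?k" | "Suc n = ?k" | "?k \<le> n" by linarith
    then show ?thesis
    proof cases
      case 1
      then show ?thesis by (simp add: m marked_weight_Suc Suc.IH)
    next
      case 2
      have "forest_weight w m' 0 = (if m' = 0 then 1 else 0)" by (simp add: forest_weight_def forests_0 forests_empty)
      then show ?thesis using 2 by (simp add: m marked_weight_Suc Suc.IH 2[symmetric])
    next
      case 3
      define l where "l = n - ?k"
      have n: "n = l + ?k" using 3 by (simp add: l_def)
      have E: "marked_weight w t m (Suc n) = (\<Sum>j\<le>n. w j * marked_weight w t (m' + j) n) + tweight w t * forest_weight w m' (Suc l)"
        by (simp add: m marked_weight_Suc n)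
      have IH: "marked_weight w t q n = (if q \<le> Suc l then real q * tweight w t * (?W ^ l) $ (Suc l - q) else 0)" for q
        by (subst Suc.IH) (simp add: n)
      show ?thesis
      proof (cases "m' \<le> Suc l")
        case False
        then have "(\<Sum>j\<le>n. w j * marked_weight w t (m' + j) n) = 0"
          by (intro sum.neutral) (simp add: IH)
        moreover have "forest_weight w m' (Suc l) = 0" using False by (simp add: forest_weight_def forests_empty)
        ultimately show ?thesis using False E by (simp add: m n)
      next
        case True
        let ?s = "Suc l - m'"
        have "(\<Sum>j\<le>n. w j * marked_weight w t (m' + j) n) = (\<Sum>j\<le>?s. w j * marked_weight w t (m' + j) n)"
        proof (cases "?s \<le> n")
          case t: True
          then show ?thesis using True
            by (intro sum.mono_neutral_right) (auto simp: IH)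
        next
          case False
          then show ?thesis using n tsize_pos[of t] by linarith
        qed
        also have "\<dots> = (\<Sum>j\<le>?s. w j * (real (m' + j) * tweight w t * (?W ^ l) $ (?s - j)))"
          using True by (intro sum.cong refl) (simp add: IH)
        also have "\<dots> = tweight w t * (real m' * (\<Sum>j\<le>?s. ?W $ j * (?W ^ l) $ (?s - j))
             + (\<Sum>j\<le>?s. real j * ?W $ j * (?W ^ l) $ (?s - j)))"
          by (simp add: sum_distrib_left sum.distrib[symmetric] algebra_simps)
        also have "(\<Sum>j\<le>?s. ?W $ j * (?W ^ l) $ (?s - j)) = (?W ^ Suc l) $ ?s"
          by (simp only: fps_power_Suc_nth)
        also have "(\<Sum>j\<le>?s. real j * ?W $ j * (?W ^ l) $ (?s - j)) = real ?s / real (Suc l) * (?W ^ Suc l) $ ?s"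
          using fps_power_exchange[where n=l and s="?s" and W="?W"] by (simp add: field_simps del: power_Suc)
        finally have 1: "(\<Sum>j\<le>n. w j * marked_weight w t (m' + j) n) =
            tweight w t * (real m' * (?W ^ Suc l) $ ?s + real ?s / real (Suc l) * (?W ^ Suc l) $ ?s)" .
        have 2: "forest_weight w m' (Suc l) = real m' / real (Suc l) * (?W ^ Suc l) $ ?s"
          using forest_weight_eq[of "Suc l" m' w] True by (simp add: field_simps del: power_Suc)
        \<comment> \<open>Exchangeability contributes the first fraction, Kemperman's formula for
          the inhomogeneous term the second; together they supply the missing 1 in m = m' +
          1.\<close>
        have 3: "real ?s / real (Suc l) + real m' / real (Suc l) = 1"
          using True by (simp add: add_divide_distrib[symmetric] of_nat_diff del: of_nat_Suc)
        have "marked_weight w t m (Suc n) = tweight w t * (?W ^ Suc l) $ ?s * (real m' + (real ?s / real (Suc l) + real m' / real (Suc l)))"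
          unfolding E 1 2 by (simp only: distrib_left distrib_right mult_ac)
        also have "\<dots> = tweight w t * (?W ^ Suc l) $ ?s * real m" unfolding 3 by (simp add: m)
        finally show ?thesis using True by (simp add: n m mult_ac Suc_diff_le del: power_Suc)
      qed
    qed
  qed
qed

lemma Zn_eq: "0 < n \<Longrightarrow> real n * Zn w n = (Abs_fps w ^ n) $ (n - 1)"
proof -
  assume "0 < n"
  have "Zn w n = forest_weight w 1 n"
    unfolding Zn_def forest_weight_def sum_trees_eq_forests by (intro sum.cong) (auto simp: forests_def length_Suc_conv)
  then show ?thesis using forest_weight_eq[of n 1 w] \<open>0 < n\<close> by simp
qed

lemma fringe_count_eq:
  assumes "tsize s \<le> n"
  shows "(\<Sum>t\<in>{t. tsize t = n}. tweight w t * real (fringe_count s t)) =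
    tweight w s * (Abs_fps w ^ (n - tsize s)) $ (n - tsize s)"
proof -
  have "(\<Sum>t\<in>{t. tsize t = n}. tweight w t * real (fringe_count s t)) = marked_weight w s 1 n"
    unfolding sum_trees_eq_forests marked_weight_def by (intro sum.cong) (auto simp: forests_def length_Suc_conv)
  then show ?thesis using assms by (simp add: marked_weight_eq)
qed

text \<open>The steps that an occurrence of \<open>t\<close> removes from the walk:
  \<open>tsize t\<close> of them, with sum \<open>tsize t - 1\<close>. Their order is
  immaterial.\<close>

fun preorder_degs :: "ptree \<Rightarrow> nat list" where
  "preorder_degs (Node ts) = length ts # concat (map preorder_degs ts)"

lemma length_preorder_degs: "length (preorder_degs t) = tsize t"
  by (induction t) (simp add: length_concat comp_def cong: map_cong)

lemma sum_list_preorder_degs: "Suc (sum_list (preorder_degs t)) = tsize t"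
proof (induction t)
  case (Node ts)
  then have "sum_list (concat (map preorder_degs ts)) + length ts = fsize ts"
  proof (induction ts)
    case (Cons a ts)
    have "sum_list (concat (map preorder_degs ts)) + length ts = fsize ts" by (rule Cons.IH) (simp add: Cons.prems)
    moreover have "Suc (sum_list (preorder_degs a)) = tsize a" by (simp add: Cons.prems)
    ultimately show ?case by simp
  qed simp
  then show ?case by simp
qed

lemma prod_list_preorder_degs: "prod_list (map w (preorder_degs t)) = tweight w t"
proof (induction t)
  case (Node ts)
  then have "prod_list (map w (concat (map preorder_degs ts))) = fweight w ts"
    by (induction ts) auto
  then show ?case by simp
qed

section \<open>Critical branching\<close>

text \<open>Sums over forests are taken in \<open>ennreal\<close>, so that no summability has to be
  known before the total mass is.\<close>

definition nn_sum_lists :: "nat \<Rightarrow> ('a list \<Rightarrow> ennreal) \<Rightarrow> ennreal" where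
  "nn_sum_lists k G = (\<integral>\<^sup>+ts. G ts \<partial>count_space {ts. length ts = k})"

lemma nn_sum_lists_0: "nn_sum_lists 0 G = G []"
  by (simp add: nn_sum_lists_def nn_integral_count_space_finite)

lemma nn_sum_lists_Suc: "nn_sum_lists (Suc k) G = (\<integral>\<^sup>+a. nn_sum_lists k (\<lambda>ts. G (a # ts)) \<partial>count_space UNIV)"
proof -
  have "bij_betw (\<lambda>(a, ts). a # ts) (UNIV \<times> {ts :: 'a list. length ts = k}) {ts. length ts = Suc k}"
    by (auto simp: bij_betw_def inj_on_def length_Suc_conv image_iff)
  from nn_integral_bij_count_space[OF this, of G]
  have "nn_sum_lists (Suc k) G = (\<integral>\<^sup>+x. G (case x of (a, ts) \<Rightarrow> a # ts) \<partial>count_space (UNIV \<times> {ts. length ts = k}))"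
    by (simp add: nn_sum_lists_def)
  also have "\<dots> = (\<integral>\<^sup>+x. G (case x of (a, ts) \<Rightarrow> a # ts) * indicator (UNIV \<times> {ts. length ts = k}) x \<partial>count_space UNIV)"
    by (simp add: nn_integral_count_space_indicator)
  also have "\<dots> = (\<integral>\<^sup>+a. \<integral>\<^sup>+ts. G (a # ts) * indicator {ts. length ts = k} ts \<partial>count_space UNIV \<partial>count_space UNIV)"
    by (subst nn_integral_fst_count_space[symmetric]) (simp add: indicator_def)
  finally show ?thesis by (simp add: nn_sum_lists_def nn_integral_count_space_indicator)
qed

lemma nn_sum_lists_cmult: "nn_sum_lists k (\<lambda>ts. c * G ts) = c * nn_sum_lists k G"
  by (simp add: nn_sum_lists_def nn_integral_cmult)

lemma nn_sum_lists_add: "nn_sum_lists k (\<lambda>ts. F ts + G ts) = nn_sum_lists k F + nn_sum_lists k G"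
  by (simp add: nn_sum_lists_def nn_integral_add)

lemma nn_sum_lists_prod: "nn_sum_lists k (\<lambda>ts. prod_list (map g ts)) = (\<integral>\<^sup>+a. g a \<partial>count_space UNIV) ^ k"
  by (induction k) (simp_all add: nn_sum_lists_0 nn_sum_lists_Suc nn_sum_lists_cmult nn_integral_multc mult.commute)

text \<open>Leibniz rule: k choices for the entry that carries the additive functional
  \<open>l\<close>; each of the other k - 1 entries contributes the plain mass.\<close>

lemma nn_sum_lists_prod_sum:
  "nn_sum_lists k (\<lambda>ts. prod_list (map g ts) * sum_list (map l ts)) =
     of_nat k * (\<integral>\<^sup>+a. g a \<partial>count_space UNIV) ^ (k - 1) * (\<integral>\<^sup>+a. g a * l a \<partial>count_space UNIV)"
proof (induction k)
  case (Suc k)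
  let ?y = "\<integral>\<^sup>+a. g a \<partial>count_space UNIV" and ?m = "\<integral>\<^sup>+a. g a * l a \<partial>count_space UNIV"
  have "nn_sum_lists (Suc k) (\<lambda>ts. prod_list (map g ts) * sum_list (map l ts)) =
    (\<integral>\<^sup>+a. nn_sum_lists k (\<lambda>ts. (g a * l a) * prod_list (map g ts) + g a * (prod_list (map g ts) * sum_list (map l ts)))
       \<partial>count_space UNIV)"
    by (simp add: nn_sum_lists_Suc algebra_simps)
  also have "\<dots> = (\<integral>\<^sup>+a. (g a * l a) * ?y ^ k + g a * (of_nat k * ?y ^ (k - 1) * ?m) \<partial>count_space UNIV)"
    by (simp only: nn_sum_lists_add nn_sum_lists_cmult nn_sum_lists_prod Suc.IH)
  also have "\<dots> = ?m * ?y ^ k + ?y * (of_nat k * ?y ^ (k - 1) * ?m)"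
    by (simp add: nn_integral_add nn_integral_multc)
  also have "?y * (of_nat k * ?y ^ (k - 1) * ?m) = of_nat k * ?y ^ k * ?m"
    by (cases k) (simp_all add: mult_ac)
  finally show ?case by (simp add: algebra_simps)
qed (simp add: nn_sum_lists_0)

lemma nn_integral_trees:
  "(\<integral>\<^sup>+t. G t \<partial>count_space UNIV) = (\<Sum>k. nn_sum_lists k (\<lambda>ts. G (Node ts)))"
proof -
  have "bij_betw Node UNIV UNIV"
    by (auto simp: bij_betw_def inj_on_def surj_def) (metis ptree.exhaust)
  then have "(\<integral>\<^sup>+t. G t \<partial>count_space UNIV) = (\<integral>\<^sup>+ts. G (Node ts) \<partial>count_space UNIV)"
    by (simp add: nn_integral_bij_count_space)
  also have "\<dots> = (\<integral>\<^sup>+ts. (\<Sum>k. G (Node ts) * indicator {ts. length ts = k} ts) \<partial>count_space UNIV)"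
  proof (intro nn_integral_cong)
    fix ts :: "ptree list"
    have "(\<Sum>k. G (Node ts) * indicator {ts. length ts = k} ts) = (\<Sum>k\<in>{length ts}. G (Node ts) * indicator {ts. length ts = k} ts)"
      by (intro suminf_finite) auto
    then show "G (Node ts) = (\<Sum>k. G (Node ts) * indicator {ts. length ts = k} ts)" by simp
  qed
  also have "\<dots> = (\<Sum>k. \<integral>\<^sup>+ts. G (Node ts) * indicator {ts. length ts = k} ts \<partial>count_space UNIV)"
    by (intro nn_integral_suminf) auto
  finally show ?thesis by (simp add: nn_sum_lists_def nn_integral_count_space_indicator)
qed

section \<open>Generation sizes and total progeny\<close>

fun level_size :: "nat \<Rightarrow> ptree \<Rightarrow> nat" where
  "level_size 0 t = 1"
| "level_size (Suc h) (Node ts) = sum_list (map (level_size h) ts)"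

lemma sum_level_size_le: "(\<Sum>h<H. level_size h t) \<le> tsize t"
proof (induction H arbitrary: t)
  case (Suc H)
  obtain ts where t: "t = Node ts" by (cases t)
  have "(\<Sum>h<H. sum_list (map (level_size h) ts)) = sum_list (map (\<lambda>s. \<Sum>h<H. level_size h s) ts)"
    by (induction ts) (simp_all add: sum.distrib)
  also have "\<dots> \<le> sum_list (map tsize ts)" by (intro sum_list_mono Suc.IH)
  finally show ?case by (simp add: t sum.lessThan_Suc_shift del: sum.lessThan_Suc)
qed simp

context critical_offspring
begin

lemma tweight_nonneg: "0 \<le> tweight p t"
  by (induction t) (auto intro!: mult_nonneg_nonneg p_nonneg prod_list_nonneg)

lemma ennreal_tweight_Node:
  "ennreal (tweight p (Node ts)) = ennreal (p (length ts)) * prod_list (map (\<lambda>t. ennreal (tweight p t)) ts)"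
proof -
  have "ennreal (prod_list (map (tweight p) ts)) = prod_list (map (\<lambda>t. ennreal (tweight p t)) ts)"
    by (induction ts) (simp_all add: ennreal_mult' tweight_nonneg)
  then show ?thesis by (simp add: ennreal_mult' p_nonneg)
qed

lemma suminf_ennreal_p: "(\<Sum>k. ennreal (p k)) = 1" "(\<Sum>k. of_nat k * ennreal (p k)) = 1"
proof -
  show "(\<Sum>k. ennreal (p k)) = 1"
    using suminf_ennreal_eq[OF p_nonneg p_sums] by simp
  have "(\<Sum>k. ennreal (real k * p k)) = 1"
    using suminf_ennreal_eq[OF mult_nonneg_nonneg[OF of_nat_0_le_iff p_nonneg] p_mean] by (simp only: ennreal_1)
  then show "(\<Sum>k. of_nat k * ennreal (p k)) = 1"
    by (simp only: ennreal_mult''[OF p_nonneg] ennreal_of_nat_eq_real_of_nat)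
qed

definition total_mass :: ennreal where
  "total_mass = (\<integral>\<^sup>+t. ennreal (tweight p t) \<partial>count_space UNIV)"

lemma total_mass_fixpoint: "total_mass = (\<Sum>k. ennreal (p k) * total_mass ^ k)"
proof -
  have "nn_sum_lists k (\<lambda>ts. ennreal (tweight p (Node ts))) = ennreal (p k) * total_mass ^ k" for k
  proof -
    have "nn_sum_lists k (\<lambda>ts. ennreal (tweight p (Node ts))) = nn_sum_lists k (\<lambda>ts. ennreal (p k) * prod_list (map (\<lambda>t. ennreal (tweight p t)) ts))"
      unfolding nn_sum_lists_def by (intro nn_integral_cong) (simp add: ennreal_tweight_Node del: tweight.simps)
    then show ?thesis by (simp add: nn_sum_lists_cmult nn_sum_lists_prod total_mass_def)
  qed
  then show ?thesis unfolding total_mass_def by (subst nn_integral_trees) (simp add: total_mass_def)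
qed

text \<open>The fixed-point equation also admits the value \<infinity>. Truncation at size n
  excludes it: the subtrees below the root of a tree of size at most n + 1 have size at most n, so
  the bound 1 is inherited from n to n + 1.\<close>

lemma total_mass_le_1: "total_mass \<le> 1"
proof -
  define g where "g n t = ennreal (tweight p t) * indicator {t. tsize t \<le> n} t" for n t
  have le: "(\<integral>\<^sup>+t. g n t \<partial>count_space UNIV) \<le> 1" for n
  proof (induction n)
    case 0
    have "g 0 t = 0" for t using tsize_pos[of t] by (simp add: g_def)
    then show ?case by simp
  next
    case (Suc n)
    have "g (Suc n) (Node ts) \<le> ennreal (p (length ts)) * prod_list (map (g n) ts)" for ts
    proof (cases "tsize (Node ts) \<le> Suc n")
      case True
      then have "tsize t \<le> n" if "t \<in> set ts" for t using member_le_sum_list[of "tsize t" "map tsize ts"] that by auto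
      then have "map (g n) ts = map (\<lambda>t. ennreal (tweight p t)) ts" by (simp add: g_def)
      moreover have "g (Suc n) (Node ts) = ennreal (tweight p (Node ts))" using True by (simp add: g_def)
      ultimately show ?thesis by (simp only: ennreal_tweight_Node order.refl)
    qed (simp add: g_def)
    then have "nn_sum_lists k (\<lambda>ts. g (Suc n) (Node ts)) \<le> nn_sum_lists k (\<lambda>ts. ennreal (p k) * prod_list (map (g n) ts))" for k
      unfolding nn_sum_lists_def by (intro nn_integral_mono) auto
    then have "nn_sum_lists k (\<lambda>ts. g (Suc n) (Node ts)) \<le> ennreal (p k) * (\<integral>\<^sup>+t. g n t \<partial>count_space UNIV) ^ k" for k
      by (simp add: nn_sum_lists_cmult nn_sum_lists_prod)
    also have "\<dots> k \<le> ennreal (p k) * 1 ^ k" for k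
      using Suc by (intro mult_left_mono power_mono) auto
    finally have "(\<Sum>k. nn_sum_lists k (\<lambda>ts. g (Suc n) (Node ts))) \<le> (\<Sum>k. ennreal (p k))"
      by (intro suminf_le) auto
    then show ?case by (simp add: nn_integral_trees suminf_ennreal_p)
  qed
  have "total_mass = (\<integral>\<^sup>+t. (SUP n. g n t) \<partial>count_space UNIV)"
    unfolding total_mass_def
  proof (intro nn_integral_cong antisym)
    fix t
    have "ennreal (tweight p t) = g (tsize t) t" by (simp add: g_def)
    also have "\<dots> \<le> (SUP n. g n t)" by (rule SUP_upper) simp
    finally show "ennreal (tweight p t) \<le> (SUP n. g n t)" .
    show "(SUP n. g n t) \<le> ennreal (tweight p t)" by (intro SUP_least) (simp add: g_def indicator_def)
  qed
  also have "\<dots> = (SUP n. \<integral>\<^sup>+t. g n t \<partial>count_space UNIV)"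
    by (intro nn_integral_monotone_convergence_SUP)
       (auto simp: incseq_def le_fun_def g_def indicator_def)
  also have "\<dots> \<le> 1" using le by (intro SUP_least)
  finally show ?thesis .
qed

text \<open>Criticality enters here: by Bernoulli's inequality, strict at an outdegree at least 2, the
  generating function of \<^term>\<open>p\<close> lies above the diagonal on \<^term>\<open>{0..<1::real}\<close>.\<close>
lemma total_mass_eq_1: "total_mass = 1"
proof (rule ccontr)
  assume ne: "total_mass \<noteq> 1"
  define y where "y = enn2real total_mass"
  have fin: "total_mass < top" using total_mass_le_1 by (simp add: le_less_trans)
  have y: "total_mass = ennreal y" "0 \<le> y" using fin by (auto simp: y_def ennreal_enn2real)
  have y1: "y < 1" using total_mass_le_1 ne y by (cases "y = 1") (auto simp: ennreal_le_1)
  have sm: "summable (\<lambda>k. p k * y ^ k)"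
    using p_nonneg y y1 by (intro summable_comparison_test'[OF sums_summable[OF p_sums], of 0])
      (auto simp: mult_left_le power_le_one)
  have "ennreal y = (\<Sum>k. ennreal (p k * y ^ k))"
    using total_mass_fixpoint y p_nonneg by (simp add: ennreal_mult' ennreal_power)
  also have "\<dots> = ennreal (\<Sum>k. p k * y ^ k)"
    using p_nonneg y sm by (intro suminf_ennreal2) auto
  finally have eq: "y = (\<Sum>k. p k * y ^ k)"
    using y p_nonneg sm by (subst (asm) ennreal_inj) (auto intro: suminf_nonneg)
  obtain k0 where k0: "k0 \<ge> 2" "0 < p k0" using p_ge_2 by auto
  have "(\<lambda>k. p k + (y - 1) * (real k * p k)) sums (1 + (y - 1) * 1)"
    by (intro sums_add sums_mult p_sums p_mean)
  then have S: "(\<lambda>k. p k * y ^ k - (p k + (y - 1) * (real k * p k))) sums ((\<Sum>k. p k * y ^ k) - (1 + (y - 1) * 1))"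
    by (intro sums_diff summable_sums sm)
  have bern: "1 + real k * (y - 1) \<le> y ^ k" for k
    using Bernoulli_inequality[of "y - 1" k] y by simp
  have "0 < (\<Sum>k. p k * y ^ k - (p k + (y - 1) * (real k * p k)))"
  proof (rule suminf_pos2[OF sums_summable[OF S]])
    fix k
    have "p k * (1 + real k * (y - 1)) \<le> p k * y ^ k" using bern p_nonneg by (intro mult_left_mono)
    then show "0 \<le> p k * y ^ k - (p k + (y - 1) * (real k * p k))" by (simp add: algebra_simps)
  next
    obtain j where j: "k0 = Suc j" "j \<ge> 1" using k0 by (cases k0) auto
    have "1 + real j * (y - 1) \<le> y ^ j" by (rule bern)
    moreover have "y ^ j < 1" using y y1 j by (simp add: power_less_one_iff)
    ultimately have "1 + real j * (y - 1) + (y - 1) < y ^ j + (y - 1) * y ^ j"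
      using y1 by (intro add_le_less_mono) auto
    then have "1 + real k0 * (y - 1) < y ^ k0" by (simp add: j algebra_simps)
    then have "p k0 * (1 + real k0 * (y - 1)) < p k0 * y ^ k0" using k0 by (intro mult_strict_left_mono)
    then show "0 < p k0 * y ^ k0 - (p k0 + (y - 1) * (real k0 * p k0))" by (simp add: algebra_simps)
  qed
  then show False using sums_unique[OF S] eq by simp
qed

text \<open>The marked vertex lies below one of the k children of the root; this child contributes
  the inductive value 1 and each of the others the total mass 1, which leaves the mean of
  \<open>p\<close>. So a critical tree loses no mass to infinite trees at any height.\<close>

lemma level_mass: "(\<integral>\<^sup>+t. ennreal (tweight p t) * of_nat (level_size h t) \<partial>count_space UNIV) = 1"
proof (induction h)
  case 0
  then show ?case using total_mass_eq_1 by (simp add: total_mass_def)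
next
  case (Suc h)
  have "nn_sum_lists k (\<lambda>ts. ennreal (tweight p (Node ts)) * of_nat (level_size (Suc h) (Node ts))) = of_nat k * ennreal (p k)" for k
  proof -
    have "of_nat (sum_list (map (level_size h) ts)) = sum_list (map (\<lambda>t. of_nat (level_size h t) :: ennreal) ts)" for ts
      by (induction ts) auto
    then have "nn_sum_lists k (\<lambda>ts. ennreal (tweight p (Node ts)) * of_nat (level_size (Suc h) (Node ts))) =
      nn_sum_lists k (\<lambda>ts. ennreal (p k) * (prod_list (map (\<lambda>t. ennreal (tweight p t)) ts) * sum_list (map (\<lambda>t. of_nat (level_size h t)) ts)))"
      unfolding nn_sum_lists_def by (intro nn_integral_cong) (simp add: ennreal_tweight_Node mult_ac del: tweight.simps)
    also have "\<dots> = ennreal (p k) * of_nat k"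
      by (simp add: nn_sum_lists_cmult nn_sum_lists_prod_sum Suc total_mass_def[symmetric] total_mass_eq_1)
    finally show ?thesis by (simp add: mult.commute)
  qed
  then show ?case by (subst nn_integral_trees) (simp add: suminf_ennreal_p del: level_size.simps tweight.simps)
qed

lemma mean_size_infinite: "(\<integral>\<^sup>+t. ennreal (tweight p t) * of_nat (tsize t) \<partial>count_space UNIV) = \<infinity>"
proof -
  let ?I = "\<integral>\<^sup>+t. ennreal (tweight p t) * of_nat (tsize t) \<partial>count_space UNIV"
  have "of_nat H \<le> ?I" for H
  proof -
    have "of_nat H = (\<Sum>h<H. \<integral>\<^sup>+t. ennreal (tweight p t) * of_nat (level_size h t) \<partial>count_space UNIV)"
      by (simp add: level_mass)
    also have "\<dots> = (\<integral>\<^sup>+t. (\<Sum>h<H. ennreal (tweight p t) * of_nat (level_size h t)) \<partial>count_space UNIV)"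
      by (simp add: nn_integral_sum)
    also have "\<dots> = (\<integral>\<^sup>+t. ennreal (tweight p t) * of_nat (\<Sum>h<H. level_size h t) \<partial>count_space UNIV)"
      by (simp add: sum_distrib_left)
    also have "\<dots> \<le> ?I"
      using sum_level_size_le by (intro nn_integral_mono mult_left_mono of_nat_mono) auto
    finally show ?thesis .
  qed
  then show ?thesis using ennreal_Ex_less_of_nat[of ?I] by (auto simp: top.not_eq_extremum[symmetric] not_less[symmetric])
qed

lemma not_summable_hitting: "\<not> summable (\<lambda>n. fps_nth (Abs_fps p ^ n) (n - 1))"
proof
  assume "summable (\<lambda>n. fps_nth (Abs_fps p ^ n) (n - 1))"
  then have sm: "summable (\<lambda>n. real n * Zn p n)"
  \<comment> \<open>Only eventually: at n = 0 truncated subtraction makes the coefficient 1, whereas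
    \<open>real n * Zn p n\<close> is 0.\<close>
  proof (rule summable_cong[THEN iffD1, rotated])
    show "\<forall>\<^sub>F n in sequentially. fps_nth (Abs_fps p ^ n) (n - 1) = real n * Zn p n"
      using eventually_gt_at_top[of 0] by eventually_elim (simp add: Zn_eq)
  qed
  have Z: "0 \<le> Zn p n" for n unfolding Zn_def by (intro sum_nonneg tweight_nonneg)
  have "(\<integral>\<^sup>+t. ennreal (tweight p t) * of_nat (tsize t) \<partial>count_space UNIV) =
    (\<integral>\<^sup>+t. (\<Sum>n. ennreal (tweight p t) * of_nat (tsize t) * indicator {t. tsize t = n} t) \<partial>count_space UNIV)"
  proof (intro nn_integral_cong)
    fix t
    have "(\<Sum>n. ennreal (tweight p t) * of_nat (tsize t) * indicator {t. tsize t = n} t) =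
      (\<Sum>n\<in>{tsize t}. ennreal (tweight p t) * of_nat (tsize t) * indicator {t. tsize t = n} t)"
      by (intro suminf_finite) auto
    then show "ennreal (tweight p t) * of_nat (tsize t) = (\<Sum>n. ennreal (tweight p t) * of_nat (tsize t) * indicator {t. tsize t = n} t)"
      by simp
  qed
  also have "\<dots> = (\<Sum>n. \<integral>\<^sup>+t. ennreal (tweight p t) * of_nat (tsize t) * indicator {t. tsize t = n} t \<partial>count_space UNIV)"
    by (intro nn_integral_suminf) auto
  also have "\<dots> = (\<Sum>n. ennreal (real n * Zn p n))"
  proof (intro suminf_cong)
    fix n
    have "(\<integral>\<^sup>+t. ennreal (tweight p t) * of_nat (tsize t) * indicator {t. tsize t = n} t \<partial>count_space UNIV)
      = (\<integral>\<^sup>+t. ennreal (tweight p t) * of_nat (tsize t) \<partial>count_space {t. tsize t = n})"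
      by (simp add: nn_integral_count_space_indicator)
    also have "\<dots> = (\<Sum>t\<in>{t. tsize t = n}. ennreal (tweight p t) * of_nat (tsize t))"
      by (simp add: nn_integral_count_space_finite finite_trees)
    also have "\<dots> = (\<Sum>t\<in>{t. tsize t = n}. ennreal (real n * tweight p t))"
      by (intro sum.cong refl) (auto simp: ennreal_mult' ennreal_of_nat_eq_real_of_nat mult.commute)
    also have "\<dots> = ennreal (real n * Zn p n)"
      by (subst sum_ennreal) (auto simp: Zn_def sum_distrib_left tweight_nonneg)
    finally show "(\<integral>\<^sup>+t. ennreal (tweight p t) * of_nat (tsize t) * indicator {t. tsize t = n} t \<partial>count_space UNIV)
      = ennreal (real n * Zn p n)" .
  qed
  also have "\<dots> = ennreal (\<Sum>n. real n * Zn p n)"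
    using sm Z by (intro suminf_ennreal2) auto
  finally show False using mean_size_infinite by simp
qed

end

section \<open>Local limits of random walk probabilities\<close>

lemma fps_power_nth_nonneg:
  fixes G :: "real fps"
  assumes "\<And>i. 0 \<le> G $ i"
  shows "0 \<le> (G ^ n) $ s"
proof (induction n arbitrary: s)
  case 0
  then show ?case by simp
next
  case (Suc n)
  then show ?case unfolding fps_power_Suc_nth by (intro sum_nonneg mult_nonneg_nonneg assms)
qed

lemma fps_mult_nth_ge:
  fixes A B :: "real fps"
  assumes "\<And>i. 0 \<le> A $ i" "\<And>i. 0 \<le> B $ i"
  shows "A $ i * B $ j \<le> (A * B) $ (i + j)"
proof -
  have "A $ i * B $ (i + j - i) \<le> (\<Sum>k=0..i + j. A $ k * B $ (i + j - k))"
    using assms by (intro member_le_sum[of i _ "\<lambda>k. A $ k * B $ (i + j - k)"]) auto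
  then show ?thesis by (simp add: fps_mult_nth)
qed

text \<open>A formal substitute for evaluating G^n at 1, with \<open>A\<close> bounding the total
  mass of G.\<close>

lemma fps_power_nth_le:
  fixes G :: "real fps"
  assumes "\<And>i. 0 \<le> G $ i" "\<And>s. (\<Sum>i\<le>s. G $ i) \<le> A"
  shows "(G ^ n) $ s \<le> A ^ n"
proof (induction n arbitrary: s)
  case 0
  then show ?case by simp
next
  case (Suc n)
  have A: "0 \<le> A" using assms(2)[of 0] assms(1)[of 0] by simp
  have "(G ^ Suc n) $ s \<le> (\<Sum>j\<le>s. G $ j * A ^ n)"
    unfolding fps_power_Suc_nth by (intro sum_mono mult_left_mono Suc assms)
  also have "\<dots> = (\<Sum>j\<le>s. G $ j) * A ^ n" by (simp add: sum_distrib_right)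
  also have "\<dots> \<le> A * A ^ n" using A by (intro mult_right_mono assms) auto
  finally show ?case by simp
qed

lemma sum_binomial_first_moment:
  fixes a b :: "'a :: comm_ring_1"
  assumes "0 < n"
  shows "(\<Sum>m\<le>n. of_nat m * (of_nat (n choose m) * a ^ m * b ^ (n - m))) = of_nat n * a * (a + b) ^ (n - 1)"
proof -
  obtain k where n: "n = Suc k" using assms by (cases n) auto
  have "(\<Sum>m\<le>n. of_nat m * (of_nat (n choose m) * a ^ m * b ^ (n - m)))
      = (\<Sum>m\<le>k. of_nat (Suc m * (Suc k choose Suc m)) * a ^ Suc m * b ^ (k - m))"
    unfolding n sum.atMost_Suc_shift by (simp only: of_nat_mult) (simp add: mult_ac)
  also have "\<dots> = (\<Sum>m\<le>k. of_nat n * a * (of_nat (k choose m) * a ^ m * b ^ (k - m)))"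
    unfolding Suc_times_binomial by (intro sum.cong refl) (simp only: of_nat_mult n power_Suc mult_ac)
  also have "\<dots> = of_nat n * a * (a + b) ^ k"
    by (simp add: binomial_ring sum_distrib_left)
  finally show ?thesis by (simp add: n)
qed

lemma exp_le_quadratic: "exp (v::real) - 1 \<le> v + v\<^sup>2" if "v \<le> 1"
proof (cases "v \<ge> 0")
  case True
  then show ?thesis using exp_bound[of v] that by simp
next
  case False
  have "exp v * (1 - v) \<le> exp v * exp (- v)"
    using exp_ge_add_one_self[of "- v"] by (intro mult_left_mono) auto
  also have "\<dots> = 1" by (simp add: exp_minus)
  \<comment> \<open>The product is 1 - v^3, which is at least 1 since v < 0.\<close>
  also have "\<dots> \<le> (1 + v + v\<^sup>2) * (1 - v)"
  proof -
    have "0 \<le> (- v) ^ 3" using False by (intro zero_le_power) simp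
    then show ?thesis by (simp add: algebra_simps power2_eq_square power3_eq_cube)
  qed
  finally have "exp v \<le> 1 + v + v\<^sup>2" using False by (subst (asm) mult_le_cancel_right) auto
  then show ?thesis by simp
qed

text \<open>Chernoff bound: \<^term>\<open>r\<close> is the mean proportion of indices with value \<^term>\<open>j\<close> among \<^term>\<open>n\<close>
  independent samples conditioned to sum to \<^term>\<open>s\<close>, so Jensen's inequality bounds the conditional
  exponential moment of their number from below.\<close>
lemma conditional_proportion_bound:
  fixes p :: "nat \<Rightarrow> real"
  assumes p: "\<And>k. 0 \<le> p k" "p sums 1" and n: "0 < n" and js: "j \<le> s"
    and r: "p j * (Abs_fps p ^ (n - 1)) $ (s - j) = r * (Abs_fps p ^ n) $ s"
    and e: "0 < e" "e \<le> 1" and dev: "e \<le> \<bar>r - p j\<bar>"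
  shows "(Abs_fps p ^ n) $ s \<le> exp (- real n * e\<^sup>2 / 4)"
proof -
  define W where "W = Abs_fps p"
  \<comment> \<open>\<open>B\<close> is the part of \<open>W\<close> from steps equal to
    \<open>j\<close> and \<open>R\<close> the rest, so \<open>a m\<close> is the probability that
    exactly m of the n steps equal \<open>j\<close> and all of them sum to s.\<close>
  define B where "B = fps_const (p j) * fps_X ^ j"
  define R where "R = W - B"
  define P where "P = (W ^ n) $ s"
  have B_nth: "B $ i = (if i = j then p j else 0)" for i by (simp add: B_def)
  have R_nth: "R $ i = (if i = j then 0 else p i)" for i by (simp add: R_def B_nth W_def)
  define a where "a m = (of_nat (n choose m) * B ^ m * R ^ (n - m)) $ s" for m
  have a_nonneg: "0 \<le> a m" for m
  proof -
    have 1: "0 \<le> (B ^ m) $ i" "0 \<le> (R ^ (n - m)) $ i" for i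
      by (intro fps_power_nth_nonneg; simp add: B_nth R_nth p)+
    have "a m = real (n choose m) * (B ^ m * R ^ (n - m)) $ s"
      unfolding a_def by (simp only: mult.assoc fps_mult_of_nat_nth)
    moreover have "0 \<le> (B ^ m * R ^ (n - m)) $ s"
      unfolding fps_mult_nth by (intro sum_nonneg mult_nonneg_nonneg 1)
    ultimately show ?thesis by simp
  qed
  have expand: "((fps_const u * B + R) ^ n) $ s = (\<Sum>m\<le>n. a m * u ^ m)" for u
  proof -
    have "(fps_const u * B + R) ^ n = (\<Sum>m\<le>n. fps_const (u ^ m) * (of_nat (n choose m) * B ^ m * R ^ (n - m)))"
      unfolding binomial_ring by (intro sum.cong refl) (simp add: power_mult_distrib fps_const_power mult_ac)
    then show ?thesis by (simp add: fps_sum_nth a_def mult.commute)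
  qed
  have sum_a: "(\<Sum>m\<le>n. a m) = P" using expand[of 1] by (simp add: P_def R_def)
  have "(\<Sum>m\<le>n. real m * a m) = (\<Sum>m\<le>n. of_nat m * (of_nat (n choose m) * B ^ m * R ^ (n - m))) $ s"
    unfolding fps_sum_nth a_def by (intro sum.cong refl) (simp only: fps_mult_of_nat_nth)
  also have "\<dots> = (of_nat n * (B * W ^ (n - 1))) $ s"
    unfolding sum_binomial_first_moment[OF n] by (simp add: R_def mult.assoc)
  also have "\<dots> = real n * (B * W ^ (n - 1)) $ s" by (simp only: fps_mult_of_nat_nth)
  also have "(B * W ^ (n - 1)) $ s = p j * (W ^ (n - 1)) $ (s - j)"
    using js by (simp add: B_def mult.assoc fps_X_power_mult_nth)
  also have "\<dots> = r * P" using r by (simp add: W_def P_def)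
  finally have first: "(\<Sum>m\<le>n. real m * a m) = real n * r * P" by simp
  \<comment> \<open>Jensen's inequality as a tangent bound at the conditional mean n r: 1 + x <= exp
    x, summed against \<open>a\<close>. Dropping the conditioning afterwards leaves a binomial
    moment generating function.\<close>
  have key: "P \<le> exp (real n * (p j * (exp v - 1) - v * r))" for v
  proof -
    have "exp (v * (real n * r)) * P = (\<Sum>m\<le>n. a m * (exp (v * (real n * r)) * (1 + v * (real m - real n * r))))"
    proof -
      have "(\<Sum>m\<le>n. a m * (exp (v * (real n * r)) * (1 + v * (real m - real n * r)))) =
        exp (v * (real n * r)) * ((\<Sum>m\<le>n. a m) + v * ((\<Sum>m\<le>n. real m * a m) - real n * r * (\<Sum>m\<le>n. a m)))"
        by (simp add: sum_distrib_left sum_distrib_right sum.distrib sum_subtractf algebra_simps)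
      then show ?thesis by (simp add: sum_a first)
    qed
    also have "\<dots> \<le> (\<Sum>m\<le>n. a m * exp v ^ m)"
    proof (intro sum_mono mult_left_mono a_nonneg)
      fix m
      have "exp (v * (real n * r)) * (1 + v * (real m - real n * r)) \<le> exp (v * (real n * r)) * exp (v * (real m - real n * r))"
        by (intro mult_left_mono exp_ge_add_one_self) auto
      also have "\<dots> = exp v ^ m" by (simp add: exp_add[symmetric] exp_of_nat_mult[symmetric] algebra_simps)
      finally show "exp (v * (real n * r)) * (1 + v * (real m - real n * r)) \<le> exp v ^ m" .
    qed
    also have "\<dots> = ((fps_const (exp v) * B + R) ^ n) $ s" by (simp only: expand)
    also have "\<dots> \<le> (1 + p j * (exp v - 1)) ^ n"
    proof (rule fps_power_nth_le)
      have nth: "(fps_const (exp v) * B + R) $ i = p i + (if i = j then p j * (exp v - 1) else 0)" for i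
        by (simp add: B_nth R_nth algebra_simps)
      show "0 \<le> (fps_const (exp v) * B + R) $ i" for i by (simp add: B_nth R_nth p)
      have S: "(\<lambda>i. (fps_const (exp v) * B + R) $ i) sums (1 + p j * (exp v - 1))"
        unfolding nth by (intro sums_add p(2) sums_single[of j "\<lambda>i. p j * (exp v - 1)"])
      show "(\<Sum>i\<le>s. (fps_const (exp v) * B + R) $ i) \<le> 1 + p j * (exp v - 1)" for s
        unfolding sums_unique[OF S]
        by (intro sum_le_suminf sums_summable[OF S]) (auto simp: B_nth R_nth p)
    qed
    also have "\<dots> \<le> exp (p j * (exp v - 1)) ^ n"
    proof (intro power_mono exp_ge_add_one_self)
      have "p j \<le> 1" using sum_le_suminf[of p "{j}"] p sums_unique[OF p(2)] sums_summable[OF p(2)] by auto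
      then have "0 \<le> 1 - p j + p j * exp v" using p by (intro add_nonneg_nonneg mult_nonneg_nonneg) auto
      then show "0 \<le> 1 + p j * (exp v - 1)" by (simp add: algebra_simps)
    qed
    also have "\<dots> = exp (real n * (p j * (exp v - 1)))" by (simp only: exp_of_nat_mult)
    finally have "exp (v * (real n * r)) * P \<le> exp (real n * (p j * (exp v - 1)))" .
    then have "P \<le> exp (real n * (p j * (exp v - 1))) / exp (v * (real n * r))"
      by (simp add: field_simps)
    then show ?thesis by (simp add: exp_diff[symmetric] algebra_simps)
  qed
  have pj: "p j \<le> 1" using sum_le_suminf[of p "{j}"] p sums_unique[OF p(2)] sums_summable[OF p(2)] by auto
  \<comment> \<open>v has absolute value e / 2 and the sign of r - p_j: this minimises v^2 - e |v|,
    with value -e^2 / 4.\<close>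
  have fin: "P \<le> exp (- real n * e\<^sup>2 / 4)" if v: "v = e / 2 \<or> v = - (e / 2)" "v * (r - p j) \<ge> e\<^sup>2 / 2" for v
  proof -
    have "exp v - 1 \<le> v + v\<^sup>2" using v e by (intro exp_le_quadratic) auto
    then have "p j * (exp v - 1) \<le> p j * (v + v\<^sup>2)" using p by (intro mult_left_mono)
    also have "\<dots> \<le> p j * v + v\<^sup>2" using pj by (simp add: algebra_simps mult_left_le_one_le p)
    finally have "p j * (exp v - 1) - v * r \<le> v\<^sup>2 - v * (r - p j)" by (simp add: algebra_simps)
    also have "\<dots> \<le> - (e\<^sup>2 / 4)" using v by (auto simp: power2_eq_square)
    finally have "real n * (p j * (exp v - 1) - v * r) \<le> real n * (- (e\<^sup>2 / 4))" by (intro mult_left_mono) auto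
    then have "exp (real n * (p j * (exp v - 1) - v * r)) \<le> exp (- real n * e\<^sup>2 / 4)" by simp
    then show ?thesis using key[of v] by linarith
  qed
  show ?thesis
  proof (cases "r \<ge> p j")
    case True
    then have "e / 2 * (r - p j) \<ge> e / 2 * e" using dev e by (intro mult_left_mono) auto
    then show ?thesis using fin[of "e / 2"] by (simp add: P_def W_def power2_eq_square)
  next
    case False
    then have "e / 2 * (p j - r) \<ge> e / 2 * e" using dev e by (intro mult_left_mono) auto
    then have "- (e / 2) * (r - p j) \<ge> e\<^sup>2 / 2" by (simp add: power2_eq_square right_diff_distrib)
    then have "P \<le> exp (- real n * e\<^sup>2 / 4)" by (rule fin[rotated]) simp
    then show ?thesis by (simp only: P_def W_def)
  qed
qed

text \<open>A numerical semigroup argument: the gcd d of \<open>A\<close> is an integer combination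
  of elements of \<open>A\<close>, hence a difference x - y with x and y in \<open>H\<close>. Large
  multiples of d are combinations of y and x = y + d with nonnegative coefficients.\<close>

lemma additive_closed_contains_large_multiples:
  fixes A H :: "nat set"
  assumes "A \<subseteq> H" "0 \<in> H" and add: "\<And>x y. x \<in> H \<Longrightarrow> y \<in> H \<Longrightarrow> x + y \<in> H"
    and div: "\<And>x. x \<in> H \<Longrightarrow> Gcd A dvd x"
  shows "\<exists>B. \<forall>s\<ge>B. Gcd A dvd s \<longrightarrow> s \<in> H"
proof -
  let ?d = "Gcd A"
  have "\<exists>x\<in>H. \<exists>y\<in>H. z = int x - int y" if "z \<in> group_closure (int ` A)" for z
    using that
  proof induction
    case (base s)
    then consider "s = 0" | a where "a \<in> A" "s = int a" by auto
    then show ?case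
    proof cases
      case 1
      then show ?thesis using assms(2) by (intro bexI[of _ 0]) auto
    next
      case 2
      then show ?thesis using assms(1,2) by (intro bexI[of _ a] bexI[of _ 0]) auto
    qed
  next
    case (diff s t)
    then obtain x y x' y' where "x \<in> H" "y \<in> H" "s = int x - int y" "x' \<in> H" "y' \<in> H" "t = int x' - int y'"
      by blast
    then have "x + y' \<in> H" "y + x' \<in> H" "s - t = int (x + y') - int (y + x')" using add by auto
    then show ?case by blast
  qed
  then obtain x y where xy: "x \<in> H" "y \<in> H" "int ?d = int x - int y"
    using Gcd_in_group_closure[of "int ` A"] unfolding Gcd_int_eq by metis
  then have x: "x = y + ?d" by linarith
  have mult: "k * z \<in> H" if "z \<in> H" for k z
    by (induction k) (use assms(2) add that in auto)
  obtain m where m: "y = ?d * m" using div[OF xy(2)] by blast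
  \<comment> \<open>Write y = d m, s = d l and l = q m + c with c < m. Then s = (q - c) y + c x, and
    l >= m^2 ensures q >= m > c.\<close>
  have "s \<in> H" if s: "s \<ge> ?d * (m * m)" "?d dvd s" for s
  proof -
    obtain l where l: "s = ?d * l" using s by blast
    show ?thesis
    proof (cases "?d = 0 \<or> m = 0")
      case True
      then have "s = 0 \<or> s = l * x" unfolding l x m by auto
      then show ?thesis using assms(2) mult[OF xy(1), of l] by metis
    next
      case False
      then have "0 < ?d" by (simp only: neq0_conv de_Morgan_disj)
      moreover have "?d * (m * m) \<le> ?d * l" using s(1) unfolding l .
      ultimately have lm: "m * m \<le> l" by (rule mult_left_le_imp_le[rotated])
      have "m \<le> l div m" using lm False by (simp add: less_eq_div_iff_mult_less_eq)
      then have le: "l mod m \<le> l div m" using False mod_less_divisor[of m l] by linarith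
      have "(l div m - l mod m) * y + l mod m * x = l div m * y + l mod m * ?d"
      proof -
        have "(l div m - l mod m) * y + l mod m * y = l div m * y"
          using le by (simp add: add_mult_distrib[symmetric])
        then show ?thesis by (simp add: x algebra_simps)
      qed
      also have "\<dots> = ?d * (l div m * m + l mod m)" by (simp only: m distrib_left mult_ac)
      also have "\<dots> = s" by (simp add: l)
      finally show ?thesis using add[OF mult[OF xy(2)] mult[OF xy(1)]] by metis
    qed
  qed
  then show ?thesis by blast
qed

lemma eventually_power_le:
  fixes a b d :: real
  assumes "0 < a" "a < b" "0 < d"
  shows "\<forall>\<^sub>F n in sequentially. a ^ n \<le> d * b ^ n"
proof -
  have "(\<lambda>n. (a / b) ^ n) \<longlonglongrightarrow> 0" using assms by (intro LIMSEQ_power_zero) auto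
  then have "\<forall>\<^sub>F n in sequentially. (a / b) ^ n < d" using assms by (intro order_tendstoD)
  then show ?thesis
  proof eventually_elim
    case (elim n)
    then show ?case using assms by (simp add: power_divide field_simps less_imp_le)
  qed
qed

section \<open>The random walk with critical step law\<close>

context critical_offspring
begin

text \<open>P(S_n = s) for the random walk S with step law \<open>p\<close>.\<close>

definition walk :: "nat \<Rightarrow> nat \<Rightarrow> real" where
  "walk n s = (Abs_fps p ^ n) $ s"

lemma walk_nonneg: "0 \<le> walk n s"
  unfolding walk_def by (rule fps_power_nth_nonneg) (simp add: p_nonneg)

lemma walk_supermult: "walk m s * walk n t \<le> walk (m + n) (s + t)"
  unfolding walk_def power_add
  by (intro fps_mult_nth_ge fps_power_nth_nonneg) (simp_all add: p_nonneg)

lemma walk_1: "walk 1 k = p k" "walk (Suc 0) k = p k"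
  by (simp_all add: walk_def)

lemma walk_0_right: "walk n 0 = p 0 ^ n"
  by (simp add: walk_def fps_nth_power_0)

lemma wspan_dvd_walk: "walk n s \<noteq> 0 \<Longrightarrow> wspan p dvd s"
proof (induction n arbitrary: s)
  case 0
  then show ?case by (cases s) (auto simp: walk_def)
next
  case (Suc n)
  then have "(\<Sum>j\<le>s. p j * walk n (s - j)) \<noteq> 0"
    unfolding walk_def fps_power_Suc_nth by simp
  then obtain j where j: "j \<le> s" "p j * walk n (s - j) \<noteq> 0"
    by (meson atMost_iff sum.not_neutral_contains_not_neutral)
  then have "wspan p dvd s - j" using Suc.IH by simp
  moreover have "wspan p dvd j"
    unfolding wspan_def using j p_nonneg[of j] by (intro Gcd_dvd) (auto simp: less_le)
  ultimately show ?case using j(1) by (metis dvd_add le_add_diff_inverse)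
qed

text \<open>Pairs (s, s) describe returns of the centred walk, which can be concatenated, so these s
  form an additive set. It contains the support of \<open>p\<close>, since a step k can be padded by
  k - 1 steps 0.\<close>

lemma walk_diag_pos: "\<exists>B. \<forall>s\<ge>B. wspan p dvd s \<longrightarrow> 0 < walk s s"
proof -
  have "\<exists>B. \<forall>s\<ge>B. Gcd {i. 0 < p i} dvd s \<longrightarrow> s \<in> {s. 0 < walk s s}"
  proof (rule additive_closed_contains_large_multiples)
    show "{i. 0 < p i} \<subseteq> {s. 0 < walk s s}"
    proof clarify
      fix k assume k: "0 < p k"
      show "0 < walk k k"
      proof (cases k)
        case (Suc j)
        have "0 < walk 1 k * walk j 0" using k p_0 by (simp add: walk_1 walk_0_right)
        also have "\<dots> \<le> walk (1 + j) (k + 0)" by (rule walk_supermult)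
        finally show ?thesis by (simp add: Suc)
      qed (simp add: walk_def)
    qed
    show "0 \<in> {s. 0 < walk s s}" by (simp add: walk_def)
    fix x y assume "x \<in> {s. 0 < walk s s}" "y \<in> {s. 0 < walk s s}"
    then show "x + y \<in> {s. 0 < walk s s}"
      using less_le_trans[OF mult_pos_pos[of "walk x x" "walk y y"] walk_supermult[of x x y y]] by simp
  next
    fix x assume "x \<in> {s. 0 < walk s s}"
    then show "Gcd {i. 0 < p i} dvd x" using wspan_dvd_walk[of x x] by (simp add: wspan_def)
  qed
  then show ?thesis by (simp add: wspan_def)
qed

lemma walk_frequently_large:
  assumes "0 < a" "a < 1"
  shows "\<exists>n\<ge>N. a ^ n \<le> walk n (n - 1)"
proof (rule ccontr)
  assume "\<not> (\<exists>n\<ge>N. a ^ n \<le> walk n (n - 1))"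
  then have "walk n (n - 1) \<le> a ^ n" if "n \<ge> N" for n
    using that by (meson linorder_linear)
  then have le: "norm (walk n (n - 1)) \<le> a ^ n" if "n \<ge> N" for n
    using that walk_nonneg[of n "n - 1"] by simp
  have "summable (\<lambda>n. a ^ n)" using assms by (simp add: summable_geometric)
  then have "summable (\<lambda>n. walk n (n - 1))"
    by (rule summable_comparison_test') (rule le)
  then show False using not_summable_hitting by (simp add: walk_def)
qed

text \<open>One step k >= 2 and k - 2 steps 0 turn n steps with sum n - 1 into a bridge on the
  diagonal. The constant price \<open>d\<close> is absorbed by the gap between a and b.\<close>

lemma walk_diag_large:
  assumes "0 < a" "a < 1"
  shows "\<exists>M>0. a ^ M \<le> walk M M"
proof -
  obtain k where k: "k \<ge> 2" "0 < p k" using p_ge_2 by auto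
  define b where "b = (1 + a) / 2"
  have b: "a < b" "b < 1" "0 < b" using assms by (auto simp: b_def)
  define d where "d = p k * p 0 ^ (k - 2)"
  have d: "0 < d" using k p_0 by (simp add: d_def)
  obtain N where N: "\<And>n. n \<ge> N \<Longrightarrow> a ^ n \<le> d * b ^ n"
    using eventually_power_le[OF assms(1) b(1) d] by (auto simp: eventually_sequentially)
  obtain n where n: "n \<ge> max 1 N" "b ^ n \<le> walk n (n - 1)"
    using walk_frequently_large[OF b(3,2)] by blast
  have "a ^ (n + (k - 1)) \<le> a ^ n" using assms by (intro power_decreasing) auto
  also have "\<dots> \<le> d * b ^ n" using N n by simp
  also have "\<dots> \<le> d * walk n (n - 1)" using n d by (intro mult_left_mono) auto
  also have "\<dots> = walk n (n - 1) * walk 1 k * walk (k - 2) 0" by (simp add: d_def walk_1 walk_0_right)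
  also have "\<dots> \<le> walk (n + 1) (n - 1 + k) * walk (k - 2) 0"
    by (intro mult_right_mono walk_supermult walk_nonneg)
  also have "\<dots> \<le> walk (n + 1 + (k - 2)) (n - 1 + k + 0)" by (rule walk_supermult)
  also have "n + 1 + (k - 2) = n + (k - 1)" using k by simp
  also have "n - 1 + k + 0 = n + (k - 1)" using k n by simp
  finally show ?thesis using k by (intro exI[of _ "n + (k - 1)"]) auto
qed

definition admissible :: "nat filter" where
  "admissible = inf sequentially (principal {n. n mod wspan p = 1 mod wspan p})"

text \<open>The radius of convergence of the generating function of the critical total progeny is 1;
  supermultiplicativity upgrades this to a bound for all admissible \<^term>\<open>n\<close>.\<close>
lemma walk_subexponential:
  assumes a: "0 < a" "a < 1"
  shows "\<forall>\<^sub>F n in admissible. a ^ n \<le> walk n (n - 1)"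
proof -
  define b where "b = (1 + a) / 2"
  have b: "a < b" "b < 1" "0 < b" using assms by (auto simp: b_def)
  obtain M where M: "0 < M" "b ^ M \<le> walk M M" using walk_diag_large[OF b(3,2)] by blast
  have dM: "wspan p dvd M" using M b zero_less_power[OF b(3), of M] by (intro wspan_dvd_walk[of M]) linarith
  obtain B where B: "\<And>s. s \<ge> B \<Longrightarrow> wspan p dvd s \<Longrightarrow> 0 < walk s s" using walk_diag_pos by blast
  \<comment> \<open>Write n - 1 = q M + s with s in a window of length M starting at B: each of q
    diagonal blocks has probability at least b^M, and the remaining \<open>Suc s\<close> steps with
    sum s have probability at least the constant \<open>d\<close>. Inserting 1 keeps the minimum
    defined.\<close>
  define S where "S = {s\<in>{B..B + M}. wspan p dvd s}"
  define d where "d = Min (insert 1 ((\<lambda>s. walk (Suc s) s) ` S))"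
  have fin: "finite S" by (simp add: S_def)
  have d_pos: "0 < d"
    unfolding d_def
  proof (subst Min_gr_iff, simp_all add: fin, intro ballI)
    fix s assume "s \<in> S"
    then have "0 < walk s s * walk 1 0" using B p_0 by (simp add: S_def walk_1)
    also have "\<dots> \<le> walk (s + 1) (s + 0)" by (rule walk_supermult)
    finally show "0 < walk (Suc s) s" by simp
  qed
  have d_le: "d \<le> walk (Suc s) s" if "s \<in> S" for s
    unfolding d_def using that fin by (intro Min_le) auto
  have "\<forall>\<^sub>F n in sequentially. n mod wspan p = 1 mod wspan p \<longrightarrow> a ^ n \<le> walk n (n - 1)"
    using eventually_power_le[OF a(1) b(1) d_pos] eventually_gt_at_top[of B]
  proof eventually_elim
    case (elim n)
    show ?case
    proof
      assume n: "n mod wspan p = 1 mod wspan p"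
      define q where "q = (n - 1 - B) div M"
      define s where "s = B + (n - 1 - B) mod M"
      have ns: "n - 1 = q * M + s" using elim by (simp add: q_def s_def)
      have dn: "wspan p dvd n - 1" using n elim mod_eq_dvd_iff_nat[of 1 n "wspan p"] by simp
      have ds: "wspan p dvd s" using dn dM unfolding ns by (metis dvd_add_right_iff dvd_mult)
      have "s \<in> S" using ds M mod_less_divisor[of M "n - 1 - B"] by (simp add: S_def s_def less_imp_le)
      have pw: "walk M M ^ i \<le> walk (i * M) (i * M)" for i
      proof (induction i)
        case (Suc i)
        have "walk M M ^ Suc i \<le> walk M M * walk (i * M) (i * M)"
          using Suc by (auto intro: mult_left_mono walk_nonneg)
        also have "\<dots> \<le> walk (M + i * M) (M + i * M)" by (rule walk_supermult)
        finally show ?case by simp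
      qed (simp add: walk_def)
      have "a ^ n \<le> d * b ^ n" by (rule elim)
      also have "\<dots> \<le> d * b ^ (q * M)"
        using b d_pos ns elim by (intro mult_left_mono power_decreasing) auto
      also have "b ^ (q * M) = (b ^ M) ^ q" by (simp add: power_mult[symmetric] mult.commute)
      also have "d * (b ^ M) ^ q \<le> d * walk M M ^ q"
        using M b d_pos by (intro mult_left_mono power_mono) auto
      also have "\<dots> \<le> walk (Suc s) s * walk (q * M) (q * M)"
        using d_le[OF \<open>s \<in> S\<close>] pw d_pos by (intro mult_mono walk_nonneg zero_le_power) auto
      also have "\<dots> \<le> walk (Suc s + q * M) (s + q * M)" by (rule walk_supermult)
      also have "Suc s + q * M = n" using ns elim by simp
      also have "s + q * M = n - 1" using ns by simp
      finally show "a ^ n \<le> walk n (n - 1)" .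
    qed
  qed
  then show ?thesis by (simp add: admissible_def eventually_inf_principal)
qed

lemma admissible_le: "admissible \<le> sequentially"
  by (simp add: admissible_def)

lemma eventually_admissible: "eventually P sequentially \<Longrightarrow> eventually P admissible"
  by (rule filter_leD[OF admissible_le])

lemma walk_hitting_pos: "\<forall>\<^sub>F n in admissible. 0 < walk n (n - 1)"
  by (rule eventually_mono[OF walk_subexponential[of "1/2"]]) (auto intro: less_le_trans[rotated])

text \<open>By exchangeability p_j y_n / x_n is the mean proportion of steps equal to
  \<open>j\<close> among n - l steps, given their sum n - 1 - k. If it is far from p_j, then x_n is
  exponentially small; but x_n exceeds half of P(S_n = n - 1), which is not.\<close>

lemma walk_ratio_step:
  assumes j: "0 < p j"
    and lim: "((\<lambda>n. walk (n - l) (n - 1 - k) / walk n (n - 1)) \<longlongrightarrow> 1) admissible"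
  shows "((\<lambda>n. walk (n - Suc l) (n - 1 - (k + j)) / walk n (n - 1)) \<longlongrightarrow> 1) admissible"
proof -
  define x where "x n = walk (n - l) (n - 1 - k)" for n
  define y where "y n = walk (n - Suc l) (n - 1 - (k + j))" for n
  have half: "\<forall>\<^sub>F n in admissible. walk n (n - 1) / 2 < x n"
  proof -
    have "\<forall>\<^sub>F n in admissible. 1 / 2 < x n / walk n (n - 1)"
      using order_tendstoD(1)[OF lim, of "1/2"] by (simp add: x_def)
    then show ?thesis using walk_hitting_pos by eventually_elim (simp add: field_simps)
  qed
  have xpos: "\<forall>\<^sub>F n in admissible. 0 < x n" using half walk_hitting_pos by eventually_elim simp
  have "((\<lambda>n. p j * y n / x n) \<longlongrightarrow> p j) admissible"
  proof (rule tendstoI)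
    fix e :: real assume "0 < e"
    define e' where "e' = min e 1"
    have e': "0 < e'" "e' \<le> 1" "e' \<le> e" using \<open>0 < e\<close> by (auto simp: e'_def)
    \<comment> \<open>\<open>a\<close> is the rate of \<open>conditional_proportion_bound\<close>
      and \<open>b\<close> a slower rate below 1; the factor a^l / 2 pays for the l missing steps
      and for the one half in \<open>half\<close>.\<close>
    define a where "a = exp (- e'\<^sup>2 / 4)"
    define b where "b = exp (- e'\<^sup>2 / 8)"
    have ab: "0 < a" "a < b" "b < 1" "0 < b" using e' by (auto simp: a_def b_def)
    have c: "0 < a ^ l / 2" using ab by simp
    show "\<forall>\<^sub>F n in admissible. dist (p j * y n / x n) (p j) < e"
      using half xpos walk_subexponential[OF ab(4,3)] eventually_admissible[OF eventually_power_le[OF ab(1,2) c]]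
        eventually_admissible[OF eventually_gt_at_top[of "l + k + j + 1"]]
    proof eventually_elim
      case (elim n)
      show ?case
      proof (rule ccontr)
        assume far: "\<not> ?thesis"
        have "x n \<le> exp (- real (n - l) * e'\<^sup>2 / 4)"
          unfolding x_def walk_def
        proof (rule conditional_proportion_bound[OF p_nonneg p_sums, where j = j and r = "p j * y n / x n"])
          have 1: "n - Suc l = n - l - 1" "n - 1 - (k + j) = n - 1 - k - j" by auto
          show "p j * (Abs_fps p ^ (n - l - 1)) $ (n - 1 - k - j) = p j * y n / x n * (Abs_fps p ^ (n - l)) $ (n - 1 - k)"
            using elim(2) unfolding x_def y_def walk_def 1 by simp
          show "e' \<le> \<bar>p j * y n / x n - p j\<bar>" using far e' by (simp add: dist_real_def)
        qed (use e' elim in auto)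
        also have "\<dots> = exp (real (n - l) * (- e'\<^sup>2 / 4))" by simp
        also have "\<dots> = a ^ (n - l)" by (simp only: a_def exp_of_nat_mult)
        also have "\<dots> = a ^ n / a ^ l" using elim ab by (simp add: power_diff)
        also have "\<dots> \<le> b ^ n / 2" using elim(4) ab by (simp add: field_simps)
        also have "\<dots> \<le> walk n (n - 1) / 2" using elim(3) by simp
        also have "\<dots> < x n" by (rule elim(1))
        finally show False by simp
      qed
    qed
  qed
  from tendsto_mult[OF tendsto_divide[OF this tendsto_const[of "p j"]] lim]
  have "((\<lambda>n. p j * y n / x n / p j * (x n / walk n (n - 1))) \<longlongrightarrow> 1) admissible"
    using j by (simp add: x_def)
  then show ?thesis
  proof (rule Lim_transform_eventually)
    show "\<forall>\<^sub>F n in admissible. p j * y n / x n / p j * (x n / walk n (n - 1)) = walk (n - Suc l) (n - 1 - (k + j)) / walk n (n - 1)"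
      using xpos by eventually_elim (use j in \<open>simp add: y_def\<close>)
  qed
qed

lemma walk_ratio:
  assumes "\<And>j. j \<in> set js \<Longrightarrow> 0 < p j"
  shows "((\<lambda>n. walk (n - length js) (n - 1 - sum_list js) / walk n (n - 1)) \<longlongrightarrow> 1) admissible"
  using assms
proof (induction js rule: rev_induct)
  case Nil
  show ?case
  proof (rule Lim_transform_eventually[OF tendsto_const])
    show "\<forall>\<^sub>F n in admissible. 1 = walk (n - length []) (n - 1 - sum_list []) / walk n (n - 1)"
      using walk_hitting_pos by eventually_elim simp
  qed
next
  case (snoc j js)
  then show ?case using walk_ratio_step[of j "length js" "sum_list js"] by simp
qed

lemma Zn_pos: "\<forall>\<^sub>F n in admissible. 0 < Zn p n"
  using walk_hitting_pos eventually_admissible[OF eventually_gt_at_top[of 0]]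
proof eventually_elim
  case (elim n)
  then show ?case using Zn_eq[of n p] by (metis walk_def zero_less_mult_iff of_nat_0_less_iff not_less_iff_gr_or_eq)
qed

lemma fringe_proportion_tendsto:
  "((\<lambda>n. (\<Sum>t\<in>{t. tsize t = n}. tweight p t * real (fringe_count s t)) / (real n * Zn p n)) \<longlongrightarrow> tweight p s) admissible"
proof -
  have eq: "\<forall>\<^sub>F n in admissible. tweight p s * (walk (n - tsize s) (n - tsize s) / walk n (n - 1)) =
    (\<Sum>t\<in>{t. tsize t = n}. tweight p t * real (fringe_count s t)) / (real n * Zn p n)"
    using eventually_admissible[OF eventually_gt_at_top[of "tsize s"]]
    by eventually_elim (simp add: fringe_count_eq Zn_eq walk_def)
  have "((\<lambda>n. tweight p s * (walk (n - tsize s) (n - tsize s) / walk n (n - 1))) \<longlongrightarrow> tweight p s) admissible"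
  \<comment> \<open>If some outdegree of \<open>s\<close> has probability 0, both sides vanish;
    otherwise \<open>walk_ratio\<close> applies to its degree word.\<close>
  proof (cases "tweight p s = 0")
    case False
    then have "prod_list (map p (preorder_degs s)) \<noteq> 0" by (simp add: prod_list_preorder_degs)
    then have pos: "0 < p j" if "j \<in> set (preorder_degs s)" for j
      using that p_nonneg[of j] by (auto simp: less_le prod_list_zero_iff)
    from walk_ratio[of "preorder_degs s", OF pos]
    have "((\<lambda>n. walk (n - tsize s) (n - 1 - sum_list (preorder_degs s)) / walk n (n - 1)) \<longlongrightarrow> 1) admissible"
      by (simp add: length_preorder_degs)
    moreover have "n - 1 - sum_list (preorder_degs s) = n - tsize s" for n using sum_list_preorder_degs[of s] by linarith
    ultimately show ?thesis using tendsto_mult[OF tendsto_const[of "tweight p s"]] by fastforce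
  qed simp
  then show ?thesis using eq by (rule Lim_transform_eventually)
qed

end

section \<open>Pointed trees in the ambient tree\<close>

fun subtree_at :: "ptree \<Rightarrow> nat list \<Rightarrow> ptree" where
  "subtree_at t [] = t"
| "subtree_at (Node ts) (i # u) = subtree_at (ts ! i) u"

lemma isaddr_Nil [simp]: "isaddr t []"
  by (cases t) auto

lemma isaddr_append: "isaddr t (u @ v) \<longleftrightarrow> isaddr t u \<and> isaddr (subtree_at t u) v"
proof (induction u arbitrary: t)
  case (Cons i u)
  then show ?case by (cases t) auto
qed simp

lemma deg_append: "isaddr t u \<Longrightarrow> deg t (u @ v) = deg (subtree_at t u) v"
proof (induction u arbitrary: t)
  case (Cons i u)
  then show ?case by (cases t) (auto split: if_splits)
qed simp

lemma deg_eq_0: "\<not> isaddr t u \<Longrightarrow> deg t u = 0"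
proof (induction u arbitrary: t)
  case (Cons i u)
  then show ?case by (cases t) auto
qed simp

lemma isaddr_snoc: "isaddr t (u @ [i]) \<longleftrightarrow> isaddr t u \<and> i < deg t u"
proof (induction u arbitrary: t)
  case Nil
  then show ?case by (cases t) auto
next
  case (Cons j u)
  then show ?case by (cases t) auto
qed

lemma isaddr_take: "isaddr t v \<Longrightarrow> isaddr t (take k v)"
  by (metis append_take_drop_id isaddr_append)

lemma isaddr_take_nth: "isaddr t v \<Longrightarrow> k < length v \<Longrightarrow> v ! k < deg t (take k v)"
  by (metis isaddr_snoc isaddr_take take_Suc_conv_app_nth)

text \<open>The right-hand side has the form in which \<open>isv\<close> tests a word below a given
  vertex.\<close>

lemma isaddr_extend:
  "isaddr t u \<Longrightarrow> isaddr t (u @ ws) \<longleftrightarrow> (\<forall>k<length ws. ws ! k < deg t (u @ take k ws))"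
proof (induction ws rule: rev_induct)
  case (snoc a ws)
  have "isaddr t (u @ ws @ [a]) \<longleftrightarrow> isaddr t (u @ ws) \<and> a < deg t (u @ ws)"
    using isaddr_snoc[of t "u @ ws" a] by simp
  with snoc show ?case by (auto simp: less_Suc_eq nth_append)
qed simp

lemma addrs_Node: "addrs (Node ts) = insert [] (\<Union>i<length ts. (#) i ` addrs (ts ! i))"
proof (intro set_eqI)
  fix u
  show "u \<in> addrs (Node ts) \<longleftrightarrow> u \<in> insert [] (\<Union>i<length ts. (#) i ` addrs (ts ! i))"
    by (cases u) (auto simp: addrs_def)
qed

lemma finite_addrs: "finite (addrs t)"
  by (induction t) (simp add: addrs_Node)

lemma sum_addrs_Node:
  "(\<Sum>u\<in>addrs (Node ts). g u) = g [] + (\<Sum>i<length ts. \<Sum>u\<in>addrs (ts ! i). g (i # u))"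
proof -
  have "(\<Sum>u\<in>(\<Union>i<length ts. (#) i ` addrs (ts ! i)). g u) = (\<Sum>i<length ts. \<Sum>u\<in>(#) i ` addrs (ts ! i). g u)"
    by (intro sum.UNION_disjoint) (auto simp: finite_addrs)
  then show ?thesis unfolding addrs_Node
    by (subst sum.insert) (auto simp: finite_addrs sum.reindex)
qed

lemma prod_addrs_Node:
  "(\<Prod>u\<in>addrs (Node ts). g u) = g [] * (\<Prod>i<length ts. \<Prod>u\<in>addrs (ts ! i). g (i # u))"
proof -
  have "(\<Prod>u\<in>(\<Union>i<length ts. (#) i ` addrs (ts ! i)). g u) = (\<Prod>i<length ts. \<Prod>u\<in>(#) i ` addrs (ts ! i). g u)"
    by (intro prod.UNION_disjoint) (auto simp: finite_addrs)
  then show ?thesis unfolding addrs_Node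
    by (subst prod.insert) (auto simp: finite_addrs prod.reindex)
qed

lemma sum_list_map_nth: "sum_list (map g ts) = (\<Sum>i<length ts. g (ts ! i))"
  by (simp add: sum_list_sum_nth atLeast0LessThan)

lemma prod_list_map_nth: "prod_list (map g ts) = (\<Prod>i<length ts. g (ts ! i))"
  by (simp add: prod.list_conv_set_nth atLeast0LessThan)

lemma card_addrs: "card (addrs t) = tsize t"
proof -
  have "(\<Sum>u\<in>addrs t. 1) = tsize t"
    by (induction t) (simp add: sum_addrs_Node sum_list_map_nth del: sum_constant)
  then show ?thesis by simp
qed

lemma card_level: "card {v \<in> addrs t. length v = h} = level_size h t"
proof -
  have "(\<Sum>v\<in>addrs t. if length v = h then 1 else 0) = level_size h t"
  proof (induction h t rule: level_size.induct)
    case (1 t)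
    have "[] \<in> addrs t" by (simp add: addrs_def)
    then show ?case by (simp add: finite_addrs)
  next
    case (2 h ts)
    then show ?case by (simp add: sum_addrs_Node sum_list_map_nth)
  qed
  then show ?thesis by (simp add: sum.If_cases finite_addrs Int_def)
qed

lemma card_fringe: "card {u \<in> addrs t. subtree_at t u = s} = fringe_count s t"
proof -
  have "(\<Sum>u\<in>addrs t. if subtree_at t u = s then 1 else 0) = fringe_count s t"
    by (induction t) (simp add: sum_addrs_Node sum_list_map_nth)
  then show ?thesis by (simp add: sum.If_cases finite_addrs Int_def)
qed

lemma tweight_eq_prod: "tweight w t = (\<Prod>u\<in>addrs t. w (deg t u))"
  by (induction t) (simp add: prod_addrs_Node prod_list_map_nth)

lemma deg_inj: "(\<And>u. deg t u = deg t' u) \<Longrightarrow> t = t'"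
proof (induction t arbitrary: t')
  case (Node ts)
  obtain ts' where t': "t' = Node ts'" by (cases t')
  have len: "length ts = length ts'" using Node.prems[of "[]"] by (simp add: t')
  have "ts ! i = ts' ! i" if "i < length ts" for i
  proof (rule Node.IH)
    show "ts ! i \<in> set ts" using that by simp
    show "deg (ts ! i) u = deg (ts' ! i) u" for u
      using Node.prems[of "i # u"] that len by (simp add: t')
  qed
  then show ?case using len by (simp add: t' list_eq_iff_nth_eq)
qed

text \<open>As in the definition of \<^const>\<open>enc\<close>, the index \<open>i\<close> refers to the spine vertex \<open>u\<^sub>i\<^sub>+\<^sub>1\<close>, and positions are
  those of \<open>u\<^sub>i\<close> and its siblings.\<close>
definition spine_addr :: "nat list \<Rightarrow> nat \<Rightarrow> nat list" where
  "spine_addr v i = take (length v - Suc i) v"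

definition spine_pos :: "nat list \<Rightarrow> nat \<Rightarrow> nat" where
  "spine_pos v i = v ! (length v - Suc i)"

definition side_ok :: "ptree \<Rightarrow> nat list \<Rightarrow> nat \<Rightarrow> bool \<Rightarrow> nat \<Rightarrow> bool" where
  "side_ok t v i l j \<longleftrightarrow> i < length v \<and>
     (if l then j < spine_pos v i else spine_pos v i + Suc j < deg t (spine_addr v i))"

definition side_addr :: "nat list \<Rightarrow> nat \<Rightarrow> bool \<Rightarrow> nat \<Rightarrow> nat list" where
  "side_addr v i l j = spine_addr v i @ [if l then spine_pos v i - Suc j else spine_pos v i + Suc j]"

text \<open>Inverse of the embedding: the address in the tree of a vertex other than u_1, u_2, ...;
  meaningful on \<open>verts\<close>.\<close>

fun vert_addr :: "nat list \<Rightarrow> uvert \<Rightarrow> nat list" where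
  "vert_addr v (Below0 ws) = v @ ws"
| "vert_addr v (Side i l j ws) = side_addr v i l j @ ws"

definition verts :: "ptree \<Rightarrow> nat list \<Rightarrow> uvert set" where
  "verts t v = {x. isv (enc t v) x}"

lemma enc_Below0: "fst (enc t v) (Below0 ws) = enat (deg t (v @ ws))"
  by (simp add: enc_def Let_def)

lemma enc_Side:
  "fst (enc t v) (Side i l j ws) = (if side_ok t v i l j then enat (deg t (side_addr v i l j @ ws)) else 0)"
  by (simp add: enc_def Let_def side_ok_def side_addr_def spine_addr_def spine_pos_def Suc_le_eq)

lemma enc_spine:
  "snd (enc t v) i = (if i < length v
     then (False, enat (spine_pos v i), enat (deg t (spine_addr v i) - Suc (spine_pos v i))) else (True, 0, 0))"
  by (simp add: enc_def Let_def spine_addr_def spine_pos_def Suc_le_eq)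

lemma spine_pos_less: "isaddr t v \<Longrightarrow> i < length v \<Longrightarrow> spine_pos v i < deg t (spine_addr v i)"
  unfolding spine_pos_def spine_addr_def by (rule isaddr_take_nth) auto

lemma isaddr_side_addr:
  assumes "isaddr t v" "side_ok t v i l j"
  shows "isaddr t (side_addr v i l j)"
  using assms spine_pos_less[of t v i] unfolding side_addr_def isaddr_snoc
  by (auto simp: side_ok_def spine_addr_def intro: isaddr_take split: if_splits)

lemma isv_enc_Below0: "isaddr t v \<Longrightarrow> isv (enc t v) (Below0 ws) \<longleftrightarrow> isaddr t (v @ ws)"
  by (simp add: enc_Below0 isaddr_extend)

lemma isv_enc_Side:
  assumes "isaddr t v"
  shows "isv (enc t v) (Side i l j ws) \<longleftrightarrow> side_ok t v i l j \<and> isaddr t (side_addr v i l j @ ws)"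
proof -
  have "spine_vertex (enc t v) i \<and>
      enat j < (if l then fst (snd (snd (enc t v) i)) else snd (snd (snd (enc t v) i))) \<longleftrightarrow> side_ok t v i l j"
    by (auto simp: spine_vertex_def enc_spine side_ok_def)
  then show ?thesis
    using isaddr_extend[OF isaddr_side_addr[OF assms], of i l j ws] by (auto simp: enc_Side)
qed

lemma enc_verts:
  assumes "isaddr t v" "x \<in> verts t v"
  shows "fst (enc t v) x = enat (deg t (vert_addr v x))"
  using assms by (cases x) (auto simp: verts_def isv_enc_Side enc_Below0 enc_Side simp del: isv.simps)

lemma enc_not_isv:
  assumes "isaddr t v" "\<not> isv (enc t v) x"
  shows "fst (enc t v) x = 0"
  using assms by (cases x)
    (auto simp: isv_enc_Below0 isv_enc_Side enc_Below0 enc_Side deg_eq_0 enat_0 simp del: isv.simps)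

lemma enc_in_Tbullet: "isaddr t v \<Longrightarrow> enc t v \<in> Tbullet"
  using enc_not_isv by (auto simp: Tbullet_def enc_spine)

section \<open>Agreement of configurations below a spine vertex\<close>

fun below_level :: "nat \<Rightarrow> uvert \<Rightarrow> bool" where
  "below_level h (Below0 ws) = True"
| "below_level h (Side i l j ws) = (i < h)"

text \<open>Equality of the pointed fringe subtrees at u_h, ignoring everything above:
  \<open>Side i\<close> hangs off u_(i+1), so i < h covers u_1, ..., u_h.\<close>

definition agree :: "nat \<Rightarrow> cfg \<Rightarrow> cfg \<Rightarrow> bool" where
  "agree h F G \<longleftrightarrow> (\<forall>x. below_level h x \<longrightarrow> fst F x = fst G x) \<and> (\<forall>i<h. snd F i = snd G i)"

lemma agree_sym: "agree h F G \<Longrightarrow> agree h G F"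
  by (simp add: agree_def)

lemma agree_trans: "agree h F G \<Longrightarrow> agree h G K \<Longrightarrow> agree h F K"
  by (simp add: agree_def)

lemma below_level_mono: "below_level h x \<Longrightarrow> h \<le> k \<Longrightarrow> below_level k x"
  by (cases x) auto

lemma agree_mono: "agree k F G \<Longrightarrow> h \<le> k \<Longrightarrow> agree h F G"
  by (auto simp: agree_def dest: below_level_mono)

lemma spine_append:
  assumes "i < length v"
  shows "spine_addr (u @ v) i = u @ spine_addr v i" "spine_pos (u @ v) i = spine_pos v i"
proof -
  have "length (u @ v) - Suc i = length u + (length v - Suc i)" using assms by simp
  then show "spine_addr (u @ v) i = u @ spine_addr v i" "spine_pos (u @ v) i = spine_pos v i"
    unfolding spine_addr_def spine_pos_def by (simp_all only: take_append nth_append_length_plus) simp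
qed

lemma side_ok_append:
  "isaddr t u \<Longrightarrow> i < length v \<Longrightarrow> side_ok t (u @ v) i l j \<longleftrightarrow> side_ok (subtree_at t u) v i l j"
  by (simp add: side_ok_def spine_append deg_append)

text \<open>What is seen from the pointed vertex up to its h-th ancestor depends only on the fringe
  subtree at that ancestor. This turns local events for (T_n, v_0) into fringe counts.\<close>

lemma enc_append_agree:
  assumes "isaddr t u"
  shows "agree (length v) (enc t (u @ v)) (enc (subtree_at t u) v)"
proof -
  have "fst (enc t (u @ v)) x = fst (enc (subtree_at t u) v) x" if "below_level (length v) x" for x
    using that by (cases x)
      (auto simp: enc_Below0 enc_Side assms side_ok_append deg_append side_addr_def spine_append)
  then show ?thesis by (auto simp: agree_def enc_spine spine_append deg_append assms)
qed

lemma verts_Nil: "verts t [] = Below0 ` addrs t"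
proof (intro set_eqI)
  fix x show "x \<in> verts t [] \<longleftrightarrow> x \<in> Below0 ` addrs t"
    by (cases x) (auto simp: verts_def isv_enc_Below0 isv_enc_Side side_ok_def addrs_def simp del: isv.simps)
qed

lemma spine_Cons:
  "i < length v \<Longrightarrow> spine_addr (c # v) i = c # spine_addr v i"
  "i < length v \<Longrightarrow> spine_pos (c # v) i = spine_pos v i"
  "spine_addr (c # v) (length v) = []"
  "spine_pos (c # v) (length v) = c"
  using spine_append[of i v "[c]"] by (simp_all add: spine_addr_def spine_pos_def)

text \<open>The new root is a spine vertex, hence not in \<open>verts\<close>; its other children
  start new side trees at index \<open>length v\<close>, numbered outwards from position
  \<open>c\<close>.\<close>

lemma verts_Cons:
  assumes "isaddr (Node ts) (c # v)"
  shows "verts (Node ts) (c # v) = verts (ts ! c) v \<union>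
     ((\<Union>j<c. Side (length v) True j ` addrs (ts ! (c - Suc j))) \<union>
     (\<Union>j<length ts - Suc c. Side (length v) False j ` addrs (ts ! (c + Suc j))))"
proof (intro set_eqI)
  fix x
  have c: "c < length ts" "isaddr (ts ! c) v" using assms by (auto split: if_splits)
  show "x \<in> verts (Node ts) (c # v) \<longleftrightarrow> x \<in> verts (ts ! c) v \<union>
     ((\<Union>j<c. Side (length v) True j ` addrs (ts ! (c - Suc j))) \<union>
     (\<Union>j<length ts - Suc c. Side (length v) False j ` addrs (ts ! (c + Suc j))))"
  proof (cases x)
    case (Below0 ws)
    then show ?thesis using c
      by (auto simp: verts_def isv_enc_Below0[OF assms] isv_enc_Below0[OF c(2)] simp del: isv.simps)
  next
    case (Side i l j ws)
    consider "i < length v" | "i = length v" | "i > length v" by linarith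
    then show ?thesis
    proof cases
      case 1
      then show ?thesis using c Side
        by (auto simp: verts_def isv_enc_Side[OF assms] isv_enc_Side[OF c(2)] side_ok_def side_addr_def spine_Cons
            simp del: isv.simps)
    next
      case 2
      then show ?thesis using c Side
        by (auto simp: verts_def isv_enc_Side[OF assms] isv_enc_Side[OF c(2)] side_ok_def side_addr_def spine_Cons
            addrs_def simp del: isv.simps split: if_splits)
    next
      case 3
      then show ?thesis using c Side
        by (auto simp: verts_def isv_enc_Side[OF assms] isv_enc_Side[OF c(2)] side_ok_def simp del: isv.simps)
    qed
  qed
qed

lemma finite_verts: "isaddr t v \<Longrightarrow> finite (verts t v)"
proof (induction v arbitrary: t)
  case Nil
  then show ?case by (simp add: verts_Nil finite_addrs)
next
  case (Cons c v)
  obtain ts where t: "t = Node ts" by (cases t)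
  have "isaddr (ts ! c) v" using Cons.prems by (auto simp: t split: if_splits)
  with Cons show ?case by (auto simp: t verts_Cons finite_addrs)
qed

text \<open>\<open>verts\<close> and the proper ancestors of \<open>v\<close> together exhaust the
  vertices of \<open>t\<close>. This makes the probability of a cylinder equal to the weight of
  \<open>t\<close>, whatever \<open>v\<close> is.\<close>

lemma prod_verts:
  assumes "isaddr t v"
  shows "(\<Prod>x\<in>verts t v. w (deg t (vert_addr v x))) * (\<Prod>i<length v. w (deg t (spine_addr v i))) = tweight w t"
  using assms
proof (induction v arbitrary: t)
  case Nil
  have "(\<Prod>x\<in>Below0 ` addrs t. w (deg t (vert_addr [] x))) = (\<Prod>u\<in>addrs t. w (deg t u))"
    by (subst prod.reindex) (auto simp: inj_on_def)
  then show ?case by (simp add: verts_Nil tweight_eq_prod)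
next
  case (Cons c v)
  obtain ts where t: "t = Node ts" by (cases t)
  have c: "c < length ts" "isaddr (ts ! c) v" using Cons.prems by (auto simp: t split: if_splits)
  let ?g = "\<lambda>x. w (deg (Node ts) (vert_addr (c # v) x))"
  let ?L = "\<Union>j<c. Side (length v) True j ` addrs (ts ! (c - Suc j))"
  let ?R = "\<Union>j<length ts - Suc c. Side (length v) False j ` addrs (ts ! (c + Suc j))"
  have lev: "below_level (length v) x" if "x \<in> verts (ts ! c) v" for x
    using that by (cases x) (auto simp: verts_def isv_enc_Side[OF c(2)] side_ok_def simp del: isv.simps)
  have "(\<Prod>x\<in>verts t (c # v). ?g x) = (\<Prod>x\<in>verts (ts ! c) v. ?g x) * (\<Prod>x\<in>?L \<union> ?R. ?g x)"
    unfolding t verts_Cons[OF Cons.prems[unfolded t]]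
    by (intro prod.union_disjoint) (auto simp: finite_addrs finite_verts c dest: lev)
  also have "(\<Prod>x\<in>?L \<union> ?R. ?g x) = (\<Prod>x\<in>?L. ?g x) * (\<Prod>x\<in>?R. ?g x)"
    by (intro prod.union_disjoint) (auto simp: finite_addrs)
  also have "(\<Prod>x\<in>?L. ?g x) = (\<Prod>j<c. \<Prod>x\<in>Side (length v) True j ` addrs (ts ! (c - Suc j)). ?g x)"
    by (intro prod.UNION_disjoint) (auto simp: finite_addrs)
  also have "\<dots> = (\<Prod>j<c. tweight w (ts ! (c - Suc j)))"
  proof (intro prod.cong refl)
    fix j assume "j \<in> {..<c}"
    moreover have "c - Suc j < length ts" using c by linarith
    ultimately show "(\<Prod>x\<in>Side (length v) True j ` addrs (ts ! (c - Suc j)). ?g x) = tweight w (ts ! (c - Suc j))"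
      using c by (subst prod.reindex) (auto simp: inj_on_def tweight_eq_prod side_addr_def spine_Cons)
  qed
  also have "\<dots> = (\<Prod>i<c. tweight w (ts ! i))" by (rule prod.nat_diff_reindex)
  also have "(\<Prod>x\<in>?R. ?g x) = (\<Prod>j<length ts - Suc c. \<Prod>x\<in>Side (length v) False j ` addrs (ts ! (c + Suc j)). ?g x)"
    by (intro prod.UNION_disjoint) (auto simp: finite_addrs)
  also have "\<dots> = (\<Prod>j<length ts - Suc c. tweight w (ts ! (j + Suc c)))"
  proof (intro prod.cong refl)
    fix j assume j: "j \<in> {..<length ts - Suc c}"
    moreover have "c + Suc j < length ts" using c j by simp
    ultimately show "(\<Prod>x\<in>Side (length v) False j ` addrs (ts ! (c + Suc j)). ?g x) = tweight w (ts ! (j + Suc c))"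
      using c by (subst prod.reindex) (auto simp: inj_on_def tweight_eq_prod side_addr_def spine_Cons add.commute)
  qed
  also have "\<dots> = (\<Prod>i=Suc c..<length ts. tweight w (ts ! i))"
  proof -
    have "length ts - Suc c + Suc c = length ts" using c by simp
    then show ?thesis
      using prod.shift_bounds_nat_ivl[of "\<lambda>i. tweight w (ts ! i)" 0 "Suc c" "length ts - Suc c"]
      by (simp only: atLeast0LessThan add_0)
  qed
  also have "(\<Prod>x\<in>verts (ts ! c) v. ?g x) = (\<Prod>x\<in>verts (ts ! c) v. w (deg (ts ! c) (vert_addr v x)))"
  proof (intro prod.cong refl)
    fix x assume "x \<in> verts (ts ! c) v"
    then show "?g x = w (deg (ts ! c) (vert_addr v x))"
      using lev[of x] c by (cases x) (auto simp: side_addr_def spine_Cons)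
  qed
  finally have 1: "(\<Prod>x\<in>verts t (c # v). ?g x) = (\<Prod>x\<in>verts (ts ! c) v. w (deg (ts ! c) (vert_addr v x))) *
    ((\<Prod>i<c. tweight w (ts ! i)) * (\<Prod>i=Suc c..<length ts. tweight w (ts ! i)))" .
  have 2: "(\<Prod>i<length (c # v). w (deg t (spine_addr (c # v) i))) = (\<Prod>i<length v. w (deg (ts ! c) (spine_addr v i))) * w (length ts)"
    using c by (simp add: t spine_Cons)
  have disj: "{..<c} \<inter> {Suc c..<length ts} = {}" by auto
  have "{..<length ts} = insert c ({..<c} \<union> {Suc c..<length ts})" using c by auto
  then have "(\<Prod>i<length ts. tweight w (ts ! i)) = tweight w (ts ! c) *
     ((\<Prod>i<c. tweight w (ts ! i)) * (\<Prod>i=Suc c..<length ts. tweight w (ts ! i)))"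
    by (simp add: prod.union_disjoint[OF _ _ disj])
  then have 3: "tweight w t = w (length ts) * (tweight w (ts ! c) *
     ((\<Prod>i<c. tweight w (ts ! i)) * (\<Prod>i=Suc c..<length ts. tweight w (ts ! i))))"
    by (simp add: t prod_list_map_nth)
  show ?case unfolding 3 2 1[folded t] Cons.IH[OF c(2), symmetric] by (simp only: mult_ac)
qed

text \<open>At a given height a configuration determines the pointed tree: the spine label of the
  root yields the position and the number of children, the side entries yield the other subtrees.
  Cylinders are disjoint for this reason.\<close>

lemma enc_agree_inj:
  assumes "isaddr t v" "isaddr t' v'" "length v = length v'" "agree (length v) (enc t v) (enc t' v')"
  shows "t = t' \<and> v = v'"
  using assms
proof (induction v arbitrary: t t' v')
  case Nil
  have "deg t u = deg t' u" for u
    using Nil.prems by (auto simp: agree_def enc_Below0 dest!: spec[of _ "Below0 u"])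
  then show ?case using deg_inj[of t t'] Nil.prems by simp
next
  case (Cons c v)
  obtain c' u where v': "v' = c' # u" "length u = length v" using Cons.prems(3) by (cases v') auto
  obtain ts ts' where t: "t = Node ts" "t' = Node ts'" by (cases t, cases t')
  have c: "c < length ts" "isaddr (ts ! c) v" "c' < length ts'" "isaddr (ts' ! c') u"
    using Cons.prems(1,2) by (auto simp: t v' split: if_splits)
  have fsts: "fst (enc t (c # v)) x = fst (enc t' v') x" if "below_level (Suc (length v)) x" for x
    using Cons.prems(4) that by (simp add: agree_def)
  have "snd (enc t (c # v)) (length v) = snd (enc t' v') (length v)"
    using Cons.prems(4) by (simp add: agree_def)
  then have cc: "c = c'" and len: "length ts = length ts'"
    using c v'(2) spine_Cons(3,4)[of c v] spine_Cons(3,4)[of c' u] by (auto simp: enc_spine t v'(1))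
  have "agree (length v) (enc (ts ! c) v) (enc t (c # v))"
    using enc_append_agree[of t "[c]" v] c by (simp add: t agree_sym)
  moreover have "agree (length v) (enc t (c # v)) (enc t' v')"
    using Cons.prems(4) by (rule agree_mono) simp
  moreover have "agree (length v) (enc t' v') (enc (ts' ! c') u)"
    using enc_append_agree[of t' "[c']" u] c v' by (simp add: t)
  ultimately have "agree (length v) (enc (ts ! c) v) (enc (ts' ! c') u)"
    by (meson agree_trans)
  then have IH: "ts ! c = ts' ! c'" "v = u" using Cons.IH c v'(2) by metis+
  have "ts ! i = ts' ! i" if i: "i < length ts" for i
  proof -
    consider "i < c" | "i = c" | "i > c" by linarith
    then show ?thesis
    proof cases
      case 1
      define j where "j = c - Suc i"
      have j: "i = c - Suc j" "j < c" using 1 by (auto simp: j_def)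
      show ?thesis
      proof (rule deg_inj)
        fix ws
        show "deg (ts ! i) ws = deg (ts' ! i) ws"
          using fsts[of "Side (length v) True j ws"] j i c cc len IH(2)
          by (simp add: enc_Side t v'(1) side_ok_def side_addr_def spine_Cons)
      qed
    next
      case 2
      then show ?thesis using IH cc by simp
    next
      case 3
      define j where "j = i - Suc c"
      have j: "i = c + Suc j" using 3 by (auto simp: j_def)
      show ?thesis
      proof (rule deg_inj)
        fix ws
        show "deg (ts ! i) ws = deg (ts' ! i) ws"
          using fsts[of "Side (length v) False j ws"] j i c cc len IH(2)
          by (simp add: enc_Side t v'(1) side_ok_def side_addr_def spine_Cons)
      qed
    qed
  qed
  then have "ts = ts'" using len by (simp add: list_eq_iff_nth_eq)
  then show ?case using cc IH by (simp add: t v'(1))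
qed

section \<open>The pruned limit tree and its cylinder events\<close>

lemma isv_snoc:
  "isv F (Below0 (ws @ [a])) \<longleftrightarrow> isv F (Below0 ws) \<and> enat a < fst F (Below0 ws)"
  "isv F (Side i l j (ws @ [a])) \<longleftrightarrow> isv F (Side i l j ws) \<and> enat a < fst F (Side i l j ws)"
  by (auto simp: less_Suc_eq nth_append)

text \<open>Degrees are compared only at vertices of \<open>G\<close>: whether a word is a vertex
  depends on its proper prefixes, so induction along words suffices. A cylinder fixes no label
  outside the finite tree.\<close>

lemma isv_cong:
  assumes spine: "\<And>i. i < h \<Longrightarrow> snd F i = snd G i"
    and fst: "\<And>x. below_level h x \<Longrightarrow> isv G x \<Longrightarrow> fst F x = fst G x"
    and x: "below_level h x"
  shows "isv F x \<longleftrightarrow> isv G x"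
proof (cases x)
  case (Below0 ws)
  have "isv F (Below0 ws) \<longleftrightarrow> isv G (Below0 ws)"
  proof (induction ws rule: rev_induct)
    case (snoc a ws)
    then show ?case using fst[of "Below0 ws"] unfolding isv_snoc by auto
  qed simp
  then show ?thesis by (simp only: Below0)
next
  case (Side i l j ws)
  then have i: "i < h" using x by simp
  have "isv F (Side i l j ws) \<longleftrightarrow> isv G (Side i l j ws)"
  proof (induction ws rule: rev_induct)
    case Nil
    then show ?case using spine[OF i] by (simp add: spine_vertex_def)
  next
    case (snoc a ws)
    then show ?case using fst[of "Side i l j ws"] i unfolding isv_snoc by auto
  qed
  then show ?thesis by (simp only: Side)
qed

lemma Tstar_of_simps:
  "fst (Tstar_of \<omega>) x = (if isv (raw_cfg \<omega>) x then enat (fst \<omega> x) else 0)"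
  "snd (Tstar_of \<omega>) = snd (raw_cfg \<omega>)"
  by (simp_all add: Tstar_of_def Let_def raw_cfg_def)

lemma below_level_exists: "\<exists>h. below_level h x"
  by (cases x) auto

lemma Tstar_of_in_Tbullet: "Tstar_of \<omega> \<in> Tbullet"
proof -
  have "isv (Tstar_of \<omega>) x \<longleftrightarrow> isv (raw_cfg \<omega>) x" for x
  proof -
    obtain h where "below_level h x" using below_level_exists by blast
    moreover have "fst (raw_cfg \<omega>) y = enat (fst \<omega> y)" for y by (simp add: raw_cfg_def)
    ultimately show ?thesis by (intro isv_cong[of h]) (auto simp: Tstar_of_simps)
  qed
  moreover have "\<not> fst (snd (Tstar_of \<omega>) i)" for i by (simp add: Tstar_of_simps raw_cfg_def)
  ultimately show ?thesis by (auto simp: Tbullet_def Tstar_of_simps(1))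
qed

text \<open>The labels that give the limit tree the fringe subtree \<open>t\<close>, pointed at
  \<open>v\<close>, at the spine vertex u_h with h = \<open>length v\<close>. Only finitely many are
  prescribed; labels that pruning discards stay free.\<close>

definition cylinder :: "ptree \<Rightarrow> nat list \<Rightarrow> ((uvert \<Rightarrow> nat) \<times> (nat \<Rightarrow> nat \<times> nat)) set" where
  "cylinder t v = {a. \<forall>x\<in>verts t v. a x = deg t (vert_addr v x)} \<times>
     {b. \<forall>i\<in>{..<length v}. b i = (deg t (spine_addr v i), spine_pos v i)}"

lemma Tstar_of_agree:
  assumes "isaddr t v" "\<omega> \<in> cylinder t v"
  shows "agree (length v) (Tstar_of \<omega>) (enc t v)"
proof -
  have spine: "snd (raw_cfg \<omega>) i = snd (enc t v) i" if "i < length v" for i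
    using assms(2) that by (auto simp: cylinder_def raw_cfg_def enc_spine)
  have fst: "fst (raw_cfg \<omega>) x = fst (enc t v) x" if "isv (enc t v) x" for x
    using assms that enc_verts[OF assms(1), of x] by (auto simp: cylinder_def raw_cfg_def verts_def)
  have "fst (Tstar_of \<omega>) x = fst (enc t v) x" if "below_level (length v) x" for x
  proof -
    have "isv (raw_cfg \<omega>) x \<longleftrightarrow> isv (enc t v) x"
      using spine fst that by (intro isv_cong) auto
    then show ?thesis using fst[of x] enc_not_isv[OF assms(1), of x] by (auto simp: Tstar_of_simps(1) raw_cfg_def)
  qed
  then show ?thesis using spine by (simp add: agree_def Tstar_of_simps(2))
qed

lemma cylinder_disjoint:
  assumes "isaddr t v" "isaddr t' v'" "length v = length v'" "(t, v) \<noteq> (t', v')"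
  shows "cylinder t v \<inter> cylinder t' v' = {}"
proof (rule ccontr)
  assume "cylinder t v \<inter> cylinder t' v' \<noteq> {}"
  then obtain \<omega> where "\<omega> \<in> cylinder t v" "\<omega> \<in> cylinder t' v'" by blast
  then have "agree (length v) (enc t v) (enc t' v')"
    using Tstar_of_agree assms by (metis agree_sym agree_trans)
  then show False using enc_agree_inj assms by blast
qed

section \<open>Convergence to the limit tree\<close>

instance ptree :: countable by countable_datatype

text \<open>At most one pattern of \<open>D\<close> matches. If one does, the error is at most e; if
  none does, it is at most K, and the last factor is the indicator of that case. The inequality is
  used pointwise both for T_n and for the limit tree.\<close>

lemma approx_by_matching:
  fixes y :: real
  assumes D: "finite D" and e: "0 \<le> e" and K: "\<bar>y\<bar> \<le> K"
    and uniq: "\<And>x x'. x \<in> D \<Longrightarrow> x' \<in> D \<Longrightarrow> P x \<Longrightarrow> P x' \<Longrightarrow> x = x'"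
    and close: "\<And>x. x \<in> D \<Longrightarrow> P x \<Longrightarrow> \<bar>y - c x\<bar> \<le> e"
  shows "\<bar>y - (\<Sum>x\<in>D. c x * of_bool (P x))\<bar> \<le> e + K * (1 - (\<Sum>x\<in>D. of_bool (P x)))"
proof (cases "\<exists>x\<in>D. P x")
  case True
  then obtain x where x: "x \<in> D" "P x" by blast
  then have eq: "P x' \<longleftrightarrow> x' = x" if "x' \<in> D" for x' using uniq that by blast
  have "(\<Sum>x'\<in>D. c x' * of_bool (P x')) = (\<Sum>x'\<in>D. if x' = x then c x' else 0)"
    by (intro sum.cong refl) (simp add: eq)
  moreover have "(\<Sum>x'\<in>D. of_bool (P x') :: real) = (\<Sum>x'\<in>D. if x' = x then 1 else 0)"
    by (intro sum.cong refl) (simp add: eq)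
  ultimately show ?thesis using x close[OF x] D by simp
next
  case False
  then show ?thesis using e K by simp
qed

section \<open>Topology and measurability\<close>

lemma tendsto_componentwise:
  fixes f :: "'c \<Rightarrow> 'a \<Rightarrow> 'b :: topological_space"
  assumes "\<And>x. ((\<lambda>n. f n x) \<longlongrightarrow> g x) F"
  shows "(f \<longlongrightarrow> g) F"
proof -
  have "limitin (product_topology (\<lambda>_. euclidean) UNIV) f g F"
    using assms by (simp add: limitin_componentwise)
  then show ?thesis by (simp add: euclidean_product_topology)
qed

lemma tendsto_of_agree:
  assumes "\<And>h. agree h (G h) F"
  shows "G \<longlonglongrightarrow> F"
proof -
  have "(\<lambda>h. fst (G h) x) \<longlonglongrightarrow> fst F x" for x
  proof -
    obtain h0 where h0: "below_level h0 x" using below_level_exists by blast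
    show ?thesis
      by (intro tendsto_eventually eventually_sequentiallyI[of h0])
         (use assms h0 below_level_mono in \<open>force simp: agree_def\<close>)
  qed
  moreover have "(\<lambda>h. snd (G h) i) \<longlonglongrightarrow> snd F i" for i
    by (intro tendsto_eventually eventually_sequentiallyI[of "Suc i"])
       (use assms in \<open>force simp: agree_def\<close>)
  ultimately have "(\<lambda>h. (fst (G h), snd (G h))) \<longlonglongrightarrow> (fst F, snd F)"
    by (intro tendsto_Pair tendsto_componentwise)
  then show ?thesis by simp
qed

text \<open>Violating configurations chosen for every h would agree with \<open>F\<close> on ever
  larger fringe subtrees and so converge to \<open>F\<close>. The threshold depends on
  \<open>F\<close>; no compactness is used.\<close>

lemma continuous_on_Tbullet_local:
  fixes f :: "cfg \<Rightarrow> real"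
  assumes f: "continuous_on Tbullet f" and F: "F \<in> Tbullet" and e: "0 < e"
  shows "\<exists>h0. \<forall>h\<ge>h0. \<forall>G\<in>Tbullet. agree h G F \<longrightarrow> \<bar>f G - f F\<bar> < e"
proof -
  have "\<exists>h0. \<forall>G\<in>Tbullet. agree h0 G F \<longrightarrow> \<bar>f G - f F\<bar> < e"
  proof (rule ccontr)
    assume "\<not> ?thesis"
    then have "\<forall>h. \<exists>G. G \<in> Tbullet \<and> agree h G F \<and> e \<le> \<bar>f G - f F\<bar>" by (meson not_less)
    then obtain G where G: "\<And>h. G h \<in> Tbullet" "\<And>h. agree h (G h) F" "\<And>h. e \<le> \<bar>f (G h) - f F\<bar>"
      by metis
    have "(\<lambda>h. f (G h)) \<longlonglongrightarrow> f F"
      using continuous_on_tendsto_compose[OF f tendsto_of_agree[of G F] F] G by simp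
    then have "\<forall>\<^sub>F h in sequentially. dist (f (G h)) (f F) < e" using e by (rule tendstoD)
    then obtain h where "\<bar>f (G h) - f F\<bar> < e" by (auto simp: dist_real_def eventually_sequentially)
    then show False using G(3)[of h] by simp
  qed
  then show ?thesis using agree_mono by blast
qed

lemma eventually_nhds_eq_discrete:
  fixes g :: "'a :: topological_space \<Rightarrow> 'b :: discrete_topology"
  assumes "continuous_on UNIV g"
  shows "\<forall>\<^sub>F y in nhds x. g y = g x"
proof -
  have "open (g -` {g x})" using assms by (intro open_vimage open_discrete)
  then show ?thesis by (auto simp: eventually_nhds)
qed

lemma continuous_on_locally_const:
  fixes g :: "'a :: topological_space \<Rightarrow> 'b :: topological_space"
  assumes "\<And>x. \<forall>\<^sub>F y in nhds x. g y = g x"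
  shows "continuous_on UNIV g"
  unfolding continuous_on_def
proof
  fix x
  have "\<forall>\<^sub>F y in at x. g y = g x" using assms[of x] by (simp add: eventually_at_filter eventually_mono)
  then show "(g \<longlongrightarrow> g x) (at x)" by (rule tendsto_eventually)
qed

text \<open>Needed because the Bochner integral of a non-measurable function is 0: a function that is merely
  almost everywhere a limit of cylinder functions would not do.\<close>
lemma continuous_on_Tstar_of: "continuous_on UNIV Tstar_of"
proof -
  have evf: "\<forall>\<^sub>F \<omega>' in nhds \<omega>. fst \<omega>' x = fst \<omega> x" for \<omega> :: "(uvert \<Rightarrow> nat) \<times> (nat \<Rightarrow> nat \<times> nat)" and x
    by (intro eventually_nhds_eq_discrete continuous_on_product_then_coordinatewise[OF continuous_on_fst] continuous_on_id)
  have c2: "continuous_on UNIV (\<lambda>\<omega> :: (uvert \<Rightarrow> nat) \<times> (nat \<Rightarrow> nat \<times> nat). snd \<omega> i)" for i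
    by (intro continuous_on_product_then_coordinatewise[OF continuous_on_snd] continuous_on_id)
  have evs: "\<forall>\<^sub>F \<omega>' in nhds \<omega>. snd \<omega>' i = snd \<omega> i" for \<omega> :: "(uvert \<Rightarrow> nat) \<times> (nat \<Rightarrow> nat \<times> nat)" and i
  proof -
    have "\<forall>\<^sub>F \<omega>' in nhds \<omega>. fst (snd \<omega>' i) = fst (snd \<omega> i)" "\<forall>\<^sub>F \<omega>' in nhds \<omega>. snd (snd \<omega>' i) = snd (snd \<omega> i)"
      by (intro eventually_nhds_eq_discrete continuous_on_fst continuous_on_snd c2)+
    then show ?thesis by eventually_elim (simp add: prod_eq_iff)
  qed
  have isv: "\<forall>\<^sub>F \<omega>' in nhds \<omega>. isv (raw_cfg \<omega>') x = isv (raw_cfg \<omega>) x" for \<omega> x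
  proof (cases x)
    case (Below0 ws)
    have "\<forall>\<^sub>F \<omega>' in nhds \<omega>. isv (raw_cfg \<omega>') (Below0 ws) = isv (raw_cfg \<omega>) (Below0 ws)"
    proof (induction ws rule: rev_induct)
      case (snoc a ws)
      show ?case using snoc evf[of "Below0 ws" \<omega>] unfolding isv_snoc
        by eventually_elim (simp add: raw_cfg_def)
    qed simp
    then show ?thesis by (simp only: Below0)
  next
    case (Side i l j ws)
    have "\<forall>\<^sub>F \<omega>' in nhds \<omega>. isv (raw_cfg \<omega>') (Side i l j ws) = isv (raw_cfg \<omega>) (Side i l j ws)"
    proof (induction ws rule: rev_induct)
      case Nil
      show ?case using evs[of i \<omega>] by eventually_elim (simp add: raw_cfg_def spine_vertex_def)
    next
      case (snoc a ws)
      show ?case using snoc evf[of "Side i l j ws" \<omega>] unfolding isv_snoc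
        by eventually_elim (simp add: raw_cfg_def)
    qed
    then show ?thesis by (simp only: Side)
  qed
  have "continuous_on UNIV (\<lambda>\<omega>. fst (Tstar_of \<omega>) x)" for x
  proof (rule continuous_on_locally_const)
    fix \<omega>
    show "\<forall>\<^sub>F \<omega>' in nhds \<omega>. fst (Tstar_of \<omega>') x = fst (Tstar_of \<omega>) x"
      using isv[of x \<omega>] evf[of x \<omega>] by eventually_elim (simp add: Tstar_of_simps)
  qed
  moreover have "continuous_on UNIV (\<lambda>\<omega>. snd (Tstar_of \<omega>) i)" for i
  proof (rule continuous_on_locally_const)
    fix \<omega>
    show "\<forall>\<^sub>F \<omega>' in nhds \<omega>. snd (Tstar_of \<omega>') i = snd (Tstar_of \<omega>) i"
      using evs[of i \<omega>] by eventually_elim (simp add: Tstar_of_simps raw_cfg_def)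
  qed
  ultimately have "continuous_on UNIV (\<lambda>\<omega>. (fst (Tstar_of \<omega>), snd (Tstar_of \<omega>)))"
    by (intro continuous_on_Pair continuous_on_coordinatewise_then_product)
  then show ?thesis by simp
qed

text \<open>With countably many discrete coordinates the product sigma-algebra is the Borel one, so
  continuity yields measurability.\<close>

lemma sets_label_space: "sets (label_space w) = sets borel"
proof -
  have 1: "sets (PiM UNIV (\<lambda>_ :: uvert. xi_measure w)) = sets borel"
    using sets_PiM_cong[of UNIV UNIV "\<lambda>_. xi_measure w" "\<lambda>_ :: uvert. borel"]
    by (simp add: sets_PiM_equal_borel xi_measure_def sets_borel_eq_count_space)
  have 2: "sets (PiM UNIV (\<lambda>_ :: nat. spine_measure w)) = sets borel"
    using sets_PiM_cong[of UNIV UNIV "\<lambda>_. spine_measure w" "\<lambda>_ :: nat. borel"]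
    by (simp add: sets_PiM_equal_borel spine_measure_def sets_borel_eq_count_space)
  show ?thesis unfolding label_space_def sets_pair_measure_cong[OF 1 2] borel_prod ..
qed

lemma measurable_Tstar_of:
  assumes "continuous_on Tbullet f"
  shows "(\<lambda>\<omega>. f (Tstar_of \<omega>) :: real) \<in> borel_measurable (label_space w)"
proof -
  have "continuous_on UNIV (\<lambda>\<omega>. f (Tstar_of \<omega>))"
    by (rule continuous_on_compose2[OF assms continuous_on_Tstar_of]) (auto simp: Tstar_of_in_Tbullet)
  then have "(\<lambda>\<omega>. f (Tstar_of \<omega>)) \<in> borel_measurable borel" by (rule borel_measurable_continuous_onI)
  then show ?thesis using measurable_cong_sets[OF sets_label_space refl] by blast
qed

definition pointed :: "nat \<Rightarrow> (ptree \<times> nat list) set" where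
  "pointed h = {(t, v). isaddr t v \<and> length v = h}"

section \<open>Label laws and the comparison of expectations\<close>

context
  fixes w :: "nat \<Rightarrow> real"
  assumes crit: "critical_offspring (pik w)"
begin

interpretation critical_offspring "pik w" by (rule crit)

lemma emeasure_xi_singleton: "emeasure (xi_measure w) {k} = ennreal (pik w k)"
  by (simp add: xi_measure_def emeasure_density)

lemma prob_space_xi: "prob_space (xi_measure w)"
proof
  have "emeasure (xi_measure w) UNIV = (\<integral>\<^sup>+k. ennreal (pik w k) \<partial>count_space UNIV)"
    by (simp add: xi_measure_def emeasure_density)
  then show "emeasure (xi_measure w) (space (xi_measure w)) = 1"
    by (simp add: nn_integral_count_space_nat suminf_ennreal_p xi_measure_def)
qed

text \<open>The size bias k and the uniform choice 1 / k cancel, so a spine vertex contributes the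
  same factor as any other vertex.\<close>

lemma emeasure_spine_singleton: "p < k \<Longrightarrow> emeasure (spine_measure w) {(k, p)} = ennreal (pik w k)"
  by (simp add: spine_measure_def emeasure_density)

text \<open>The total mass is the mean of the offspring law; criticality makes the size-biased law
  proper.\<close>

lemma prob_space_spine: "prob_space (spine_measure w)"
proof
  let ?d = "\<lambda>k p. ennreal (real k * pik w k * (if p < k then 1 / real k else 0))"
  have inner: "(\<integral>\<^sup>+p. ?d k p \<partial>count_space UNIV) = of_nat k * ennreal (pik w k)" for k
  proof -
    have "(\<integral>\<^sup>+p. ?d k p \<partial>count_space UNIV) = (\<integral>\<^sup>+p. ennreal (pik w k) * indicator {..<k} p \<partial>count_space UNIV)"
      by (intro nn_integral_cong) (auto simp: indicator_def)
    then show ?thesis by (simp add: nn_integral_cmult_indicator mult.commute)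
  qed
  have "emeasure (spine_measure w) UNIV = (\<integral>\<^sup>+x. (case x of (k, p) \<Rightarrow> ?d k p) \<partial>count_space UNIV)"
    by (simp add: spine_measure_def emeasure_density)
  also have "\<dots> = (\<integral>\<^sup>+k. \<integral>\<^sup>+p. ?d k p \<partial>count_space UNIV \<partial>count_space UNIV)"
    by (subst nn_integral_fst_count_space[symmetric]) simp
  also have "\<dots> = 1" unfolding inner by (simp add: nn_integral_count_space_nat suminf_ennreal_p)
  finally show "emeasure (spine_measure w) (space (spine_measure w)) = 1"
    by (simp add: spine_measure_def)
qed

interpretation xi: product_prob_space "\<lambda>_. xi_measure w" "UNIV :: uvert set"
  by (intro product_prob_spaceI prob_space_xi)

interpretation spine: product_prob_space "\<lambda>_. spine_measure w" "UNIV :: nat set"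
  by (intro product_prob_spaceI prob_space_spine)

interpretation label: prob_space "label_space w"
  unfolding label_space_def by (intro prob_space_pair xi.prob_space_axioms spine.prob_space_axioms)

lemma space_label: "space (label_space w) = UNIV"
  by (simp add: label_space_def space_pair_measure space_PiM xi_measure_def spine_measure_def PiE_UNIV_domain)

lemma cylinder_measure:
  assumes "isaddr t v"
  shows "cylinder t v \<in> sets (label_space w)" "emeasure (label_space w) (cylinder t v) = ennreal (tweight (pik w) t)"
proof -
  let ?A = "{a. \<forall>x\<in>verts t v. a x = deg t (vert_addr v x)}"
  let ?B = "{b. \<forall>i\<in>{..<length v}. b i = (deg t (spine_addr v i), spine_pos v i)}"
  have spA: "space (PiM UNIV (\<lambda>_ :: uvert. xi_measure w)) = UNIV"
    by (simp add: space_PiM xi_measure_def PiE_UNIV_domain)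
  have spB: "space (PiM UNIV (\<lambda>_ :: nat. spine_measure w)) = UNIV"
    by (simp add: space_PiM spine_measure_def PiE_UNIV_domain)
  have sA: "?A \<in> sets (PiM UNIV (\<lambda>_ :: uvert. xi_measure w))"
  proof -
    have "?A = prod_emb UNIV (\<lambda>_. xi_measure w) (verts t v) (PiE (verts t v) (\<lambda>x. {deg t (vert_addr v x)}))"
      using spA by (auto simp: prod_emb_def space_PiM PiE_iff)
    then show ?thesis using finite_verts[OF assms] by (auto intro!: sets_PiM_I simp: xi_measure_def)
  qed
  have sB: "?B \<in> sets (PiM UNIV (\<lambda>_ :: nat. spine_measure w))"
  proof -
    have "?B = prod_emb UNIV (\<lambda>_. spine_measure w) {..<length v} (PiE {..<length v} (\<lambda>i. {(deg t (spine_addr v i), spine_pos v i)}))"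
      using spB by (auto simp: prod_emb_def space_PiM PiE_iff)
    then show ?thesis by (auto intro!: sets_PiM_I simp: spine_measure_def)
  qed
  show "cylinder t v \<in> sets (label_space w)"
    unfolding cylinder_def label_space_def using sA sB by (rule pair_measureI)
  have eA: "emeasure (PiM UNIV (\<lambda>_ :: uvert. xi_measure w)) ?A = ennreal (\<Prod>x\<in>verts t v. pik w (deg t (vert_addr v x)))"
    using xi.emeasure_PiM_Collect[of "verts t v" "\<lambda>x. {deg t (vert_addr v x)}"] finite_verts[OF assms] spA
    by (simp add: emeasure_xi_singleton prod_ennreal p_nonneg) (simp add: xi_measure_def)
  have eB: "emeasure (PiM UNIV (\<lambda>_ :: nat. spine_measure w)) ?B = ennreal (\<Prod>i<length v. pik w (deg t (spine_addr v i)))"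
    using spine.emeasure_PiM_Collect[of "{..<length v}" "\<lambda>i. {(deg t (spine_addr v i), spine_pos v i)}"] spB
      spine_pos_less[OF assms]
    by (simp add: emeasure_spine_singleton prod_ennreal p_nonneg) (simp add: spine_measure_def)
  show "emeasure (label_space w) (cylinder t v) = ennreal (tweight (pik w) t)"
    unfolding cylinder_def label_space_def
    by (subst spine.emeasure_pair_measure_Times[OF sA sB])
       (simp add: eA eB ennreal_mult[symmetric] prod_nonneg p_nonneg prod_verts[OF assms])
qed

lemma disjoint_cylinders: "disjoint_family_on (\<lambda>(t, v). cylinder t v) (pointed h)"
  unfolding disjoint_family_on_def pointed_def using cylinder_disjoint by fastforce

text \<open>The probabilities of these disjoint cylinders add up to the mean size of generation h,
  which is 1.\<close>

lemma AE_cylinder: "AE \<omega> in label_space w. \<exists>(t, v)\<in>pointed h. \<omega> \<in> cylinder t v"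
proof -
  let ?U = "\<Union>(t, v)\<in>pointed h. cylinder t v"
  have sets: "?U \<in> sets (label_space w)"
    by (intro sets.countable_UN'') (auto simp: pointed_def cylinder_measure)
  have "emeasure (label_space w) ?U = (\<integral>\<^sup>+x. emeasure (label_space w) (case x of (t, v) \<Rightarrow> cylinder t v) \<partial>count_space (pointed h))"
    by (intro emeasure_UN_countable disjoint_cylinders) (auto simp: pointed_def cylinder_measure)
  also have "\<dots> = (\<integral>\<^sup>+x. ennreal (tweight (pik w) (fst x)) \<partial>count_space (pointed h))"
    by (intro nn_integral_cong) (auto simp: pointed_def cylinder_measure)
  also have "\<dots> = (\<integral>\<^sup>+x. ennreal (tweight (pik w) (fst x)) * indicator (pointed h) x \<partial>count_space UNIV)"
    by (simp add: nn_integral_count_space_indicator)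
  also have "\<dots> = (\<integral>\<^sup>+t. \<integral>\<^sup>+v. ennreal (tweight (pik w) t) * indicator {v \<in> addrs t. length v = h} v \<partial>count_space UNIV \<partial>count_space UNIV)"
    by (subst nn_integral_fst_count_space[symmetric]) (simp add: pointed_def addrs_def indicator_def)
  also have "\<dots> = (\<integral>\<^sup>+t. ennreal (tweight (pik w) t) * of_nat (level_size h t) \<partial>count_space UNIV)"
    by (intro nn_integral_cong)
       (simp add: nn_integral_cmult_indicator emeasure_count_space_finite finite_addrs card_level)
  also have "\<dots> = 1" by (rule level_mass)
  finally have "label.prob ?U = 1" by (simp add: measure_def)
  then have "AE \<omega> in label_space w. \<omega> \<in> ?U" using sets label.prob_eq_1 by blast
  then show ?thesis by (auto elim: eventually_mono)
qed

text \<open>Stands in for uniform continuity. For almost every realisation the cylinder at height h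
  is good for all large h, so a single height works up to probability e; a finite set of its
  cylinders then suffices by exhaustion.\<close>

lemma good_cylinders:
  fixes f :: "cfg \<Rightarrow> real"
  assumes f: "continuous_on Tbullet f" and e: "0 < e"
  obtains h D where "finite D" "D \<subseteq> pointed h" "1 - e < (\<Sum>(t, v)\<in>D. tweight (pik w) t)"
    "\<And>t v G. (t, v) \<in> D \<Longrightarrow> G \<in> Tbullet \<Longrightarrow> agree h G (enc t v) \<Longrightarrow> \<bar>f G - f (enc t v)\<bar> \<le> e"
proof -
  define good where "good h = {(t, v)\<in>pointed h. \<forall>G\<in>Tbullet. agree h G (enc t v) \<longrightarrow> \<bar>f G - f (enc t v)\<bar> \<le> e}" for h
  define A where "A h = (\<Union>(t, v)\<in>good h. cylinder t v)" for h
  \<comment> \<open>\<open>A\<close> need not increase, since passing to height h + 1 may turn the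
    error e into 2 e; \<open>B\<close> increases by construction.\<close>
  define B where "B H = (\<Inter>h\<in>{H..}. A h)" for H
  have cyl: "(case x of (t, v) \<Rightarrow> cylinder t v) \<in> sets (label_space w)" if "x \<in> good h" for x h
    using that by (auto simp: good_def pointed_def cylinder_measure)
  have A: "A h \<in> sets (label_space w)" for h
    unfolding A_def by (intro sets.countable_UN'' cyl) auto
  have B: "B H \<in> sets (label_space w)" for H
    unfolding B_def by (intro sets.countable_INT') (auto simp: A)
  have incB: "incseq B" by (auto simp: incseq_def B_def)
  have "AE \<omega> in label_space w. \<forall>h. \<exists>(t, v)\<in>pointed h. \<omega> \<in> cylinder t v"
    by (subst AE_all_countable) (intro allI AE_cylinder)
  then have "AE \<omega> in label_space w. \<omega> \<in> (\<Union>H. B H)"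
  proof (rule eventually_mono)
    fix \<omega> assume \<omega>: "\<forall>h. \<exists>(t, v)\<in>pointed h. \<omega> \<in> cylinder t v"
    \<comment> \<open>Half of e, because \<open>G\<close> and the encoding are compared through the
      realised limit tree.\<close>
    obtain h0 where h0: "\<And>h G. h \<ge> h0 \<Longrightarrow> G \<in> Tbullet \<Longrightarrow> agree h G (Tstar_of \<omega>) \<Longrightarrow> \<bar>f G - f (Tstar_of \<omega>)\<bar> < e / 2"
      using continuous_on_Tbullet_local[OF f Tstar_of_in_Tbullet[of \<omega>], of "e / 2"] e by auto
    have "\<omega> \<in> A h" if h: "h \<ge> h0" for h
    proof -
      obtain t v where tv: "isaddr t v" "length v = h" "\<omega> \<in> cylinder t v"
        using spec[OF \<omega>, of h] by (auto simp: pointed_def)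
      have ag: "agree h (enc t v) (Tstar_of \<omega>)" using Tstar_of_agree[OF tv(1,3)] tv(2) agree_sym by blast
      have 1: "\<bar>f (enc t v) - f (Tstar_of \<omega>)\<bar> < e / 2" using h0[OF h enc_in_Tbullet[OF tv(1)] ag] .
      have "\<bar>f G - f (enc t v)\<bar> \<le> e" if "G \<in> Tbullet" "agree h G (enc t v)" for G
        using h0[OF h that(1) agree_trans[OF that(2) ag]] 1 by linarith
      then have "(t, v) \<in> good h" using tv by (auto simp: good_def pointed_def)
      then show ?thesis using tv(3) by (auto simp: A_def)
    qed
    then show "\<omega> \<in> (\<Union>H. B H)" by (auto simp: B_def)
  qed
  then have "label.prob (\<Union>H. B H) = 1" using B by (subst label.prob_eq_1) auto
  then have "(\<lambda>H. label.prob (B H)) \<longlonglongrightarrow> 1"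
    using label.finite_Lim_measure_incseq[OF _ incB] B by (auto simp: image_subset_iff)
  then have "\<forall>\<^sub>F H in sequentially. 1 - e < label.prob (B H)" using e by (intro order_tendstoD) auto
  then obtain h where "1 - e < label.prob (B h)" by (auto simp: eventually_sequentially)
  also have "\<dots> \<le> label.prob (A h)" using A by (intro label.finite_measure_mono) (auto simp: B_def)
  finally have Ah: "1 - e < label.prob (A h)" .
  define D where "D N = {x \<in> good h. to_nat x < N}" for N
  have finD: "finite (D N)" for N
  proof -
    have "finite (to_nat ` D N)" by (rule finite_subset[of _ "{..<N}"]) (auto simp: D_def)
    then show ?thesis by (rule finite_imageD) (simp add: inj_on_subset[OF inj_to_nat])
  qed
  have cD: "(\<Union>(t, v)\<in>D N. cylinder t v) \<in> sets (label_space w)" for N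
    by (intro sets.countable_UN'' cyl[of _ h]) (auto simp: D_def)
  have "(\<lambda>N. label.prob (\<Union>(t, v)\<in>D N. cylinder t v)) \<longlonglongrightarrow> label.prob (\<Union>N. \<Union>(t, v)\<in>D N. cylinder t v)"
  proof (rule label.finite_Lim_measure_incseq)
    show "range (\<lambda>N. \<Union>(t, v)\<in>D N. cylinder t v) \<subseteq> sets (label_space w)" using cD by blast
    show "incseq (\<lambda>N. \<Union>(t, v)\<in>D N. cylinder t v)"
      unfolding incseq_def by (intro allI impI UN_mono) (auto simp: D_def)
  qed
  moreover have "(\<Union>N. \<Union>(t, v)\<in>D N. cylinder t v) = A h" by (fastforce simp: A_def D_def)
  ultimately have "\<forall>\<^sub>F N in sequentially. 1 - e < label.prob (\<Union>(t, v)\<in>D N. cylinder t v)"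
    using Ah by (intro order_tendstoD) auto
  then obtain N where N: "1 - e < label.prob (\<Union>(t, v)\<in>D N. cylinder t v)" by (auto simp: eventually_sequentially)
  have sub: "D N \<subseteq> pointed h" by (auto simp: D_def good_def)
  have "label.prob (\<Union>(t, v)\<in>D N. cylinder t v) = (\<Sum>x\<in>D N. label.prob (case x of (t, v) \<Rightarrow> cylinder t v))"
    using finD cyl[of _ h] disjoint_family_on_mono[OF sub disjoint_cylinders]
    by (intro label.finite_measure_finite_Union) (auto simp: D_def)
  also have "\<dots> = (\<Sum>(t, v)\<in>D N. tweight (pik w) t)"
    using sub by (intro sum.cong refl) (auto simp: pointed_def cylinder_measure measure_def tweight_nonneg)
  finally have "1 - e < (\<Sum>(t, v)\<in>D N. tweight (pik w) t)" using N by simp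
  then show ?thesis by (rule that[OF finD sub]) (auto simp: D_def good_def)
qed

lemma ETstar_approx:
  assumes f: "continuous_on Tbullet f" and K: "\<And>F. F \<in> Tbullet \<Longrightarrow> \<bar>f F\<bar> \<le> K" and e: "0 \<le> e"
    and D: "finite D" "D \<subseteq> pointed h"
    and close: "\<And>t v G. (t, v) \<in> D \<Longrightarrow> G \<in> Tbullet \<Longrightarrow> agree h G (enc t v) \<Longrightarrow> \<bar>f G - f (enc t v)\<bar> \<le> e"
  shows "\<bar>ETstar w f - (\<Sum>(t, v)\<in>D. f (enc t v) * tweight (pik w) t)\<bar> \<le> e + K * (1 - (\<Sum>(t, v)\<in>D. tweight (pik w) t))"
proof -
  let ?C = "\<lambda>x. cylinder (fst x) (snd x)"
  have cyl: "?C x \<in> sets (label_space w)" "label.prob (?C x) = tweight (pik w) (fst x)" if "x \<in> D" for x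
    using that D by (auto simp: pointed_def cylinder_measure measure_def tweight_nonneg)
  have ind: "of_bool (\<omega> \<in> ?C x) = (indicator (?C x) \<omega> :: real)" for x \<omega> by (simp add: indicator_def)
  define g where "g \<omega> = (\<Sum>x\<in>D. f (enc (fst x) (snd x)) * indicator (?C x) \<omega>)" for \<omega>
  define u where "u \<omega> = (\<Sum>x\<in>D. indicator (?C x) \<omega> :: real)" for \<omega>
  have int1: "integrable (label_space w) (\<lambda>\<omega>. f (Tstar_of \<omega>))"
    by (rule label.integrable_const_bound[of _ K]) (auto simp: K Tstar_of_in_Tbullet measurable_Tstar_of f)
  have int2: "integrable (label_space w) g" "integrable (label_space w) u"
    unfolding g_def u_def using cyl by (auto intro!: Bochner_Integration.integrable_sum integrable_mult_right
        integrable_real_indicator simp: label.emeasure_eq_measure)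
  have Eg: "(\<integral>\<omega>. g \<omega> \<partial>label_space w) = (\<Sum>(t, v)\<in>D. f (enc t v) * tweight (pik w) t)"
    unfolding g_def using cyl
    by (subst Bochner_Integration.integral_sum)
       (auto intro!: sum.cong integrable_mult_right integrable_real_indicator simp: space_label label.emeasure_eq_measure)
  have Eu: "(\<integral>\<omega>. u \<omega> \<partial>label_space w) = (\<Sum>(t, v)\<in>D. tweight (pik w) t)"
    unfolding u_def using cyl
    by (subst Bochner_Integration.integral_sum)
       (auto intro!: sum.cong integrable_real_indicator simp: space_label label.emeasure_eq_measure)
  have pw: "\<bar>f (Tstar_of \<omega>) - g \<omega>\<bar> \<le> e + K * (1 - u \<omega>)" for \<omega>
    unfolding g_def u_def ind[symmetric]
  proof (rule approx_by_matching[OF D(1) e K[OF Tstar_of_in_Tbullet]])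
    fix x x' assume *: "x \<in> D" "x' \<in> D" "\<omega> \<in> ?C x" "\<omega> \<in> ?C x'"
    then have "x \<in> pointed h" "x' \<in> pointed h" using D by auto
    then have "x \<noteq> x' \<Longrightarrow> ?C x \<inter> ?C x' = {}" by (intro cylinder_disjoint) (auto simp: pointed_def)
    with * show "x = x'" by blast
  next
    fix x assume x: "x \<in> D" "\<omega> \<in> ?C x"
    then have "isaddr (fst x) (snd x)" "length (snd x) = h" using D by (auto simp: pointed_def)
    then have "agree h (Tstar_of \<omega>) (enc (fst x) (snd x))" using Tstar_of_agree[of "fst x" "snd x" \<omega>] x by simp
    then show "\<bar>f (Tstar_of \<omega>) - f (enc (fst x) (snd x))\<bar> \<le> e"
      using close[of "fst x" "snd x"] x Tstar_of_in_Tbullet by simp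
  qed
  have "\<bar>ETstar w f - (\<Sum>(t, v)\<in>D. f (enc t v) * tweight (pik w) t)\<bar> = \<bar>\<integral>\<omega>. f (Tstar_of \<omega>) - g \<omega> \<partial>label_space w\<bar>"
    unfolding ETstar_def Eg[symmetric] using int1 int2 by simp
  also have "\<dots> \<le> (\<integral>\<omega>. \<bar>f (Tstar_of \<omega>) - g \<omega>\<bar> \<partial>label_space w)"
    by (rule integral_abs_bound)
  also have "\<dots> \<le> (\<integral>\<omega>. e + K * (1 - u \<omega>) \<partial>label_space w)"
    using pw int1 int2 by (intro integral_mono) auto
  also have "\<dots> = e + K * (1 - (\<integral>\<omega>. u \<omega> \<partial>label_space w))"
    using int2 by (simp add: label.prob_space)
  finally show ?thesis by (simp add: Eu)
qed

text \<open>Each fringe subtree of T_n equal to s, rooted at u, yields exactly one vertex v_0 = u v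
  whose h-th ancestor carries the pattern (s, v). Hence the pattern has probability
  \<open>r s\<close>, whatever v is.\<close>

lemma ETn_approx:
  assumes Z: "0 < Zn (pik w) n" "0 < n"
    and K: "\<And>F. F \<in> Tbullet \<Longrightarrow> \<bar>f F\<bar> \<le> K" and e: "0 \<le> e"
    and D: "finite D" "D \<subseteq> pointed h"
    and close: "\<And>t v G. (t, v) \<in> D \<Longrightarrow> G \<in> Tbullet \<Longrightarrow> agree h G (enc t v) \<Longrightarrow> \<bar>f G - f (enc t v)\<bar> \<le> e"
  defines "r \<equiv> \<lambda>s. (\<Sum>t\<in>{t. tsize t = n}. tweight (pik w) t * real (fringe_count s t)) / (real n * Zn (pik w) n)"
  shows "\<bar>ETn (pik w) n f - (\<Sum>(s, v)\<in>D. f (enc s v) * r s)\<bar> \<le> e + K * (1 - (\<Sum>(s, v)\<in>D. r s))"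
proof -
  define q where "q t = tweight (pik w) t / (real n * Zn (pik w) n)" for t
  define T where "T = {t. tsize t = n}"
  define M where "M t x v0 \<longleftrightarrow> v0 \<in> (\<lambda>u. u @ snd x) ` {u \<in> addrs t. subtree_at t u = fst x}" for t x v0
  have q: "0 \<le> q t" for t using Z by (simp add: q_def tweight_nonneg)
  have count: "(\<Sum>v0\<in>addrs t. of_bool (M t x v0) :: real) = real (fringe_count (fst x) t)" if "x \<in> D" for t x
  proof -
    have x: "isaddr (fst x) (snd x)" using that D by (auto simp: pointed_def)
    have "{v0 \<in> addrs t. M t x v0} = (\<lambda>u. u @ snd x) ` {u \<in> addrs t. subtree_at t u = fst x}"
      using x by (auto simp: M_def addrs_def isaddr_append)
    then have "card {v0 \<in> addrs t. M t x v0} = fringe_count (fst x) t"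
      by (simp add: card_image inj_on_def card_fringe)
    then show ?thesis by (simp add: finite_addrs Int_def)
  qed
  have sumq: "(\<Sum>t\<in>T. \<Sum>v0\<in>addrs t. q t) = 1"
  proof -
    have "(\<Sum>t\<in>T. \<Sum>v0\<in>addrs t. q t) = (\<Sum>t\<in>T. tweight (pik w) t / Zn (pik w) n)"
      using Z by (intro sum.cong refl) (simp add: T_def card_addrs q_def)
    then show ?thesis using Z by (simp add: T_def Zn_def sum_divide_distrib[symmetric])
  qed
  have ETn: "ETn (pik w) n f = (\<Sum>t\<in>T. \<Sum>v0\<in>addrs t. q t * f (enc t v0))"
    unfolding ETn_def T_def q_def by (intro sum.cong refl) (simp add: sum_distrib_left sum_divide_distrib mult_ac)
  have r: "r (fst x) = (\<Sum>t\<in>T. \<Sum>v0\<in>addrs t. q t * of_bool (M t x v0))" if "x \<in> D" for x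
    unfolding r_def sum_distrib_left[symmetric] count[OF that] by (simp add: q_def T_def sum_divide_distrib)
  have S1: "(\<Sum>(s, v)\<in>D. f (enc s v) * r s) = (\<Sum>t\<in>T. \<Sum>v0\<in>addrs t. q t * (\<Sum>x\<in>D. f (enc (fst x) (snd x)) * of_bool (M t x v0)))"
  proof -
    have "(\<Sum>(s, v)\<in>D. f (enc s v) * r s) = (\<Sum>x\<in>D. \<Sum>t\<in>T. \<Sum>v0\<in>addrs t. q t * (f (enc (fst x) (snd x)) * of_bool (M t x v0)))"
      unfolding case_prod_unfold by (intro sum.cong refl) (simp add: r sum_distrib_left mult_ac)
    also have "\<dots> = (\<Sum>t\<in>T. \<Sum>v0\<in>addrs t. \<Sum>x\<in>D. q t * (f (enc (fst x) (snd x)) * of_bool (M t x v0)))"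
      by (subst sum.swap) (intro sum.cong refl sum.swap)
    finally show ?thesis by (simp add: sum_distrib_left)
  qed
  have S2: "(\<Sum>(s, v)\<in>D. r s) = (\<Sum>t\<in>T. \<Sum>v0\<in>addrs t. q t * (\<Sum>x\<in>D. of_bool (M t x v0)))"
  proof -
    have "(\<Sum>(s, v)\<in>D. r s) = (\<Sum>x\<in>D. \<Sum>t\<in>T. \<Sum>v0\<in>addrs t. q t * of_bool (M t x v0))"
      unfolding case_prod_unfold by (intro sum.cong refl r)
    also have "\<dots> = (\<Sum>t\<in>T. \<Sum>v0\<in>addrs t. \<Sum>x\<in>D. q t * of_bool (M t x v0))"
      by (subst sum.swap) (intro sum.cong refl sum.swap)
    finally show ?thesis by (simp add: sum_distrib_left)
  qed
  have pw: "\<bar>f (enc t v0) - (\<Sum>x\<in>D. f (enc (fst x) (snd x)) * of_bool (M t x v0))\<bar> \<le> e + K * (1 - (\<Sum>x\<in>D. of_bool (M t x v0)))"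
    if v0: "v0 \<in> addrs t" for t v0
  proof (rule approx_by_matching[OF D(1) e])
    have tv0: "enc t v0 \<in> Tbullet" using v0 by (intro enc_in_Tbullet) (simp add: addrs_def)
    then show "\<bar>f (enc t v0)\<bar> \<le> K" by (rule K)
    fix x assume x: "x \<in> D"
    then have len: "length (snd x) = h" using D by (auto simp: pointed_def)
    {
      fix x' assume "x' \<in> D" "M t x v0" "M t x' v0"
      moreover have "length (snd x') = h" using \<open>x' \<in> D\<close> D by (auto simp: pointed_def)
      \<comment> \<open>Suffixes of equal length h of the same address coincide, hence so do the
        prefixes and the subtrees at them.\<close>
      ultimately show "x = x'" using len by (auto simp: M_def prod_eq_iff)
    }
    assume "M t x v0"
    then obtain u where u: "v0 = u @ snd x" "isaddr t u" "subtree_at t u = fst x" by (auto simp: M_def addrs_def)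
    then have "agree h (enc t v0) (enc (fst x) (snd x))" using enc_append_agree[of t u "snd x"] len by simp
    then show "\<bar>f (enc t v0) - f (enc (fst x) (snd x))\<bar> \<le> e" using close[of "fst x" "snd x"] x tv0 by simp
  qed
  have "\<bar>ETn (pik w) n f - (\<Sum>(s, v)\<in>D. f (enc s v) * r s)\<bar> =
    \<bar>\<Sum>t\<in>T. \<Sum>v0\<in>addrs t. q t * (f (enc t v0) - (\<Sum>x\<in>D. f (enc (fst x) (snd x)) * of_bool (M t x v0)))\<bar>"
    unfolding ETn S1 by (simp add: sum_subtractf[symmetric] right_diff_distrib)
  also have "\<dots> \<le> (\<Sum>t\<in>T. \<bar>\<Sum>v0\<in>addrs t. q t * (f (enc t v0) - (\<Sum>x\<in>D. f (enc (fst x) (snd x)) * of_bool (M t x v0)))\<bar>)"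
    by (rule sum_abs)
  also have "\<dots> \<le> (\<Sum>t\<in>T. \<Sum>v0\<in>addrs t. \<bar>q t * (f (enc t v0) - (\<Sum>x\<in>D. f (enc (fst x) (snd x)) * of_bool (M t x v0)))\<bar>)"
    by (intro sum_mono sum_abs)
  also have "\<dots> \<le> (\<Sum>t\<in>T. \<Sum>v0\<in>addrs t. q t * (e + K * (1 - (\<Sum>x\<in>D. of_bool (M t x v0)))))"
    unfolding abs_mult using q by (intro sum_mono mult_mono pw) auto
  also have "\<dots> = (\<Sum>t\<in>T. \<Sum>v0\<in>addrs t. (e + K) * q t - K * (q t * (\<Sum>x\<in>D. of_bool (M t x v0))))"
    by (intro sum.cong refl) (simp add: algebra_simps)
  also have "\<dots> = (e + K) * (\<Sum>t\<in>T. \<Sum>v0\<in>addrs t. q t) - K * (\<Sum>(s, v)\<in>D. r s)"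
    unfolding S2 by (simp only: sum_subtractf sum_distrib_left)
  also have "\<dots> = e + K * (1 - (\<Sum>(s, v)\<in>D. r s))" unfolding sumq by (simp add: algebra_simps)
  finally show ?thesis .
qed

lemma ETn_tendsto_ETstar:
  assumes f: "continuous_on Tbullet f" and bdd: "bounded (f ` Tbullet)"
  shows "((\<lambda>n. ETn (pik w) n f) \<longlongrightarrow> ETstar w f) admissible"
proof (rule tendstoI)
  fix \<epsilon> :: real assume \<epsilon>: "0 < \<epsilon>"
  obtain K where K0: "K > 0" and K: "\<And>F. F \<in> Tbullet \<Longrightarrow> \<bar>f F\<bar> \<le> K"
    using bdd unfolding bounded_pos by auto
  \<comment> \<open>Three errors, each below e (1 + K): the approximation for T_n, the limit of the
    finite sum, and the approximation for the limit tree.\<close>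
  define e where "e = \<epsilon> / (3 * (1 + K))"
  have e: "0 < e" using \<epsilon> K0 by (simp add: e_def)
  obtain h D where D: "finite D" "D \<subseteq> pointed h" "1 - e < (\<Sum>(t, v)\<in>D. tweight (pik w) t)"
    and close: "\<And>t v G. (t, v) \<in> D \<Longrightarrow> G \<in> Tbullet \<Longrightarrow> agree h G (enc t v) \<Longrightarrow> \<bar>f G - f (enc t v)\<bar> \<le> e"
    using good_cylinders[OF f e] by metis
  define r where "r n s = (\<Sum>t\<in>{t. tsize t = n}. tweight (pik w) t * real (fringe_count s t)) / (real n * Zn (pik w) n)" for n s
  have r: "((\<lambda>n. r n s) \<longlongrightarrow> tweight (pik w) s) admissible" for s
    unfolding r_def by (rule fringe_proportion_tendsto)
  let ?S = "\<Sum>(t, v)\<in>D. f (enc t v) * tweight (pik w) t" and ?m = "\<Sum>(t, v)\<in>D. tweight (pik w) t"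
  have "((\<lambda>n. \<Sum>(t, v)\<in>D. r n t) \<longlongrightarrow> ?m) admissible"
    unfolding case_prod_unfold by (intro tendsto_sum r)
  \<comment> \<open>The mass of the finitely many patterns converges, so under T_n too they miss at
    most e.\<close>
  then have ev1: "\<forall>\<^sub>F n in admissible. 1 - e < (\<Sum>(t, v)\<in>D. r n t)"
    using D(3) by (rule order_tendstoD)
  have "((\<lambda>n. \<Sum>(t, v)\<in>D. f (enc t v) * r n t) \<longlongrightarrow> ?S) admissible"
    unfolding case_prod_unfold by (intro tendsto_intros r)
  then have ev2: "\<forall>\<^sub>F n in admissible. dist (\<Sum>(t, v)\<in>D. f (enc t v) * r n t) ?S < e * (1 + K)"
    using e K0 by (intro tendstoD) auto
  have star: "\<bar>ETstar w f - ?S\<bar> \<le> e + K * (1 - ?m)"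
    using e by (intro ETstar_approx[OF f K _ D(1,2) close]) auto
  have "K * (1 - ?m) < K * e" using D(3) K0 by (intro mult_strict_left_mono) auto
  then have star': "\<bar>ETstar w f - ?S\<bar> < e * (1 + K)" using star by (simp add: algebra_simps)
  show "\<forall>\<^sub>F n in admissible. dist (ETn (pik w) n f) (ETstar w f) < \<epsilon>"
    using ev1 ev2 Zn_pos eventually_admissible[OF eventually_gt_at_top[of 0]]
  proof eventually_elim
    case (elim n)
    have "\<bar>ETn (pik w) n f - (\<Sum>(s, v)\<in>D. f (enc s v) * r n s)\<bar> \<le> e + K * (1 - (\<Sum>(s, v)\<in>D. r n s))"
      unfolding r_def using e 
      by (intro ETn_approx[where f = f and K = K and e = e and D = D and h = h, OF elim(3,4) K _ D(1,2) close]) auto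
    moreover have "K * (1 - (\<Sum>(s, v)\<in>D. r n s)) < K * e" using elim(1) K0 by (intro mult_strict_left_mono) auto
    ultimately have "\<bar>ETn (pik w) n f - (\<Sum>(s, v)\<in>D. f (enc s v) * r n s)\<bar> < e * (1 + K)"
      by (simp add: algebra_simps)
    moreover have "\<bar>(\<Sum>(s, v)\<in>D. f (enc s v) * r n s) - ?S\<bar> < e * (1 + K)" using elim(2) by (simp add: dist_real_def)
    ultimately have "\<bar>ETn (pik w) n f - ETstar w f\<bar> < 3 * (e * (1 + K))" using star' by linarith
    also have "\<dots> = \<epsilon>" using K0 by (simp add: e_def field_simps)
    finally show ?case by (simp add: dist_real_def)
  qed
qed

end

theorem theorem5p1:
  fixes w :: "nat \<Rightarrow> real"
  assumes "weight_seq w" and "typeI w"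
  shows "\<forall>f :: cfg \<Rightarrow> real. continuous_on Tbullet f \<and> bounded (f ` Tbullet) \<longrightarrow>
           ((\<lambda>n. ETn w n f) \<longlongrightarrow> ETstar w f)
             (inf sequentially (principal {n. n mod wspan w = 1 mod wspan w}))"
proof (intro allI impI)
  fix f :: "cfg \<Rightarrow> real"
  assume f: "continuous_on Tbullet f \<and> bounded (f ` Tbullet)"
  interpret critical_offspring "pik w" by (rule critical_offspring_pik[OF assms])
  \<comment> \<open>Tilting keeps the support, hence the span and the filter.\<close>
  have "wspan (pik w) = wspan w" by (simp add: wspan_def pik_pos_iff[OF assms])
  moreover have "((\<lambda>n. ETn (pik w) n f) \<longlongrightarrow> ETstar w f) admissible"
    using f by (intro ETn_tendsto_ETstar critical_offspring_axioms) auto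
  ultimately show "((\<lambda>n. ETn w n f) \<longlongrightarrow> ETstar w f)
             (inf sequentially (principal {n. n mod wspan w = 1 mod wspan w}))"
    by (simp add: ETn_pik[OF assms] admissible_def)
qed

end
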